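(* Let $\mathcal{A}$ be an arrangement in $V=\mathbb{K}^\ell$, let $H\in\mathcal{A}$ and $\mathcal{A}'=\mathcal{A}\setminus\{H\}$. Assume that $\rho^H$ is locally surjective in codimension three along $H$, that $\operatorname{pd}\mathcal{A}=k$, and that $\mathcal{A}'$ is NMPD along $H$. (1) If $\operatorname{pd}\mathcal{A}^H=k-1$, then $\operatorname{pd}\mathcal{A}'\le k$. (2) If $\operatorname{pd}\mathcal{A}^H>k-1$, then $\operatorname{pd}\mathcal{A}'=\operatorname{pd}\mathcal{A}^H$. (3) If $\operatorname{pd}\mathcal{A}^H<k-1$, then $\operatorname{pd}\mathcal{A}'=\operatorname{pd}\mathcal{A}>\operatorname{pd}\mathcal{A}^H+1$.
   Context: $\mathbb{K}$ is an arbitrary field, $V=\mathbb{K}^\ell$, $S=\mathrm{Sym}^*(V^* )\simeq\mathbb{K}[x_1,\dots,x_\ell]$, $\mathrm{Der}\,S=\bigoplus_{i=1}^\ell S\partial_{x_i}$. An arrangement $\mathcal{A}$ in $V$ is a finite set of linear hyperplanes; for $L\in\mathcal{A}$ fix a linear form $\alpha_L$ with $\ker\alpha_L=L$. $D(\mathcal{A})=\{\theta\in\mathrm{Der}\,S\mid\theta(\alpha_L)\in S\alpha_L\ \forall L\in\mathcal{A}\}$ is a graded $S$-module, and $\operatorname{pd}\mathcal{A}:=\operatorname{pd}_S D(\mathcal{A})$; the same definitions apply over any finite-dimensional ambient space. $L(\mathcal{A})$ is the set of all intersections of subsets of $\mathcal{A}$ (with $V$ the empty intersection); $L_k(\mathcal{A})$,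 $L_{\ge k}(\mathcal{A})$ are the elements of codimension $k$, resp. $\ge k$, in the ambient space of $\mathcal{A}$. For $H\in\mathcal{A}$: $\mathcal{A}'=\mathcal{A}\setminus\{H\}$; $\mathcal{A}^H=\{H\cap L\mid L\in\mathcal{A}'\}$, an arrangement in $H\simeq\mathbb{K}^{\ell-1}$ with coordinate ring $S^H=S/\alpha_HS$, and $\operatorname{pd}\mathcal{A}^H=\operatorname{pd}_{S^H}D(\mathcal{A}^H)$. Elements of $L_k(\mathcal{A}^H)$ have codimension $k$ in $H$, i.e. $k+1$ in $V$. For $X\in L(\mathcal{A}^H)$: $\mathcal{A}_X=\{L\in\mathcal{A}\mid X\subset L\}$, $\mathcal{A}'_X=\{L\in\mathcal{A}'\mid X\subset L\}$, $\mathcal{A}^H_X=\{Y\in\mathcal{A}^H\mid X\subset Y\}=(\mathcal{A}_X)^H$. The Euler restriction map $\rho^H:D(\mathcal{A})\to D(\mathcal{A}^H)$ is reduction modulo $\alpha_H$: $\rho^H(\theta)(\overline f)=\overline{\theta(f)}$. $\rho^H_X:D(\mathcal{A}_X)\to D(\mathcal{A}_X^H)$ is the Euler restriction map of $\mathcal{A}_X$. $\rho^H$ is locally surjective in codimension three along $H$ if $\rho^H_X$ is surjective for all $X\in L_2(\mathcal{A}^H)$. $\mathcal{A}'$ is NMPD (not of maximal projective dimension) along $H$ if $\operatorname{pd}\mathcal{A}'_X<\operatorname{codim}_VX-2$ for all $X\in L_{\ge3}(\mathcal{A}^H)$. *)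

theory Defs
  imports
    "HOL-Analysis.Cartesian_Space"
    "HOL-Library.Poly_Mapping"
    "HOL-Library.Extended_Nat"
    "HOL-Algebra.Module"
    "HOL-Algebra.QuotRing"
begin

section \<open>Projective dimension\<close>

definition module_hom ::
  "('r, 'c) ring_scheme \<Rightarrow> ('r, 'm, 'd) module_scheme \<Rightarrow> ('r, 'n, 'e) module_scheme \<Rightarrow> ('m \<Rightarrow> 'n) set"
  where "module_hom R M N =
    {f \<in> carrier M \<rightarrow> carrier N.
       (\<forall>x\<in>carrier M. \<forall>y\<in>carrier M. f (x \<oplus>\<^bsub>M\<^esub> y) = f x \<oplus>\<^bsub>N\<^esub> f y) \<and>
       (\<forall>r\<in>carrier R. \<forall>x\<in>carrier M. f (r \<odot>\<^bsub>M\<^esub> x) = r \<odot>\<^bsub>N\<^esub> f x)}"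

text \<open>The free module on a basis indexed by \<open>B\<close>: the finitely supported functions on \<open>B\<close>.
  The fields \<open>mult\<close> and \<open>one\<close> of a module record carry no meaning.\<close>

definition free_module :: "('r, 'c) ring_scheme \<Rightarrow> 'b set \<Rightarrow> ('r, 'b \<Rightarrow> 'r) module"
  where "free_module R B =
    \<lparr>carrier = {c \<in> B \<rightarrow>\<^sub>E carrier R. finite {b \<in> B. c b \<noteq> \<zero>\<^bsub>R\<^esub>}},
     mult = undefined, one = undefined,
     zero = (\<lambda>b\<in>B. \<zero>\<^bsub>R\<^esub>),
     add = (\<lambda>c d. \<lambda>b\<in>B. c b \<oplus>\<^bsub>R\<^esub> d b),
     smult = (\<lambda>r c. \<lambda>b\<in>B. r \<otimes>\<^bsub>R\<^esub> c b)\<rparr>"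

text \<open>A module is projective if it is a direct summand of a free module. Taking the basis to be a
  set of elements of \<open>P\<close> is no restriction: if \<open>P\<close> is a summand of any free module, then it is a
  summand of the free module on its own carrier.\<close>

definition projective :: "('r, 'c) ring_scheme \<Rightarrow> ('r, 'm, 'd) module_scheme \<Rightarrow> bool"
  where "projective R P \<longleftrightarrow> module R P \<and>
    (\<exists>(B :: 'm set) i p.
       i \<in> module_hom R P (free_module R B) \<and>
       p \<in> module_hom R (free_module R B) P \<and>
       (\<forall>x\<in>carrier P. p (i x) = x))"

text \<open>An exact complex \<open>\<cdots> \<rightarrow> P 1 \<rightarrow> P 0 \<rightarrow> M \<rightarrow> 0\<close> with projective \<open>P i\<close>, where
  \<open>d i : P (i + 1) \<rightarrow> P i\<close> and \<open>\<epsilon> : P 0 \<rightarrow> M\<close>.\<close>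

definition projective_resolution ::
  "('r, 'c) ring_scheme \<Rightarrow> ('r, 'm, 'd) module_scheme \<Rightarrow>
   (nat \<Rightarrow> ('r, 'p) module) \<Rightarrow> (nat \<Rightarrow> 'p \<Rightarrow> 'p) \<Rightarrow> ('p \<Rightarrow> 'm) \<Rightarrow> bool"
  where "projective_resolution R M P d \<epsilon> \<longleftrightarrow>
    (\<forall>i. projective R (P i)) \<and>
    \<epsilon> \<in> module_hom R (P 0) M \<and> \<epsilon> ` carrier (P 0) = carrier M \<and>
    (\<forall>i. d i \<in> module_hom R (P (Suc i)) (P i)) \<and>
    d 0 ` carrier (P 1) = {x \<in> carrier (P 0). \<epsilon> x = \<zero>\<^bsub>M\<^esub>} \<and>
    (\<forall>i. d (Suc i) ` carrier (P (Suc (Suc i))) =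
         {x \<in> carrier (P (Suc i)). d i x = \<zero>\<^bsub>P i\<^esub>})"

text \<open>The least length of a projective resolution, \<open>\<infinity>\<close> if there is no finite one; the zero module
  has projective dimension \<open>0\<close>. Since one cannot quantify over types, the modules in a resolution
  have their carriers in one type. Choosing \<open>('r + 'm) list\<close> loses nothing: every module generated
  by at most \<open>max |R| |M| \<aleph>\<^sub>0\<close> elements embeds into this type, and \<open>M\<close> has a resolution of length
  \<open>n\<close> by such modules whenever it has one of length \<open>n\<close> by arbitrary projective modules.\<close>

definition pd :: "('r, 'c) ring_scheme \<Rightarrow> ('r, 'm, 'd) module_scheme \<Rightarrow> enat"
  where "pd R M = Inf {enat n | n.
    \<exists>(P :: nat \<Rightarrow> ('r, ('r + 'm) list) module) d \<epsilon>.
      projective_resolution R M P d \<epsilon> \<and> (\<forall>i>n. carrier (P i) = {\<zero>\<^bsub>P i\<^esub>})}"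


section \<open>Derivations and logarithmic derivations\<close>

text \<open>The \<open>K\<close>-linear derivations of a commutative \<open>K\<close>-algebra \<open>R\<close> with structure map \<open>\<iota> : K \<rightarrow> R\<close>.\<close>

definition Der :: "('r, 'c) ring_scheme \<Rightarrow> ('k \<Rightarrow> 'r) \<Rightarrow> ('r \<Rightarrow> 'r) set"
  where "Der R \<iota> =
    {\<theta> \<in> carrier R \<rightarrow>\<^sub>E carrier R.
       (\<forall>f\<in>carrier R. \<forall>g\<in>carrier R. \<theta> (f \<oplus>\<^bsub>R\<^esub> g) = \<theta> f \<oplus>\<^bsub>R\<^esub> \<theta> g) \<and>
       (\<forall>c. \<forall>f\<in>carrier R. \<theta> (\<iota> c \<otimes>\<^bsub>R\<^esub> f) = \<iota> c \<otimes>\<^bsub>R\<^esub> \<theta> f) \<and>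
       (\<forall>f\<in>carrier R. \<forall>g\<in>carrier R. \<theta> (f \<otimes>\<^bsub>R\<^esub> g) = f \<otimes>\<^bsub>R\<^esub> \<theta> g \<oplus>\<^bsub>R\<^esub> g \<otimes>\<^bsub>R\<^esub> \<theta> f)}"

definition log_der :: "('r, 'c) ring_scheme \<Rightarrow> ('k \<Rightarrow> 'r) \<Rightarrow> 'r set \<Rightarrow> ('r, 'r \<Rightarrow> 'r) module"
  where "log_der R \<iota> F =
    \<lparr>carrier = {\<theta> \<in> Der R \<iota>. \<forall>\<alpha>\<in>F. \<theta> \<alpha> \<in> PIdl\<^bsub>R\<^esub> \<alpha>},
     mult = undefined, one = undefined,
     zero = (\<lambda>f\<in>carrier R. \<zero>\<^bsub>R\<^esub>),
     add = (\<lambda>\<theta> \<eta>. \<lambda>f\<in>carrier R. \<theta> f \<oplus>\<^bsub>R\<^esub> \<eta> f),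
     smult = (\<lambda>r \<theta>. \<lambda>f\<in>carrier R. r \<otimes>\<^bsub>R\<^esub> \<theta> f)\<rparr>"


section \<open>Coordinate rings\<close>

text \<open>The ambient space is \<open>V = 'k ^ 'n\<close>, and \<open>coord_ring\<close> is \<open>S\<close>, the polynomial ring over
  \<open>'k\<close> in the variables indexed by \<open>'n\<close>.\<close>

type_synonym ('k, 'n) poly_ring_elem = "('n \<Rightarrow>\<^sub>0 nat) \<Rightarrow>\<^sub>0 'k"

definition coord_ring :: "('k::field, 'n) poly_ring_elem ring"
  where "coord_ring = \<lparr>carrier = UNIV, mult = (*), one = 1, zero = 0, add = (+)\<rparr>"

definition const :: "'k::field \<Rightarrow> ('k, 'n) poly_ring_elem"
  where "const c = Poly_Mapping.single 0 c"

definition var :: "'n \<Rightarrow> ('k::field, 'n) poly_ring_elem"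
  where "var i = Poly_Mapping.single (Poly_Mapping.single i 1) 1"

text \<open>A vector \<open>a\<close> of coefficients represents the linear form \<open>\<Sum>i. a\<^sub>i x\<^sub>i\<close> on \<open>V\<close>:
  \<open>lin_form a\<close> is this form as an element of \<open>S\<close>, and \<open>ker_form a\<close> is its kernel in \<open>V\<close>.\<close>

definition lin_form :: "'k::field ^ 'n::finite \<Rightarrow> ('k, 'n) poly_ring_elem"
  where "lin_form a = (\<Sum>i\<in>UNIV. const (a $ i) * var i)"

definition ker_form :: "'k::field ^ 'n::finite \<Rightarrow> ('k ^ 'n) set"
  where "ker_form a = {v. (\<Sum>i\<in>UNIV. a $ i * v $ i) = 0}"

text \<open>A linear form on \<open>V\<close> whose restriction to the subspace \<open>W\<close> has kernel \<open>L\<close>. If \<open>L\<close> is a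
  hyperplane of \<open>W\<close>, this restriction is unique up to a nonzero scalar.\<close>

definition def_form :: "('k::field ^ 'n::finite) set \<Rightarrow> ('k ^ 'n) set \<Rightarrow> ('k, 'n) poly_ring_elem"
  where "def_form W L = lin_form (SOME a. W \<inter> ker_form a = L)"

text \<open>The principal ideal \<open>\<alpha>\<^sub>H S\<close>, the coordinate ring \<open>S / \<alpha>\<^sub>H S\<close> of \<open>H\<close>, and reduction modulo
  \<open>\<alpha>\<^sub>H\<close>.\<close>

definition hyp_ideal :: "('k::field ^ 'n::finite) set \<Rightarrow> ('k, 'n) poly_ring_elem set"
  where "hyp_ideal H = PIdl\<^bsub>coord_ring\<^esub> (def_form UNIV H)"

definition coord_ring_in :: "('k::field ^ 'n::finite) set \<Rightarrow> ('k, 'n) poly_ring_elem set ring"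
  where "coord_ring_in H = coord_ring Quot (hyp_ideal H)"

definition reduce_mod :: "('k::field ^ 'n::finite) set \<Rightarrow> ('k, 'n) poly_ring_elem \<Rightarrow> ('k, 'n) poly_ring_elem set"
  where "reduce_mod H f = hyp_ideal H +>\<^bsub>coord_ring\<^esub> f"


section \<open>Arrangements\<close>

definition codim_in :: "('k::field ^ 'n::finite) set \<Rightarrow> ('k ^ 'n) set \<Rightarrow> nat"
  where "codim_in W X = vec.dim W - vec.dim X"

definition arrangement :: "('k::field ^ 'n::finite) set set \<Rightarrow> bool"
  where "arrangement \<A> \<longleftrightarrow> finite \<A> \<and> (\<forall>L\<in>\<A>. vec.subspace L \<and> codim_in UNIV L = 1)"

text \<open>The intersection lattice of an arrangement in the ambient space \<open>W\<close>.\<close>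

definition flats :: "('k::field ^ 'n::finite) set \<Rightarrow> ('k ^ 'n) set set \<Rightarrow> ('k ^ 'n) set set"
  where "flats W \<B> = {W \<inter> \<Inter>\<C> | \<C>. \<C> \<subseteq> \<B>}"

definition localization :: "('k::field ^ 'n::finite) set set \<Rightarrow> ('k ^ 'n) set \<Rightarrow> ('k ^ 'n) set set"
  where "localization \<A> X = {L \<in> \<A>. X \<subseteq> L}"

definition restriction :: "('k::field ^ 'n::finite) set set \<Rightarrow> ('k ^ 'n) set \<Rightarrow> ('k ^ 'n) set set"
  where "restriction \<A> H = {H \<inter> L | L. L \<in> \<A> - {H}}"

text \<open>\<open>log_mod \<A>\<close> is the module of logarithmic derivations of an arrangement \<open>\<A>\<close> in \<open>V\<close>, and
  \<open>log_mod_in H \<B>\<close> that of an arrangement \<open>\<B>\<close> in the hyperplane \<open>H\<close>.\<close>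

definition log_mod :: "('k::field ^ 'n::finite) set set \<Rightarrow>
    (('k, 'n) poly_ring_elem, ('k, 'n) poly_ring_elem \<Rightarrow> ('k, 'n) poly_ring_elem) module"
  where "log_mod \<A> = log_der coord_ring const (def_form UNIV ` \<A>)"

definition log_mod_in :: "('k::field ^ 'n::finite) set \<Rightarrow> ('k ^ 'n) set set \<Rightarrow>
    (('k, 'n) poly_ring_elem set, ('k, 'n) poly_ring_elem set \<Rightarrow> ('k, 'n) poly_ring_elem set) module"
  where "log_mod_in H \<B> = log_der (coord_ring_in H) (\<lambda>c. reduce_mod H (const c))
    ((\<lambda>Y. reduce_mod H (def_form H Y)) ` \<B>)"

definition pd_arr :: "('k::field ^ 'n::finite) set set \<Rightarrow> enat"
  where "pd_arr \<A> = pd coord_ring (log_mod \<A>)"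

definition pd_arr_in :: "('k::field ^ 'n::finite) set \<Rightarrow> ('k ^ 'n) set set \<Rightarrow> enat"
  where "pd_arr_in H \<B> = pd (coord_ring_in H) (log_mod_in H \<B>)"

text \<open>The Euler restriction map \<open>\<rho> \<theta> (reduce_mod H f) = reduce_mod H (\<theta> f)\<close>. For
  \<open>\<theta> \<in> log_mod \<A>\<close> with \<open>H \<in> \<A>\<close>, the class of \<open>\<theta> f\<close> does not depend on the representative \<open>f\<close> of a coset \<open>G\<close>.\<close>

definition euler_restriction :: "('k::field ^ 'n::finite) set \<Rightarrow>
    (('k, 'n) poly_ring_elem \<Rightarrow> ('k, 'n) poly_ring_elem) \<Rightarrow>
    ('k, 'n) poly_ring_elem set \<Rightarrow> ('k, 'n) poly_ring_elem set"
  where "euler_restriction H \<theta> = (\<lambda>G\<in>carrier (coord_ring_in H). the_elem ((\<lambda>f. reduce_mod H (\<theta> f)) ` G))"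

definition locally_surjective_codim_three ::
    "('k::field ^ 'n::finite) set set \<Rightarrow> ('k ^ 'n) set \<Rightarrow> bool"
  where "locally_surjective_codim_three \<A> H \<longleftrightarrow>
    (\<forall>X\<in>flats H (restriction \<A> H). codim_in H X = 2 \<longrightarrow>
       euler_restriction H ` carrier (log_mod (localization \<A> X)) =
       carrier (log_mod_in H (restriction (localization \<A> X) H)))"

text \<open>The deletion \<open>\<A> - {H}\<close> is not of maximal projective dimension along \<open>H\<close>.\<close>

definition deletion_NMPD :: "('k::field ^ 'n::finite) set set \<Rightarrow> ('k ^ 'n) set \<Rightarrow> bool"
  where "deletion_NMPD \<A> H \<longleftrightarrow>
    (\<forall>X\<in>flats H (restriction \<A> H). codim_in H X \<ge> 3 \<longrightarrow>
       pd_arr (localization (\<A> - {H}) X) < enat (codim_in UNIV X - 2))"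


section \<open>Basic facts\<close>

lemma cring_coord_ring: "cring (coord_ring :: ('k::field, 'n) poly_ring_elem ring)"
proof (rule cringI)
  show "abelian_group (coord_ring :: ('k, 'n) poly_ring_elem ring)"
    by (rule abelian_groupI) (auto simp: coord_ring_def add.assoc add.commute, metis add.right_inverse)
  show "comm_monoid (coord_ring :: ('k, 'n) poly_ring_elem ring)"
    by (rule comm_monoidI) (auto simp: coord_ring_def mult.assoc mult.commute)
qed (auto simp: coord_ring_def distrib_right)

lemma module_log_der:
  fixes R (structure)
  assumes "cring R" "F \<subseteq> carrier R" "\<iota> ` UNIV \<subseteq> carrier R"
  shows "module R (log_der R \<iota> F)"
proof -
  interpret cring R by fact
  have i: "\<iota> c \<in> carrier R" for c using assms(3) by auto
  have I: "ideal (PIdl\<^bsub>R\<^esub> \<alpha>) R" if "\<alpha> \<in> F" for \<alpha>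
    using assms(2) that by (auto intro: cgenideal_ideal)
  let ?M = "log_der R \<iota> F"
  have c: "\<theta> f \<in> carrier R" if "\<theta> \<in> carrier ?M" "f \<in> carrier R" for \<theta> f
    using that by (auto simp: log_der_def Der_def)
  have e: "\<theta> = \<eta>" if "\<theta> \<in> carrier ?M" "\<eta> \<in> carrier ?M" "\<And>f. f \<in> carrier R \<Longrightarrow> \<theta> f = \<eta> f" for \<theta> \<eta>
    using that by (auto simp: log_der_def Der_def intro: PiE_ext)
  have z: "\<zero>\<^bsub>?M\<^esub> \<in> carrier ?M"
    using assms(2) i by (auto simp: log_der_def Der_def subset_iff intro!: additive_subgroup.zero_closed ideal.axioms(1) I)
  have a: "\<theta> \<oplus>\<^bsub>?M\<^esub> \<eta> \<in> carrier ?M" if "\<theta> \<in> carrier ?M" "\<eta> \<in> carrier ?M" for \<theta> \<eta>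
  proof -
    have t: "\<theta> f \<in> carrier R" "\<eta> f \<in> carrier R" if "f \<in> carrier R" for f using c \<open>\<theta> \<in> _\<close> \<open>\<eta> \<in> _\<close> that by auto
    show ?thesis
      using that assms(2) i t by (auto simp: log_der_def Der_def subset_iff a_ac r_distr intro!: additive_subgroup.a_closed ideal.axioms(1) I)
  qed
  have s: "r \<odot>\<^bsub>?M\<^esub> \<theta> \<in> carrier ?M" if "r \<in> carrier R" "\<theta> \<in> carrier ?M" for r \<theta>
  proof -
    have t: "\<theta> f \<in> carrier R" if "f \<in> carrier R" for f using c \<open>\<theta> \<in> _\<close> that by auto
    show ?thesis
      using that assms(2) i t by (auto simp: log_der_def Der_def subset_iff m_ac r_distr intro!: ideal.I_l_closed I)
  qed
  have l: "(r \<oplus> q) \<odot>\<^bsub>?M\<^esub> x = (r \<odot>\<^bsub>?M\<^esub> x) \<oplus>\<^bsub>?M\<^esub> (q \<odot>\<^bsub>?M\<^esub> x)"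
    "r \<odot>\<^bsub>?M\<^esub> (x \<oplus>\<^bsub>?M\<^esub> y) = (r \<odot>\<^bsub>?M\<^esub> x) \<oplus>\<^bsub>?M\<^esub> (r \<odot>\<^bsub>?M\<^esub> y)"
    "(r \<otimes> q) \<odot>\<^bsub>?M\<^esub> x = r \<odot>\<^bsub>?M\<^esub> (q \<odot>\<^bsub>?M\<^esub> x)"
    "\<one> \<odot>\<^bsub>?M\<^esub> x = x"
    if h: "r \<in> carrier R" "q \<in> carrier R" "x \<in> carrier ?M" "y \<in> carrier ?M" for r q x y
  proof -
    have t: "x f \<in> carrier R" "y f \<in> carrier R" if "f \<in> carrier R" for f using h that c by auto
    show "(r \<oplus> q) \<odot>\<^bsub>?M\<^esub> x = (r \<odot>\<^bsub>?M\<^esub> x) \<oplus>\<^bsub>?M\<^esub> (q \<odot>\<^bsub>?M\<^esub> x)"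
      using h t by (intro e a s) (auto simp: log_der_def l_distr)
    show "r \<odot>\<^bsub>?M\<^esub> (x \<oplus>\<^bsub>?M\<^esub> y) = (r \<odot>\<^bsub>?M\<^esub> x) \<oplus>\<^bsub>?M\<^esub> (r \<odot>\<^bsub>?M\<^esub> y)"
      using h t by (intro e a s) (auto simp: log_der_def r_distr)
    show "(r \<otimes> q) \<odot>\<^bsub>?M\<^esub> x = r \<odot>\<^bsub>?M\<^esub> (q \<odot>\<^bsub>?M\<^esub> x)"
      using h t by (intro e a s) (auto simp: log_der_def m_assoc)
    show "\<one> \<odot>\<^bsub>?M\<^esub> x = x"
      using h t by (intro e a s) (auto simp: log_der_def)
  qed
  show ?thesis
  proof (rule moduleI)
    show "cring R" by fact
    show "abelian_group ?M"
    proof (rule abelian_groupI)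
      fix \<theta> assume t: "\<theta> \<in> carrier ?M"
      show "\<exists>\<eta>\<in>carrier ?M. \<eta> \<oplus>\<^bsub>?M\<^esub> \<theta> = \<zero>\<^bsub>?M\<^esub>"
      proof (rule bexI)
        show "(\<ominus> \<one>) \<odot>\<^bsub>?M\<^esub> \<theta> \<in> carrier ?M" using t by (intro s) auto
        show "((\<ominus> \<one>) \<odot>\<^bsub>?M\<^esub> \<theta>) \<oplus>\<^bsub>?M\<^esub> \<theta> = \<zero>\<^bsub>?M\<^esub>"
          using c[OF t] by (auto simp: log_der_def l_minus l_neg intro!: ext)
      qed
    next
      fix x y z assume "x \<in> carrier ?M" "y \<in> carrier ?M" "z \<in> carrier ?M"
      then show "x \<oplus>\<^bsub>?M\<^esub> y \<oplus>\<^bsub>?M\<^esub> z = x \<oplus>\<^bsub>?M\<^esub> (y \<oplus>\<^bsub>?M\<^esub> z)"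
        using c by (intro e a) (auto simp: log_der_def a_ac)
    next
      fix x y assume "x \<in> carrier ?M" "y \<in> carrier ?M"
      then show "x \<oplus>\<^bsub>?M\<^esub> y = y \<oplus>\<^bsub>?M\<^esub> x"
        using c by (intro e a) (auto simp: log_der_def a_ac)
    next
      fix x assume "x \<in> carrier ?M"
      then show "\<zero>\<^bsub>?M\<^esub> \<oplus>\<^bsub>?M\<^esub> x = x"
        using c z by (intro e a) (auto simp: log_der_def)
    qed (rule a z; assumption?)+
    show "r \<odot>\<^bsub>?M\<^esub> x \<in> carrier ?M" if "r \<in> carrier R" "x \<in> carrier ?M" for r x
      using that by (rule s)
    show "(r \<oplus> q) \<odot>\<^bsub>?M\<^esub> x = (r \<odot>\<^bsub>?M\<^esub> x) \<oplus>\<^bsub>?M\<^esub> (q \<odot>\<^bsub>?M\<^esub> x)"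
      if "r \<in> carrier R" "q \<in> carrier R" "x \<in> carrier ?M" for r q x
      using that that(3) by (rule l(1))
    show "r \<odot>\<^bsub>?M\<^esub> (x \<oplus>\<^bsub>?M\<^esub> y) = (r \<odot>\<^bsub>?M\<^esub> x) \<oplus>\<^bsub>?M\<^esub> (r \<odot>\<^bsub>?M\<^esub> y)"
      if "r \<in> carrier R" "x \<in> carrier ?M" "y \<in> carrier ?M" for r x y
      using that(1) that by (rule l(2))
    show "(r \<otimes> q) \<odot>\<^bsub>?M\<^esub> x = r \<odot>\<^bsub>?M\<^esub> (q \<odot>\<^bsub>?M\<^esub> x)"
      if "r \<in> carrier R" "q \<in> carrier R" "x \<in> carrier ?M" for r q x
      using that that(3) by (rule l(3))
    show "\<one> \<odot>\<^bsub>?M\<^esub> x = x" if "x \<in> carrier ?M" for x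
      using one_closed one_closed that that by (rule l(4))
  qed
qed

lemma euler_restriction_reduce_mod:
  assumes "H \<in> \<A>" "\<theta> \<in> carrier (log_mod \<A>)"
  shows "euler_restriction H \<theta> (reduce_mod H f) = reduce_mod H (\<theta> f)"
proof -
  interpret R: cring coord_ring by (rule cring_coord_ring)
  let ?\<alpha> = "def_form UNIV H"
  have U: "carrier coord_ring = UNIV" by (simp add: coord_ring_def)
  have I: "ideal (hyp_ideal H) coord_ring"
    unfolding hyp_ideal_def by (rule R.cgenideal_ideal) (simp add: U)
  have mem: "g \<in> hyp_ideal H \<longleftrightarrow> (\<exists>x. g = x * ?\<alpha>)" for g
    by (auto simp: hyp_ideal_def cgenideal_def coord_ring_def)
  have coset: "reduce_mod H f = {g. g - f \<in> hyp_ideal H}" for f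
  proof -
    have "reduce_mod H f = {h + f | h. h \<in> hyp_ideal H}"
      by (auto simp: reduce_mod_def a_r_coset_def r_coset_def coord_ring_def)
    also have "\<dots> = {g. g - f \<in> hyp_ideal H}" by (auto, metis diff_add_cancel)
    finally show ?thesis .
  qed
  have d: "\<theta> \<in> Der coord_ring const" "\<theta> ?\<alpha> \<in> hyp_ideal H"
    using assms by (auto simp: log_mod_def log_der_def hyp_ideal_def)
  have red: "reduce_mod H g = reduce_mod H f" if "g - f \<in> hyp_ideal H" for f g
  proof -
    from that obtain x where "g - f = x * ?\<alpha>" using mem by blast
    then have x: "g = f + x * ?\<alpha>" by (simp add: diff_eq_eq add.commute)
    have "h - f = (y + x) * ?\<alpha>" if "h - g = y * ?\<alpha>" for h y
      using that by (simp add: x algebra_simps)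
    moreover have "h - g = (y - x) * ?\<alpha>" if "h - f = y * ?\<alpha>" for h y
      using that by (simp add: x algebra_simps)
    ultimately have "h - g \<in> hyp_ideal H \<longleftrightarrow> h - f \<in> hyp_ideal H" for h
      unfolding mem by blast
    then show ?thesis by (simp add: coset)
  qed
  have "reduce_mod H (\<theta> g) = reduce_mod H (\<theta> f)" if "g \<in> reduce_mod H f" for g
  proof (rule red)
    from that obtain x where "g - f = x * ?\<alpha>" using mem coset by blast
    then have x: "g = f + x * ?\<alpha>" by (simp add: diff_eq_eq add.commute)
    from d(2) obtain y where y: "\<theta> ?\<alpha> = y * ?\<alpha>" by (auto simp: mem)
    have "\<theta> g = \<theta> f + (x * \<theta> ?\<alpha> + ?\<alpha> * \<theta> x)"
      using d(1) unfolding x Der_def coord_ring_def by auto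
    then have "\<theta> g - \<theta> f = (x * y + \<theta> x) * ?\<alpha>" by (simp add: y algebra_simps)
    then show "\<theta> g - \<theta> f \<in> hyp_ideal H" by (auto simp: mem)
  qed
  moreover have "f \<in> reduce_mod H f" by (auto simp: coset mem intro: exI[of _ 0])
  ultimately have "(\<lambda>g. reduce_mod H (\<theta> g)) ` reduce_mod H f = {reduce_mod H (\<theta> f)}" by blast
  moreover have "reduce_mod H f \<in> carrier (coord_ring_in H)"
    unfolding coord_ring_in_def FactRing_def A_RCOSETS_def' reduce_mod_def by (simp add: U) blast
  ultimately show ?thesis by (simp add: euler_restriction_def)
qed

text \<open>Formal partial derivatives.\<close>

definition partial :: "'n \<Rightarrow> ('k::field, 'n) poly_ring_elem \<Rightarrow> ('k, 'n) poly_ring_elem"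
  where "partial i f = (\<Sum>m\<in>Poly_Mapping.keys f.
    Poly_Mapping.single (m - Poly_Mapping.single i 1)
      (of_nat (Poly_Mapping.lookup m i) * Poly_Mapping.lookup f m))"

lemma partial_superset:
  assumes "finite A" "Poly_Mapping.keys f \<subseteq> A"
  shows "partial i f = (\<Sum>m\<in>A.
    Poly_Mapping.single (m - Poly_Mapping.single i 1)
      (of_nat (Poly_Mapping.lookup m i) * Poly_Mapping.lookup f m))"
  unfolding partial_def using assms
  by (intro sum.mono_neutral_left) (auto simp: in_keys_iff)

lemma partial_single:
  "partial i (Poly_Mapping.single m c) =
    Poly_Mapping.single (m - Poly_Mapping.single i 1) (of_nat (Poly_Mapping.lookup m i) * c)"
  by (subst partial_superset[where A="{m}"]) (auto simp: when_def)

lemma partial_add: "partial i (f + g) = partial i f + partial i g"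
proof -
  let ?A = "Poly_Mapping.keys f \<union> Poly_Mapping.keys g"
  have "Poly_Mapping.keys (f + g) \<subseteq> ?A" by (rule Poly_Mapping.keys_add)
  then show ?thesis
    by (simp add: partial_superset[where A="?A"] lookup_add distrib_left single_add sum.distrib)
qed

lemma poly_add_induct:
  assumes "\<And>m c. P (Poly_Mapping.single m c)" "\<And>f g. P f \<Longrightarrow> P g \<Longrightarrow> P (f + g)"
  shows "P (f :: ('k::field, 'n) poly_ring_elem)"
proof -
  have s: "P (sum h A)" if "finite A" "\<And>m. m \<in> A \<Longrightarrow> P (h m)" for h and A :: "('n \<Rightarrow>\<^sub>0 nat) set"
    using that by (induction A) (auto intro: assms(2), metis assms(1) single_zero)
  have "f = (\<Sum>m\<in>Poly_Mapping.keys f. Poly_Mapping.single m (Poly_Mapping.lookup f m))"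
    by (intro poly_mapping_eqI) (auto simp: lookup_sum lookup_single when_def in_keys_iff)
  then show ?thesis
    using s[of "Poly_Mapping.keys f" "\<lambda>m. Poly_Mapping.single m (Poly_Mapping.lookup f m)"] assms(1)
    by auto
qed

lemma minus_single_add:
  assumes "Poly_Mapping.lookup m i > (0::nat)"
  shows "m + n - Poly_Mapping.single i 1 = (m - Poly_Mapping.single i 1) + n"
  using assms by (intro poly_mapping_eqI) (auto simp: lookup_add lookup_minus lookup_single when_def)

lemma partial_mult_single:
  fixes c d :: "'k::field"
  shows "partial i (Poly_Mapping.single m c * Poly_Mapping.single n d) =
    Poly_Mapping.single m c * partial i (Poly_Mapping.single n d)
    + Poly_Mapping.single n d * partial i (Poly_Mapping.single m c)"
proof -
  let ?a = "of_nat (Poly_Mapping.lookup m i) :: 'k" and ?b = "of_nat (Poly_Mapping.lookup n i) :: 'k"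
  let ?e = "Poly_Mapping.single i (1::nat)"
  have 1: "Poly_Mapping.single (m + n - ?e) (?a * x) = Poly_Mapping.single (n + (m - ?e)) (?a * x)" for x
    using minus_single_add[of m i n] by (cases "Poly_Mapping.lookup m i = 0") (auto simp: ac_simps)
  have 2: "Poly_Mapping.single (m + n - ?e) (?b * x) = Poly_Mapping.single (m + (n - ?e)) (?b * x)" for x
    using minus_single_add[of n i m] by (cases "Poly_Mapping.lookup n i = 0") (auto simp: ac_simps)
  have "partial i (Poly_Mapping.single m c * Poly_Mapping.single n d) =
     Poly_Mapping.single (m + n - ?e) (?a * (c * d)) + Poly_Mapping.single (m + n - ?e) (?b * (c * d))"
    by (simp add: mult_single partial_single lookup_add distrib_right single_add)
  then show ?thesis
    unfolding 1 2 by (simp add: partial_single mult_single mult.assoc mult.left_commute mult.commute add.commute)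
qed

lemma partial_mult: "partial i (f * g) = f * partial i g + g * partial i f"
proof (induction f rule: poly_add_induct)
  case (1 m c)
  show ?case
    by (induction g rule: poly_add_induct)
      (simp_all add: partial_mult_single partial_add algebra_simps)
next
  case (2 f h)
  then show ?case by (simp add: partial_add algebra_simps)
qed

lemma partial_const [simp]: "partial i (const c) = 0"
  by (simp add: const_def partial_single)

lemma partial_var: "partial i (var j) = (if i = j then 1 else 0)"
proof -
  have "Poly_Mapping.single i (1::nat) - Poly_Mapping.single i 1 = 0" by simp
  then show ?thesis by (auto simp: var_def partial_single lookup_single when_def)
qed

lemma var_power: "var i ^ k = Poly_Mapping.single (Poly_Mapping.single i k) 1"
  by (induction k) (auto simp: var_def mult_single simp flip: single_add)

lemma prod_var:
  "(\<Prod>i\<in>A. var i ^ g i) = (Poly_Mapping.single (\<Sum>i\<in>A. Poly_Mapping.single i (g i)) 1 :: ('k::field, 'n::finite) poly_ring_elem)"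
  by (induction A rule: infinite_finite_induct) (auto simp: var_power mult_single)

lemma single_eq_prod_var:
  "Poly_Mapping.single m c = const c * (\<Prod>i\<in>UNIV. var (i::'n::finite) ^ Poly_Mapping.lookup m i)"
proof -
  have "(\<Sum>i\<in>UNIV. Poly_Mapping.single i (Poly_Mapping.lookup m i)) = m"
    by (intro poly_mapping_eqI) (auto simp: lookup_sum lookup_single when_def)
  then show ?thesis by (simp add: prod_var const_def mult_single)
qed

lemma Der_coord_ring_iff:
  "\<theta> \<in> Der coord_ring const \<longleftrightarrow> (\<forall>f g. \<theta> (f + g) = \<theta> f + \<theta> g) \<and>
     (\<forall>c f. \<theta> (const c * f) = const c * \<theta> f) \<and> (\<forall>f g. \<theta> (f * g) = f * \<theta> g + g * \<theta> f)"
  by (auto simp: Der_def coord_ring_def)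

lemma Der_eqI:
  fixes \<theta> \<eta> :: "('k::field, 'n::finite) poly_ring_elem \<Rightarrow> ('k, 'n) poly_ring_elem"
  assumes "\<theta> \<in> Der coord_ring const" "\<eta> \<in> Der coord_ring const" "\<And>i. \<theta> (var i) = \<eta> (var i)"
  shows "\<theta> = \<eta>"
proof
  fix f
  have m: "\<theta> (f * g) = \<eta> (f * g)" if "\<theta> f = \<eta> f" "\<theta> g = \<eta> g" for f g
    using assms(1,2) that unfolding Der_coord_ring_iff by metis
  have one: "\<theta> 1 = \<eta> 1"
  proof -
    have "\<theta> (1 * 1) = 1 * \<theta> 1 + 1 * \<theta> 1" "\<eta> (1 * 1) = 1 * \<eta> 1 + 1 * \<eta> 1"
      using assms(1,2) unfolding Der_coord_ring_iff by blast+
    then show ?thesis by simp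
  qed
  have pow: "\<theta> (var i ^ k) = \<eta> (var i ^ k)" for i k
    by (induction k) (auto intro: m one assms(3))
  have pr: "\<theta> (\<Prod>i\<in>A. var i ^ g i) = \<eta> (\<Prod>i\<in>A. var i ^ g i)" for A g
    by (induction A rule: infinite_finite_induct) (auto intro: m one pow)
  show "\<theta> f = \<eta> f"
  proof (induction f rule: poly_add_induct)
    case (1 m c)
    show ?case unfolding single_eq_prod_var
      using assms(1,2) pr unfolding Der_coord_ring_iff by metis
  next
    case (2 f g)
    then show ?case using assms(1,2) unfolding Der_coord_ring_iff by metis
  qed
qed

lemma sum_partial_Der: "(\<lambda>f. \<Sum>i\<in>UNIV. p i * partial i f) \<in> Der coord_ring (const :: 'k::field \<Rightarrow> ('k, 'n::finite) poly_ring_elem)"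
  unfolding Der_coord_ring_iff
  by (simp add: partial_add partial_mult sum.distrib sum_distrib_left algebra_simps)

text \<open>The derivations of the polynomial ring are the \<open>\<Sum>\<^sub>i p\<^sub>i \<partial>\<^sub>i\<close> with unique coefficients, so
  \<open>Der coord_ring const = \<Oplus>\<^sub>i S \<partial>\<^sub>i\<close>.\<close>

lemma Der_coord_ring:
  "bij_betw (\<lambda>p f. \<Sum>i\<in>UNIV. p i * partial i f) UNIV
     (Der coord_ring (const :: 'k::field \<Rightarrow> ('k, 'n::finite) poly_ring_elem))"
proof (rule bij_betw_byWitness[where f' = "\<lambda>\<theta> i. \<theta> (var i)"])
  have v: "(\<Sum>i\<in>UNIV. p i * partial i (var j)) = p j" for p :: "'n \<Rightarrow> ('k, 'n) poly_ring_elem" and j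
    by (simp add: partial_var if_distrib cong: if_cong)
  show "\<forall>p\<in>(UNIV :: ('n \<Rightarrow> ('k, 'n) poly_ring_elem) set). (\<lambda>i. \<Sum>j\<in>UNIV. p j * partial j (var i)) = p" by (simp add: v)
  show "\<forall>\<theta>\<in>Der coord_ring (const :: 'k \<Rightarrow> ('k, 'n) poly_ring_elem). (\<lambda>f. \<Sum>i\<in>UNIV. \<theta> (var i) * partial i f) = \<theta>"
    by (auto intro!: Der_eqI sum_partial_Der simp: v)
qed (auto intro: sum_partial_Der)

end

theory Submission
  imports Defs
begin

text \<open>
  The Euler sequence \<open>0 \<rightarrow> D(\<A>') \<rightarrow> D(\<A>) \<rightarrow> D(\<A>\<^sup>H)\<close>, whose first map is multiplication by \<open>\<alpha>\<^sub>H\<close>, turns out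
  to be exact on the right as well. All three claims then follow from the estimates for projective
  dimensions in a short exact sequence and from \<open>pd\<^sub>S N \<le> m + 1 \<longleftrightarrow> pd\<^bsub>S/\<alpha>S\<^esub> N \<le> m\<close>, where
  \<open>\<alpha> = \<alpha>\<^sub>H\<close>.

  Surjectivity of the restriction map is proved for every localization \<open>\<A>\<^sub>X\<close>, by induction on the
  codimension of \<open>X\<close>; up to codimension 3 it is elementary or assumed. Beyond that, the cokernel for
  \<open>\<A>\<^sub>X\<close> is killed by powers of \<open>c = codim X\<close> independent linear forms. These powers form a regular
  sequence, so their Koszul cohomology with values in \<open>D(\<A>'\<^sub>X)\<close> vanishes in degrees below
  \<open>c - pd \<A>'\<^sub>X\<close>, in particular in degree 2. This is exactly what is needed to lift every element of
  \<open>D(\<A>\<^sub>X\<^sup>H)\<close>, given that its multiples by these powers can be lifted.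
\<close>

section \<open>Modules and homomorphisms\<close>

text \<open>The NMPD bound is a degree count. The obstruction to lifting lies in degree 2 of the
  Koszul complex with values in D(\<A>'_X), and 2 + pd \<A>'_X < c is the hypothesis. Degree 1 is
  needed too, but only with values in Der S, which is free, so c \<ge> 2 suffices there. Ext, depth
  and localization at primes never occur: exactness is proved for free modules and carried to
  D(\<A>'_X) one syzygy at a time, each costing one degree, and the support of the cokernel is
  replaced by explicit powers that annihilate it. The homological algebra is shaped by types. A
  resolution lives in one type of lists, so modules in different types can be compared only through
  maps, and an induction cannot change the type of its modules. Bounds on projective dimension are
  therefore proved inside a list type and then moved to arbitrary modules along injections. In the
  change of rings, the inequality from S to S/\<alpha>S is false for a general regular element; it
  holds here because a scaled partial derivative takes \<alpha> to 1.\<close>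

lemma module_homI:
  assumes "\<And>x. x \<in> carrier M \<Longrightarrow> f x \<in> carrier N"
    and "\<And>x y. x \<in> carrier M \<Longrightarrow> y \<in> carrier M \<Longrightarrow> f (x \<oplus>\<^bsub>M\<^esub> y) = f x \<oplus>\<^bsub>N\<^esub> f y"
    and "\<And>r x. r \<in> carrier R \<Longrightarrow> x \<in> carrier M \<Longrightarrow> f (r \<odot>\<^bsub>M\<^esub> x) = r \<odot>\<^bsub>N\<^esub> f x"
  shows "f \<in> module_hom R M N"
  using assms by (auto simp: module_hom_def)

lemma module_hom_closed: "f \<in> module_hom R M N \<Longrightarrow> x \<in> carrier M \<Longrightarrow> f x \<in> carrier N"
  and module_hom_add: "f \<in> module_hom R M N \<Longrightarrow> x \<in> carrier M \<Longrightarrow> y \<in> carrier M \<Longrightarrow>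
    f (x \<oplus>\<^bsub>M\<^esub> y) = f x \<oplus>\<^bsub>N\<^esub> f y"
  and module_hom_smult: "f \<in> module_hom R M N \<Longrightarrow> r \<in> carrier R \<Longrightarrow> x \<in> carrier M \<Longrightarrow>
    f (r \<odot>\<^bsub>M\<^esub> x) = r \<odot>\<^bsub>N\<^esub> f x"
  by (auto simp: module_hom_def)

lemmas module_hom_simps = module_hom_closed module_hom_add module_hom_smult

lemma module_hom_comp:
  "f \<in> module_hom R M N \<Longrightarrow> g \<in> module_hom R N P \<Longrightarrow> (\<lambda>x. g (f x)) \<in> module_hom R M P"
  by (auto simp: module_hom_def Pi_iff)

lemma module_hom_id: "(\<lambda>x. x) \<in> module_hom R M M"
  by (auto simp: module_hom_def)

lemma module_cring: "module R M \<Longrightarrow> cring R"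
  by (simp add: module_def)

lemma module_hom_zero:
  assumes "module R M" "module R N" "f \<in> module_hom R M N"
  shows "f \<zero>\<^bsub>M\<^esub> = \<zero>\<^bsub>N\<^esub>"
proof -
  interpret M: module R M by fact
  interpret N: module R N by fact
  have "f (\<zero>\<^bsub>R\<^esub> \<odot>\<^bsub>M\<^esub> \<zero>\<^bsub>M\<^esub>) = \<zero>\<^bsub>R\<^esub> \<odot>\<^bsub>N\<^esub> f \<zero>\<^bsub>M\<^esub>"
    using assms(3) by (intro module_hom_smult) auto
  then show ?thesis using module_hom_closed[OF assms(3), of "\<zero>\<^bsub>M\<^esub>"] by simp
qed

lemma (in abelian_group) minus_eq_zero_iff:
  assumes "x \<in> carrier G" "y \<in> carrier G"
  shows "x \<ominus> y = \<zero> \<longleftrightarrow> x = y"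
  using assms minus_equality[of x "\<ominus> y"] by (auto simp: a_minus_def r_neg)

lemma (in module) a_inv_smult: "x \<in> carrier M \<Longrightarrow> \<ominus>\<^bsub>M\<^esub> x = (\<ominus> \<one>) \<odot>\<^bsub>M\<^esub> x"
  by (simp add: smult_l_minus)

lemma module_hom_minus:
  assumes "module R M" "module R N" "f \<in> module_hom R M N" "x \<in> carrier M" "y \<in> carrier M"
  shows "f (x \<ominus>\<^bsub>M\<^esub> y) = f x \<ominus>\<^bsub>N\<^esub> f y"
proof -
  interpret M: module R M by fact
  interpret N: module R N by fact
  show ?thesis using assms(3-)
    by (simp add: a_minus_def M.a_inv_smult N.a_inv_smult module_hom_simps)
qed

lemma module_hom_diff:
  assumes "module R M" "module R N" "f \<in> module_hom R M N" "g \<in> module_hom R M N"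
  shows "(\<lambda>x. f x \<ominus>\<^bsub>N\<^esub> g x) \<in> module_hom R M N"
proof -
  interpret M: module R M by fact
  interpret N: module R N by fact
  show ?thesis
  proof (rule module_homI)
    fix x y assume "x \<in> carrier M" "y \<in> carrier M"
    then show "f (x \<oplus>\<^bsub>M\<^esub> y) \<ominus>\<^bsub>N\<^esub> g (x \<oplus>\<^bsub>M\<^esub> y) = (f x \<ominus>\<^bsub>N\<^esub> g x) \<oplus>\<^bsub>N\<^esub> (f y \<ominus>\<^bsub>N\<^esub> g y)"
      using assms(3,4) by (simp add: a_minus_def module_hom_simps N.minus_add N.a_ac)
  next
    fix r x assume "r \<in> carrier R" "x \<in> carrier M"
    then show "f (r \<odot>\<^bsub>M\<^esub> x) \<ominus>\<^bsub>N\<^esub> g (r \<odot>\<^bsub>M\<^esub> x) = r \<odot>\<^bsub>N\<^esub> (f x \<ominus>\<^bsub>N\<^esub> g x)"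
      using assms(3,4) by (simp add: a_minus_def module_hom_simps N.smult_r_distr N.smult_r_minus)
  qed (use assms in \<open>auto simp: module_hom_simps\<close>)
qed

lemma module_hom_sum:
  assumes "module R N" "f \<in> module_hom R M N" "g \<in> module_hom R M N"
  shows "(\<lambda>x. f x \<oplus>\<^bsub>N\<^esub> g x) \<in> module_hom R M N"
proof -
  interpret N: module R N by fact
  show ?thesis
    using assms(2,3) by (intro module_homI) (auto simp: module_hom_simps N.smult_r_distr N.a_ac)
qed

lemma module_subset:
  assumes "module R M" "Z \<subseteq> carrier M" "\<zero>\<^bsub>M\<^esub> \<in> Z"
    and "\<And>x y. x \<in> Z \<Longrightarrow> y \<in> Z \<Longrightarrow> x \<oplus>\<^bsub>M\<^esub> y \<in> Z"
    and "\<And>r x. r \<in> carrier R \<Longrightarrow> x \<in> Z \<Longrightarrow> r \<odot>\<^bsub>M\<^esub> x \<in> Z"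
  shows "module R (M\<lparr>carrier := Z\<rparr>)"
proof -
  interpret M: module R M by fact
  have "\<ominus>\<^bsub>M\<^esub> x \<in> Z" if "x \<in> Z" for x
    using that assms(2) assms(5)[of "\<ominus>\<^bsub>R\<^esub> \<one>\<^bsub>R\<^esub>" x] M.a_inv_smult[of x] by auto
  then have "submodule Z R M"
    using assms by (intro M.submoduleI) auto
  then show ?thesis by (rule submodule.submodule_is_module) (rule assms)
qed

text \<open>The kernel keeps the element type and the operations of \<open>M\<close>, so a syzygy
  lives in the type of its cover and iterated syzygies never change type.\<close>

definition ker_mod :: "('r, 'm, 'd) module_scheme \<Rightarrow> ('r, 'n, 'e) module_scheme \<Rightarrow> ('m \<Rightarrow> 'n) \<Rightarrow>
    ('r, 'm, 'd) module_scheme"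
  where "ker_mod M N f = M\<lparr>carrier := {x \<in> carrier M. f x = \<zero>\<^bsub>N\<^esub>}\<rparr>"

lemma ker_mod_simps [simp]:
  "carrier (ker_mod M N f) = {x \<in> carrier M. f x = \<zero>\<^bsub>N\<^esub>}"
  "add (ker_mod M N f) = add M" "zero (ker_mod M N f) = zero M" "smult (ker_mod M N f) = smult M"
  by (simp_all add: ker_mod_def)

lemma module_ker_mod:
  assumes "module R M" "module R N" "f \<in> module_hom R M N"
  shows "module R (ker_mod M N f)"
proof -
  interpret M: module R M by fact
  interpret N: module R N by fact
  show ?thesis unfolding ker_mod_def
    using module_hom_zero[OF assms] assms(3) by (intro module_subset assms) (auto simp: module_hom_simps)
qed

lemma module_zero_sub: "module R M \<Longrightarrow> module R (M\<lparr>carrier := {\<zero>\<^bsub>M\<^esub>}\<rparr>)"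
  by (rule module_subset) (auto simp: module_def abelian_group_def abelian_monoid.zero_closed
    abelian_monoid.l_zero module.smult_r_null)

text \<open>Quotient modules are never formed: a surjection \<open>p\<close> stands for the quotient
  by its kernel, and this is its universal property. Any choice of preimages defines the induced
  map, because \<open>s\<close> is constant on the fibres of \<open>p\<close>.\<close>

lemma module_hom_factor:
  assumes "module R G" "module R N" "module R Y" "p \<in> module_hom R G N"
    and "p ` carrier G = carrier N" "s \<in> module_hom R G Y"
    and "\<And>x. x \<in> carrier G \<Longrightarrow> p x = \<zero>\<^bsub>N\<^esub> \<Longrightarrow> s x = \<zero>\<^bsub>Y\<^esub>"
  shows "\<exists>t \<in> module_hom R N Y. \<forall>x\<in>carrier G. t (p x) = s x"
proof -
  interpret G: module R G by fact
  interpret N: module R N by fact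
  interpret Y: module R Y by fact
  define t where "t = (\<lambda>y. s (inv_into (carrier G) p y))"
  have i: "inv_into (carrier G) p y \<in> carrier G" "p (inv_into (carrier G) p y) = y" if "y \<in> carrier N" for y
    using that assms(5) by (auto simp: inv_into_into f_inv_into_f)
  have e: "s x = s y" if "x \<in> carrier G" "y \<in> carrier G" "p x = p y" for x y
  proof -
    have "p (x \<ominus>\<^bsub>G\<^esub> y) = \<zero>\<^bsub>N\<^esub>"
      using that module_hom_closed[OF assms(4)] by (simp add: module_hom_minus[OF assms(1,2,4)] N.minus_eq_zero_iff)
    then have "s (x \<ominus>\<^bsub>G\<^esub> y) = \<zero>\<^bsub>Y\<^esub>" using assms(7) that by simp
    then show ?thesis
      using that module_hom_closed[OF assms(6)] by (simp add: module_hom_minus[OF assms(1,3,6)] Y.minus_eq_zero_iff)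
  qed
  have tp: "t (p x) = s x" if "x \<in> carrier G" for x
    unfolding t_def using that assms(4) i by (intro e) (auto simp: module_hom_simps)
  have "t \<in> module_hom R N Y"
  proof (rule module_homI)
    fix x y assume "x \<in> carrier N" "y \<in> carrier N"
    then obtain x' y' where "x' \<in> carrier G" "y' \<in> carrier G" "x = p x'" "y = p y'"
      using assms(5) by (metis (no_types, lifting) imageE)
    then show "t (x \<oplus>\<^bsub>N\<^esub> y) = t x \<oplus>\<^bsub>Y\<^esub> t y"
      using assms(4,6) by (simp flip: module_hom_add[OF assms(4)] add: tp module_hom_add[OF assms(6)])
  next
    fix r x assume "r \<in> carrier R" "x \<in> carrier N"
    then obtain x' where "x' \<in> carrier G" "x = p x'"
      using assms(5) by (metis (no_types, lifting) imageE)
    then show "t (r \<odot>\<^bsub>N\<^esub> x) = r \<odot>\<^bsub>Y\<^esub> t x"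
      using \<open>r \<in> _\<close> by (simp flip: module_hom_smult[OF assms(4)] add: tp module_hom_smult[OF assms(6)])
  next
    show "t x \<in> carrier Y" if "x \<in> carrier N" for x
      unfolding t_def using that i assms(6) by (auto simp: module_hom_simps)
  qed
  then show ?thesis using tp by blast
qed

section \<open>Free modules\<close>

definition free_unit :: "('r, 'c) ring_scheme \<Rightarrow> 'b set \<Rightarrow> 'b \<Rightarrow> 'b \<Rightarrow> 'r"
  where "free_unit R B b = (\<lambda>x\<in>B. if x = b then \<one>\<^bsub>R\<^esub> else \<zero>\<^bsub>R\<^esub>)"

lemma free_module_simps:
  "c \<in> carrier (free_module R B) \<longleftrightarrow> c \<in> B \<rightarrow>\<^sub>E carrier R \<and> finite {b \<in> B. c b \<noteq> \<zero>\<^bsub>R\<^esub>}"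
  "\<zero>\<^bsub>free_module R B\<^esub> = (\<lambda>b\<in>B. \<zero>\<^bsub>R\<^esub>)"
  "c \<oplus>\<^bsub>free_module R B\<^esub> d = (\<lambda>b\<in>B. c b \<oplus>\<^bsub>R\<^esub> d b)"
  "r \<odot>\<^bsub>free_module R B\<^esub> c = (\<lambda>b\<in>B. r \<otimes>\<^bsub>R\<^esub> c b)"
  by (auto simp: free_module_def)

lemma module_free_module:
  assumes "cring R"
  shows "module R (free_module R B)"
proof -
  interpret R: cring R by fact
  let ?F = "free_module R B"
  have fa: "finite {b \<in> B. c b \<oplus>\<^bsub>R\<^esub> d b \<noteq> \<zero>\<^bsub>R\<^esub>}"
    if "finite {b \<in> B. c b \<noteq> \<zero>\<^bsub>R\<^esub>}" "finite {b \<in> B. d b \<noteq> \<zero>\<^bsub>R\<^esub>}" for c d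
    by (rule finite_subset[OF _ finite_UnI[OF that]]) auto
  have fs: "finite {b \<in> B. r \<otimes>\<^bsub>R\<^esub> c b \<noteq> \<zero>\<^bsub>R\<^esub>}" if "finite {b \<in> B. c b \<noteq> \<zero>\<^bsub>R\<^esub>}" "r \<in> carrier R" for c r
    by (rule finite_subset[OF _ that(1)]) (use that in auto)
  have fn: "finite {b \<in> B. \<ominus>\<^bsub>R\<^esub> c b \<noteq> \<zero>\<^bsub>R\<^esub>}" if "finite {b \<in> B. c b \<noteq> \<zero>\<^bsub>R\<^esub>}" for c
    by (rule finite_subset[OF _ that(1)]) auto
  have "abelian_group ?F"
  proof (rule abelian_groupI)
    fix c assume "c \<in> carrier ?F"
    then show "\<exists>d\<in>carrier ?F. d \<oplus>\<^bsub>?F\<^esub> c = \<zero>\<^bsub>?F\<^esub>"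
      by (intro bexI[of _ "\<lambda>b\<in>B. \<ominus>\<^bsub>R\<^esub> c b"])
        (auto simp: free_module_simps Pi_iff R.l_neg PiE_iff fn cong: conj_cong intro!: restrict_ext)
  qed (auto simp: free_module_simps PiE_iff fa R.a_ac extensional_def restrict_def fun_eq_iff cong: conj_cong)
  then show ?thesis
    by (intro moduleI assms)
      (auto simp: free_module_simps PiE_iff fa fs R.a_ac R.m_ac R.l_distr R.r_distr extensional_def restrict_def fun_eq_iff cong: conj_cong)
qed

lemma free_unit_closed: "cring R \<Longrightarrow> b \<in> B \<Longrightarrow> free_unit R B b \<in> carrier (free_module R B)"
  by (auto simp: free_module_simps free_unit_def cring_def ring.ring_simprules cong: conj_cong if_cong)

lemma free_module_hom_exists:
  assumes "module R X" "\<And>b. b \<in> B \<Longrightarrow> x b \<in> carrier X"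
  shows "\<exists>\<phi> \<in> module_hom R (free_module R B) X. \<forall>b\<in>B. \<phi> (free_unit R B b) = x b"
proof -
  interpret X: module R X by fact
  let ?F = "free_module R B"
  define \<phi> where "\<phi> c = finsum X (\<lambda>b. c b \<odot>\<^bsub>X\<^esub> x b) {b \<in> B. c b \<noteq> \<zero>\<^bsub>R\<^esub>}" for c
  \<comment> \<open>The sum may be taken over any finite set containing the support, which puts
    \<open>c\<close>, \<open>d\<close> and their sum over one index set.\<close>
  have sup: "\<phi> c = finsum X (\<lambda>b. c b \<odot>\<^bsub>X\<^esub> x b) A"
    if "c \<in> B \<rightarrow> carrier R" "finite A" "A \<subseteq> B" "{b \<in> B. c b \<noteq> \<zero>\<^bsub>R\<^esub>} \<subseteq> A" for c A
    unfolding \<phi>_def using that assms(2)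
    by (intro X.add.finprod_mono_neutral_cong_left) (auto simp: Pi_iff subset_iff)
  have "\<phi> \<in> module_hom R ?F X"
  proof (rule module_homI)
    fix c assume c: "c \<in> carrier ?F"
    then show "\<phi> c \<in> carrier X"
      unfolding \<phi>_def using assms(2) by (intro X.finsum_closed) (auto simp: free_module_simps PiE_iff)
    fix d assume d: "d \<in> carrier ?F"
    let ?A = "{b \<in> B. c b \<noteq> \<zero>\<^bsub>R\<^esub>} \<union> {b \<in> B. d b \<noteq> \<zero>\<^bsub>R\<^esub>}"
    have A: "finite ?A" using c d by (auto simp: free_module_simps)
    have "\<phi> (c \<oplus>\<^bsub>?F\<^esub> d) = finsum X (\<lambda>b. (c \<oplus>\<^bsub>?F\<^esub> d) b \<odot>\<^bsub>X\<^esub> x b) ?A"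
      by (rule sup) (use A c d in \<open>auto simp: free_module_simps PiE_iff\<close>)
    also have "\<dots> = finsum X (\<lambda>b. c b \<odot>\<^bsub>X\<^esub> x b \<oplus>\<^bsub>X\<^esub> d b \<odot>\<^bsub>X\<^esub> x b) ?A"
      by (rule X.finsum_cong') (use assms(2) c d in \<open>auto simp: free_module_simps PiE_iff X.smult_l_distr\<close>)
    also have "\<dots> = finsum X (\<lambda>b. c b \<odot>\<^bsub>X\<^esub> x b) ?A \<oplus>\<^bsub>X\<^esub> finsum X (\<lambda>b. d b \<odot>\<^bsub>X\<^esub> x b) ?A"
      by (rule X.finsum_addf) (use assms(2) c d in \<open>auto simp: free_module_simps PiE_iff\<close>)
    also have "finsum X (\<lambda>b. c b \<odot>\<^bsub>X\<^esub> x b) ?A = \<phi> c"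
      by (rule sup[symmetric]) (use A c in \<open>auto simp: free_module_simps PiE_iff\<close>)
    also have "finsum X (\<lambda>b. d b \<odot>\<^bsub>X\<^esub> x b) ?A = \<phi> d"
      by (rule sup[symmetric]) (use A d in \<open>auto simp: free_module_simps PiE_iff\<close>)
    finally show "\<phi> (c \<oplus>\<^bsub>?F\<^esub> d) = \<phi> c \<oplus>\<^bsub>X\<^esub> \<phi> d" .
  next
    fix r c assume r: "r \<in> carrier R" and c: "c \<in> carrier ?F"
    let ?A = "{b \<in> B. c b \<noteq> \<zero>\<^bsub>R\<^esub>}"
    have A: "finite ?A" using c by (auto simp: free_module_simps)
    have "\<phi> (r \<odot>\<^bsub>?F\<^esub> c) = finsum X (\<lambda>b. (r \<odot>\<^bsub>?F\<^esub> c) b \<odot>\<^bsub>X\<^esub> x b) ?A"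
      by (rule sup) (use A c r in \<open>auto simp: free_module_simps PiE_iff\<close>)
    also have "\<dots> = finsum X (\<lambda>b. r \<odot>\<^bsub>X\<^esub> (c b \<odot>\<^bsub>X\<^esub> x b)) ?A"
      by (rule X.finsum_cong') (use assms(2) c r in \<open>auto simp: free_module_simps PiE_iff X.smult_assoc1\<close>)
    also have "\<dots> = r \<odot>\<^bsub>X\<^esub> \<phi> c"
      unfolding \<phi>_def by (rule X.finsum_smult_ldistr[symmetric]) (use A assms(2) c r in \<open>auto simp: free_module_simps PiE_iff\<close>)
    finally show "\<phi> (r \<odot>\<^bsub>?F\<^esub> c) = r \<odot>\<^bsub>X\<^esub> \<phi> c" .
  qed
  moreover have "\<phi> (free_unit R B b) = x b" if "b \<in> B" for b
  proof -
    have "\<phi> (free_unit R B b) = finsum X (\<lambda>a. free_unit R B b a \<odot>\<^bsub>X\<^esub> x a) {b}"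
      by (rule sup) (use that in \<open>auto simp: free_unit_def\<close>)
    also have "\<dots> = x b" using that assms(2) by (simp add: free_unit_def)
    finally show ?thesis .
  qed
  ultimately show ?thesis by blast
qed

text \<open>Induction on the size of the support: one coordinate at a time is split off as a
  multiple of a unit vector.\<close>

lemma free_module_hom_eq:
  assumes "module R X" "\<phi> \<in> module_hom R (free_module R B) X" "\<psi> \<in> module_hom R (free_module R B) X"
    and "\<And>b. b \<in> B \<Longrightarrow> \<phi> (free_unit R B b) = \<psi> (free_unit R B b)" "c \<in> carrier (free_module R B)"
  shows "\<phi> c = \<psi> c"
proof -
  interpret X: module R X by fact
  let ?F = "free_module R B"
  have F: "module R ?F" by (rule module_free_module) (rule X.is_cring)
  show ?thesis
    using assms(5)
  proof (induction "card {b \<in> B. c b \<noteq> \<zero>\<^bsub>R\<^esub>}" arbitrary: c)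
    case 0
    then have "{b \<in> B. c b \<noteq> \<zero>\<^bsub>R\<^esub>} = {}" by (auto simp: free_module_simps)
    then have "c = \<zero>\<^bsub>?F\<^esub>" using 0 by (auto simp: free_module_simps PiE_iff extensional_def fun_eq_iff)
    then show ?case using module_hom_zero[OF F assms(1) assms(2)] module_hom_zero[OF F assms(1) assms(3)] by simp
  next
    case (Suc n)
    let ?A = "{b \<in> B. c b \<noteq> \<zero>\<^bsub>R\<^esub>}"
    have fin: "finite ?A" using Suc by (auto simp: free_module_simps)
    obtain b where b: "b \<in> ?A" using Suc.hyps(2) by (metis card.empty ex_in_conv nat.simps(3))
    let ?d = "c(b := \<zero>\<^bsub>R\<^esub>)"
    have A: "{a \<in> B. ?d a \<noteq> \<zero>\<^bsub>R\<^esub>} = ?A - {b}" by auto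
    have d: "?d \<in> carrier ?F"
      unfolding free_module_simps A using Suc.prems b fin by (auto simp: free_module_simps PiE_iff extensional_def)
    have cb: "c b \<in> carrier R" using Suc.prems b by (auto simp: free_module_simps)
    have u: "free_unit R B b \<in> carrier ?F" using b X.is_cring by (intro free_unit_closed) auto
    have "c = ?d \<oplus>\<^bsub>?F\<^esub> c b \<odot>\<^bsub>?F\<^esub> free_unit R B b"
      using Suc.prems b cb
      by (auto simp: free_module_simps free_unit_def PiE_iff extensional_def fun_eq_iff)
    moreover have "\<phi> ?d = \<psi> ?d"
    proof (rule Suc.hyps(1)[OF _ d])
      show "n = card {a \<in> B. ?d a \<noteq> \<zero>\<^bsub>R\<^esub>}" using Suc.hyps(2) b fin unfolding A by simp
    qed
    moreover have "c b \<odot>\<^bsub>?F\<^esub> free_unit R B b \<in> carrier ?F" using cb u module.smult_closed[OF F] by blast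
    ultimately show ?case
      using module_hom_add[OF assms(2) d, of "c b \<odot>\<^bsub>?F\<^esub> free_unit R B b"]
        module_hom_add[OF assms(3) d, of "c b \<odot>\<^bsub>?F\<^esub> free_unit R B b"]
        module_hom_smult[OF assms(2) cb u] module_hom_smult[OF assms(3) cb u] assms(4) b by auto
  qed
qed

lemma free_module_lift:
  assumes "module R X" "module R C" "g \<in> module_hom R X C" "g ` carrier X = carrier C"
    and "h \<in> module_hom R (free_module R B) C"
  shows "\<exists>k \<in> module_hom R (free_module R B) X. \<forall>c\<in>carrier (free_module R B). g (k c) = h c"
proof -
  have R: "cring R" using assms(1) by (rule module_cring)
  have "\<forall>b\<in>B. \<exists>x. x \<in> carrier X \<and> g x = h (free_unit R B b)"
    using assms(4) module_hom_closed[OF assms(5) free_unit_closed[OF R]] by (metis (no_types, lifting) imageE)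
  then obtain x where x: "\<And>b. b \<in> B \<Longrightarrow> x b \<in> carrier X" "\<And>b. b \<in> B \<Longrightarrow> g (x b) = h (free_unit R B b)"
    by metis
  obtain k where k: "k \<in> module_hom R (free_module R B) X" "\<And>b. b \<in> B \<Longrightarrow> k (free_unit R B b) = x b"
    using free_module_hom_exists[OF assms(1), of B x] x by blast
  have "g (k c) = h c" if "c \<in> carrier (free_module R B)" for c
    by (rule free_module_hom_eq[OF assms(2) module_hom_comp[OF k(1) assms(3)] assms(5) _ that])
      (simp add: k x)
  then show ?thesis using k(1) by blast
qed

section \<open>Projective modules\<close>

lemma projective_module: "projective R P \<Longrightarrow> module R P"
  by (simp add: projective_def)

lemma projective_lift:
  fixes P :: "('r, 'm, 'd) module_scheme"
  assumes "projective R P" "module R X" "module R C" "g \<in> module_hom R X C" "g ` carrier X = carrier C"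
    and "h \<in> module_hom R P C"
  shows "\<exists>k \<in> module_hom R P X. \<forall>x\<in>carrier P. g (k x) = h x"
proof -
  obtain B :: "'m set" and i p where ip: "i \<in> module_hom R P (free_module R B)" "p \<in> module_hom R (free_module R B) P"
    "\<forall>x\<in>carrier P. p (i x) = x"
    using assms(1) by (auto simp: projective_def)
  obtain k where k: "k \<in> module_hom R (free_module R B) X" "\<forall>c\<in>carrier (free_module R B). g (k c) = h (p c)"
    using free_module_lift[OF assms(2-5) module_hom_comp[OF ip(2) assms(6)]] by blast
  show ?thesis
    using module_hom_comp[OF ip(1) k(1)] k(2) ip by (intro bexI) (auto simp: module_hom_closed)
qed

lemma free_module_cover:
  assumes "module R P"
  shows "\<exists>p \<in> module_hom R (free_module R (carrier P)) P. (\<forall>x\<in>carrier P. p (free_unit R (carrier P) x) = x) \<and>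
    p ` carrier (free_module R (carrier P)) = carrier P"
proof -
  obtain p where p: "p \<in> module_hom R (free_module R (carrier P)) P"
    "\<forall>x\<in>carrier P. p (free_unit R (carrier P) x) = x"
    using free_module_hom_exists[OF assms, of "carrier P" "\<lambda>x. x"] by blast
  have "x \<in> p ` carrier (free_module R (carrier P))" if "x \<in> carrier P" for x
    using p(2) that free_unit_closed[OF module_cring[OF assms] that] by (metis image_eqI)
  then show ?thesis using p module_hom_closed[OF p(1)] by blast
qed

text \<open>Testing surjections from modules with elements of type
  \<open>'m \<Rightarrow> 'r\<close> is enough: the free cover on the carrier of \<open>P\<close> is
  one of them, and a section of it exhibits \<open>P\<close> as a summand.\<close>

lemma projectiveI_section:
  assumes "module R P"
    and "\<And>X g. module R (X :: ('r, 'm \<Rightarrow> 'r) module) \<Longrightarrow> g \<in> module_hom R X P \<Longrightarrow> g ` carrier X = carrier P \<Longrightarrow>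
      \<exists>s \<in> module_hom R P X. \<forall>x\<in>carrier P. g (s x) = x"
  shows "projective R (P :: ('r, 'm, 'd) module_scheme)"
proof -
  obtain p where p: "p \<in> module_hom R (free_module R (carrier P)) P"
    "p ` carrier (free_module R (carrier P)) = carrier P"
    using free_module_cover[OF assms(1)] by blast
  then obtain s where "s \<in> module_hom R P (free_module R (carrier P))" "\<forall>x\<in>carrier P. p (s x) = x"
    using assms(2)[OF module_free_module p] module_cring[OF assms(1)] by blast
  then show ?thesis unfolding projective_def using p(1) assms(1) by blast
qed

text \<open>The definition of \<open>projective\<close> admits only bases consisting of elements of
  the type of \<open>P\<close>; here the basis may have any type. The free module on
  \<open>B\<close> provides the lifts, and a section of the free cover of \<open>P\<close> leads
  back to a basis of the required type.\<close>

lemma projective_if_retract_free: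
  assumes "module R P" "i \<in> module_hom R P (free_module R B)" "p \<in> module_hom R (free_module R B) P"
    and "\<And>x. x \<in> carrier P \<Longrightarrow> p (i x) = x"
  shows "projective R P"
proof (rule projectiveI_section)
  fix X :: "('a, 'c \<Rightarrow> 'a) module" and g
  assume X: "module R X" "g \<in> module_hom R X P" "g ` carrier X = carrier P"
  obtain k where k: "k \<in> module_hom R (free_module R B) X" "\<forall>c\<in>carrier (free_module R B). g (k c) = p c"
    using free_module_lift[OF X(1) assms(1) X(2,3) assms(3)] by blast
  show "\<exists>s \<in> module_hom R P X. \<forall>x\<in>carrier P. g (s x) = x"
    using module_hom_comp[OF assms(2) k(1)] k(2) assms(2,4) by (intro bexI) (auto simp: module_hom_closed)
qed (rule assms)

lemma projective_free_module: "cring R \<Longrightarrow> projective R (free_module R B)"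
  by (rule projective_if_retract_free[where i = "\<lambda>x. x" and p = "\<lambda>x. x"])
    (auto intro: module_free_module module_hom_id)

lemma projective_retract:
  fixes Q :: "('r, 'm, 'd) module_scheme"
  assumes "module R P" "projective R Q" "i \<in> module_hom R P Q" "p \<in> module_hom R Q P"
    and "\<And>x. x \<in> carrier P \<Longrightarrow> p (i x) = x"
  shows "projective R P"
proof -
  obtain B :: "'m set" and j q where jq: "j \<in> module_hom R Q (free_module R B)" "q \<in> module_hom R (free_module R B) Q"
    "\<forall>x\<in>carrier Q. q (j x) = x"
    using assms(2) by (auto simp: projective_def)
  show ?thesis
    using assms jq by (intro projective_if_retract_free[OF assms(1) module_hom_comp[OF assms(3) jq(1)] module_hom_comp[OF jq(2) assms(4)]])
      (auto simp: module_hom_closed)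
qed

lemma projective_zero_module:
  assumes "module R M" "carrier M = {\<zero>\<^bsub>M\<^esub>}"
  shows "projective R M"
proof -
  interpret M: module R M by fact
  interpret F: module R "free_module R ({} :: 'a set)" by (rule module_free_module) (rule M.is_cring)
  show ?thesis
    by (rule projective_if_retract_free[OF assms(1), where B = "{} :: 'a set" and i = "\<lambda>_. \<zero>\<^bsub>free_module R {}\<^esub>" and p = "\<lambda>_. \<zero>\<^bsub>M\<^esub>"])
      (auto intro!: module_homI simp: assms(2))
qed

section \<open>Projective dimension\<close>

definition transport_module :: "('m \<Rightarrow> 'u) \<Rightarrow> ('r, 'm, 'd) module_scheme \<Rightarrow> ('r, 'u) module"
  where "transport_module e M = \<lparr>carrier = e ` carrier M, mult = undefined, one = undefined, zero = e \<zero>\<^bsub>M\<^esub>,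
    add = (\<lambda>x y. e (inv_into (carrier M) e x \<oplus>\<^bsub>M\<^esub> inv_into (carrier M) e y)),
    smult = (\<lambda>r x. e (r \<odot>\<^bsub>M\<^esub> inv_into (carrier M) e x))\<rparr>"

text \<open>This makes modules with elements in unrelated types comparable: a copy of each can be
  placed in a type that has room for both.\<close>

lemma transport_module:
  assumes "module R M" "inj_on e (carrier M)"
  shows module_transport: "module R (transport_module e M)"
    and transport_hom: "e \<in> module_hom R M (transport_module e M)"
    and transport_inv_hom: "inv_into (carrier M) e \<in> module_hom R (transport_module e M) M"
    and carrier_transport: "carrier (transport_module e M) = e ` carrier M"
    and zero_transport: "\<zero>\<^bsub>transport_module e M\<^esub> = e \<zero>\<^bsub>M\<^esub>"
proof -
  interpret M: module R M by fact
  let ?T = "transport_module e M"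
  have T: "carrier ?T = e ` carrier M" "\<zero>\<^bsub>?T\<^esub> = e \<zero>\<^bsub>M\<^esub>"
    "\<And>x y. x \<in> carrier M \<Longrightarrow> y \<in> carrier M \<Longrightarrow> e x \<oplus>\<^bsub>?T\<^esub> e y = e (x \<oplus>\<^bsub>M\<^esub> y)"
    "\<And>r x. x \<in> carrier M \<Longrightarrow> r \<odot>\<^bsub>?T\<^esub> e x = e (r \<odot>\<^bsub>M\<^esub> x)"
    using assms(2) by (auto simp: transport_module_def)
  then show "carrier ?T = e ` carrier M" "\<zero>\<^bsub>?T\<^esub> = e \<zero>\<^bsub>M\<^esub>" by simp_all
  have "abelian_group ?T"
  proof (rule abelian_groupI)
    fix x assume "x \<in> carrier ?T"
    then obtain y where y: "y \<in> carrier M" "x = e y" by (auto simp: T)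
    then show "\<exists>z\<in>carrier ?T. z \<oplus>\<^bsub>?T\<^esub> x = \<zero>\<^bsub>?T\<^esub>"
      by (intro bexI[of _ "e (\<ominus>\<^bsub>M\<^esub> y)"]) (auto simp: T M.l_neg)
  qed (auto simp: T M.a_ac)
  then show "module R ?T"
    by (intro moduleI M.is_cring) (auto simp: T M.smult_l_distr M.smult_r_distr M.smult_assoc1)
  show "e \<in> module_hom R M ?T" by (rule module_homI) (auto simp: T)
  show "inv_into (carrier M) e \<in> module_hom R ?T M"
    by (rule module_homI) (auto simp: T assms(2))
qed

text \<open>A self-delimiting code: every entry is announced by \<open>a\<close> and the end is
  marked by \<open>b\<close>. Markers sit at the even positions, so entries equal to
  \<open>a\<close> or \<open>b\<close> cause no confusion, and concatenated codes can be split again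
  as soon as \<open>a\<close> and \<open>b\<close> differ.\<close>

fun wrap_list :: "'x \<Rightarrow> 'x \<Rightarrow> 'x list \<Rightarrow> 'x list"
  where "wrap_list a b [] = [b]"
  | "wrap_list a b (x # xs) = a # x # wrap_list a b xs"

fun encode_lists :: "'x \<Rightarrow> 'x \<Rightarrow> 'x list list \<Rightarrow> 'x list"
  where "encode_lists a b [] = []"
  | "encode_lists a b (xs # xss) = wrap_list a b xs @ encode_lists a b xss"

lemma wrap_list_append_eq:
  "a \<noteq> b \<Longrightarrow> wrap_list a b xs @ us = wrap_list a b ys @ vs \<Longrightarrow> xs = ys \<and> us = vs"
proof (induction xs arbitrary: ys)
  case Nil
  then show ?case by (cases ys) auto
next
  case (Cons x xs)
  then show ?case by (cases ys) auto
qed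

lemma wrap_list_not_Nil: "wrap_list a b xs \<noteq> []"
  by (cases xs) auto

lemma encode_lists_inject: "a \<noteq> b \<Longrightarrow> encode_lists a b xss = encode_lists a b yss \<Longrightarrow> xss = yss"
proof (induction xss arbitrary: yss)
  case Nil
  then show ?case by (cases yss) (auto simp: wrap_list_not_Nil)
next
  case (Cons xs xss)
  then show ?case
    by (cases yss) (auto simp: wrap_list_not_Nil dest: wrap_list_append_eq)
qed

text \<open>Up to injections, the list type is closed under forming free modules on its subsets: a
  finitely supported function is recorded as the list of its support, each basis element followed by
  its coefficient as a one-element list, and this list of lists is flattened.\<close>

lemma free_module_encode:
  "\<exists>e :: (('r + 'z) list \<Rightarrow> 'r) \<Rightarrow> ('r + 'z) list. inj_on e (carrier (free_module R B))"
proof -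
  define ls where "ls c = (SOME xs. set xs = {b \<in> B. c b \<noteq> \<zero>\<^bsub>R\<^esub>})" for c :: "('r + 'z) list \<Rightarrow> 'r"
  define pairs where "pairs c xs = concat (map (\<lambda>b. [b, [Inl (c b)]]) xs)" for c :: "('r + 'z) list \<Rightarrow> 'r" and xs
  \<comment> \<open>The first two arguments are merely markers; \<open>Inl\<close> and
    \<open>Inr\<close> make them different.\<close>
  define e where "e c = encode_lists (Inl undefined) (Inr undefined) (pairs c (ls c))" for c
  have ls: "set (ls c) = {b \<in> B. c b \<noteq> \<zero>\<^bsub>R\<^esub>}" if "c \<in> carrier (free_module R B)" for c
    unfolding ls_def by (rule someI_ex, rule finite_list) (use that in \<open>simp add: free_module_simps\<close>)
  have pairs: "xs = ys \<and> (\<forall>b\<in>set xs. c b = d b)" if "pairs c xs = pairs d ys" for c d xs ys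
    using that
  proof (induction xs arbitrary: ys)
    case Nil
    then show ?case by (cases ys) (auto simp: pairs_def)
  next
    case (Cons x xs)
    then show ?case by (cases ys) (auto simp: pairs_def)
  qed
  have "c = d" if c: "c \<in> carrier (free_module R B)" and d: "d \<in> carrier (free_module R B)" and "e c = e d" for c d
  proof
    fix b
    have *: "ls c = ls d" "\<forall>b\<in>set (ls c). c b = d b"
      using pairs[OF encode_lists_inject[OF _ that(3)[unfolded e_def]]] by auto
    consider "b \<in> set (ls c)" | "b \<in> B" "b \<notin> set (ls c)" | "b \<notin> B" by blast
    then show "c b = d b"
    proof cases
      case 2
      then show ?thesis using ls[OF c] ls[OF d] *(1) by auto
    next
      case 3
      then show ?thesis using c d by (auto simp: free_module_simps PiE_iff extensional_def)
    qed (use * in auto)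
  qed
  then show ?thesis unfolding inj_on_def by blast
qed

lemma projective_transport:
  assumes "projective R P" "inj_on e (carrier P)"
  shows "projective R (transport_module e P)"
proof -
  note T = transport_module[OF projective_module[OF assms(1)] assms(2)]
  show ?thesis
    by (rule projective_retract[OF T(1) assms(1) T(3) T(2)]) (use assms(2) in \<open>auto simp: T(4)\<close>)
qed

lemma projective_cover_exists:
  assumes "module R (M :: ('r, ('r + 'z) list, 'd) module_scheme)"
  shows "\<exists>(G :: ('r, ('r + 'z) list) module) g. projective R G \<and> g \<in> module_hom R G M \<and> g ` carrier G = carrier M"
proof -
  let ?F = "free_module R (carrier M)"
  have R: "cring R" by (rule module_cring) fact
  obtain e :: "(('r + 'z) list \<Rightarrow> 'r) \<Rightarrow> ('r + 'z) list" where e: "inj_on e (carrier ?F)"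
    using free_module_encode by blast
  note T = transport_module[OF module_free_module[OF R] e]
  obtain p where p: "p \<in> module_hom R ?F M" "p ` carrier ?F = carrier M"
    using free_module_cover[OF assms] by blast
  have "(\<lambda>x. p (inv_into (carrier ?F) e x)) ` carrier (transport_module e ?F) = carrier M"
    using p(2) e by (auto simp: T(4) image_image)
  then show ?thesis
    using projective_transport[OF projective_free_module[OF R] e] module_hom_comp[OF T(3) p(1)] by blast
qed

text \<open>The existence of a resolution of length at most \<open>n\<close>, unfolded one syzygy at
  a time for use in inductions. Only some cover is required at each stage; that every cover works is
  the content of \<open>pd_ker\<close>.\<close>

primrec pd_le :: "('r, 'c) ring_scheme \<Rightarrow> nat \<Rightarrow> ('r, 'u) module \<Rightarrow> bool"
  where "pd_le R 0 M = projective R M"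
  | "pd_le R (Suc n) M = (\<exists>(F :: ('r, 'u) module) f. projective R F \<and> f \<in> module_hom R F M \<and>
      f ` carrier F = carrier M \<and> pd_le R n (ker_mod F M f))"

text \<open>The identity of \<open>M\<close> is a sum of a map through \<open>M'\<close> and a map through \<open>F\<close>. For projective \<open>F\<close>
  this property passes to kernels of projective covers; it replaces Schanuel's lemma and lets one
  compare resolutions whose modules live in different types.\<close>

definition stable_retract :: "('r, 'c) ring_scheme \<Rightarrow> ('r, 'm, 'd) module_scheme \<Rightarrow> ('r, 'n, 'e) module_scheme \<Rightarrow>
    ('r, 'f, 'g) module_scheme \<Rightarrow> bool"
  where "stable_retract R M M' F \<longleftrightarrow> (\<exists>a b q p.
    a \<in> module_hom R M M' \<and> b \<in> module_hom R M' M \<and> q \<in> module_hom R M F \<and> p \<in> module_hom R F M \<and>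
    (\<forall>x\<in>carrier M. x = b (a x) \<oplus>\<^bsub>M\<^esub> p (q x)))"

text \<open>Lifting the given maps to the covers yields \<open>A\<close>, \<open>B\<close> and
  \<open>P\<close>. The identity minus the sum of \<open>B A\<close> and \<open>P q g\<close> maps
  all of \<open>G\<close> into the kernel of \<open>g\<close>, and \<open>P q g\<close> vanishes on
  that kernel. So the new correction term factors through \<open>G\<close>, with the inclusion as
  its first map.\<close>

lemma stable_retract_ker:
  assumes "stable_retract R M M' F" "module R M" "module R M'" "projective R F"
    and "projective R G" "g \<in> module_hom R G M" "g ` carrier G = carrier M"
    and "projective R G'" "g' \<in> module_hom R G' M'" "g' ` carrier G' = carrier M'"
  shows "stable_retract R (ker_mod G M g) (ker_mod G' M' g') G"
proof -
  interpret M: module R M by fact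
  interpret M': module R M' by fact
  interpret G: module R G by (rule projective_module) fact
  interpret G': module R G' by (rule projective_module) fact
  interpret F: module R F by (rule projective_module) fact
  obtain a b q p where abqp: "a \<in> module_hom R M M'" "b \<in> module_hom R M' M" "q \<in> module_hom R M F" "p \<in> module_hom R F M"
    "\<And>x. x \<in> carrier M \<Longrightarrow> x = b (a x) \<oplus>\<^bsub>M\<^esub> p (q x)"
    using assms(1) by (auto simp: stable_retract_def)
  obtain A where A: "A \<in> module_hom R G G'" "\<And>x. x \<in> carrier G \<Longrightarrow> g' (A x) = a (g x)"
    using projective_lift[OF assms(5) G'.module_axioms M'.module_axioms assms(9,10) module_hom_comp[OF assms(6) abqp(1)]] by blast
  obtain B where B: "B \<in> module_hom R G' G" "\<And>x. x \<in> carrier G' \<Longrightarrow> g (B x) = b (g' x)"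
    using projective_lift[OF assms(8) G.module_axioms M.module_axioms assms(6,7) module_hom_comp[OF assms(9) abqp(2)]] by blast
  obtain P where P: "P \<in> module_hom R F G" "\<And>x. x \<in> carrier F \<Longrightarrow> g (P x) = p x"
    using projective_lift[OF assms(4) G.module_axioms M.module_axioms assms(6,7) abqp(4)] by blast
  note cl = module_hom_closed[OF A(1)] module_hom_closed[OF B(1)] module_hom_closed[OF P(1)]
    module_hom_closed[OF abqp(1)] module_hom_closed[OF abqp(2)] module_hom_closed[OF abqp(3)] module_hom_closed[OF abqp(4)]
    module_hom_closed[OF assms(6)] module_hom_closed[OF assms(9)]
  define h where "h x = x \<ominus>\<^bsub>G\<^esub> (B (A x) \<oplus>\<^bsub>G\<^esub> P (q (g x)))" for x
  have hG: "h \<in> module_hom R G G"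
    unfolding h_def
    by (intro module_hom_diff module_hom_sum module_hom_id G.module_axioms module_hom_comp[OF A(1) B(1)]
        module_hom_comp[OF module_hom_comp[OF assms(6) abqp(3)] P(1)])
  have gh: "g (h x) = \<zero>\<^bsub>M\<^esub>" if "x \<in> carrier G" for x
  proof -
    have "g (h x) = g x \<ominus>\<^bsub>M\<^esub> (b (a (g x)) \<oplus>\<^bsub>M\<^esub> p (q (g x)))"
      unfolding h_def using that
      by (simp add: module_hom_minus[OF G.module_axioms M.module_axioms assms(6)] module_hom_add[OF assms(6)] cl A B P)
    also have "\<dots> = \<zero>\<^bsub>M\<^esub>" using that abqp(5)[of "g x"] M.minus_eq_zero_iff[of "g x" "g x"] by (simp add: cl)
    finally show ?thesis .
  qed
  have eq: "x = B (A x) \<oplus>\<^bsub>G\<^esub> h x" if "x \<in> carrier G" "g x = \<zero>\<^bsub>M\<^esub>" for x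
  proof -
    have "P (q (g x)) = \<zero>\<^bsub>G\<^esub>" using that(2)
      by (simp add: module_hom_zero[OF M.module_axioms F.module_axioms abqp(3)] module_hom_zero[OF F.module_axioms G.module_axioms P(1)])
    then show ?thesis using that by (simp add: h_def a_minus_def cl G.a_lcomm G.r_neg)
  qed
  have a0: "a \<zero>\<^bsub>M\<^esub> = \<zero>\<^bsub>M'\<^esub>" "b \<zero>\<^bsub>M'\<^esub> = \<zero>\<^bsub>M\<^esub>"
    using module_hom_zero[OF M.module_axioms M'.module_axioms abqp(1)] module_hom_zero[OF M'.module_axioms M.module_axioms abqp(2)] by simp_all
  have "A \<in> module_hom R (ker_mod G M g) (ker_mod G' M' g')"
    using A a0 by (auto simp: module_hom_def)
  moreover have "B \<in> module_hom R (ker_mod G' M' g') (ker_mod G M g)"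
    using B a0 by (auto simp: module_hom_def)
  moreover have "(\<lambda>x. x) \<in> module_hom R (ker_mod G M g) G"
    by (auto simp: module_hom_def)
  moreover have "h \<in> module_hom R G (ker_mod G M g)"
    using hG gh by (auto simp: module_hom_def)
  ultimately show ?thesis unfolding stable_retract_def
    using eq by (intro exI[of _ A] exI[of _ B] exI[of _ "\<lambda>x. x"] exI[of _ h]) auto
qed

text \<open>\<open>M\<close> is a retract of the direct sum of \<open>M'\<close> and
  \<open>F\<close>; lifting \<open>b\<close> and \<open>p\<close> separately and adding the results
  avoids forming that sum.\<close>

lemma stable_retract_projective:
  assumes "stable_retract R M M' F" "module R M" "projective R M'" "projective R F"
  shows "projective R M"
proof (rule projectiveI_section[OF assms(2)])
  fix X :: "('a, 'c \<Rightarrow> 'a) module" and g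
  assume X: "module R X" "g \<in> module_hom R X M" "g ` carrier X = carrier M"
  obtain a b q p where abqp: "a \<in> module_hom R M M'" "b \<in> module_hom R M' M" "q \<in> module_hom R M F" "p \<in> module_hom R F M"
    "\<And>x. x \<in> carrier M \<Longrightarrow> x = b (a x) \<oplus>\<^bsub>M\<^esub> p (q x)"
    using assms(1) by (auto simp: stable_retract_def)
  obtain B where B: "B \<in> module_hom R M' X" "\<And>x. x \<in> carrier M' \<Longrightarrow> g (B x) = b x"
    using projective_lift[OF assms(3) X(1) assms(2) X(2,3) abqp(2)] by blast
  obtain P where P: "P \<in> module_hom R F X" "\<And>x. x \<in> carrier F \<Longrightarrow> g (P x) = p x"
    using projective_lift[OF assms(4) X(1) assms(2) X(2,3) abqp(4)] by blast
  have "g (B (a x) \<oplus>\<^bsub>X\<^esub> P (q x)) = x" if "x \<in> carrier M" for x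
    using that module_hom_closed[OF abqp(1)] module_hom_closed[OF abqp(3)]
      module_hom_closed[OF B(1)] module_hom_closed[OF P(1)] abqp(5)[OF that, symmetric]
    by (simp add: module_hom_add[OF X(2)] B P)
  then show "\<exists>s\<in>module_hom R M X. \<forall>x\<in>carrier M. g (s x) = x"
    by (intro bexI[OF _ module_hom_sum[OF X(1) module_hom_comp[OF abqp(1) B(1)] module_hom_comp[OF abqp(3) P(1)]]]) simp
qed

text \<open>Here \<open>F\<close> has the type of \<open>M\<close>, because in the induction its
  place is taken by the cover \<open>G\<close> of \<open>M\<close>.\<close>

lemma pd_le_stable_retract_aux:
  fixes M F :: "('r, ('r + 'z) list) module" and M' :: "('r, 'v) module"
  assumes "stable_retract R M M' F" "module R M" "module R M'" "projective R F" "pd_le R n M'"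
  shows "pd_le R n M"
  using assms
proof (induction n arbitrary: M M' F)
  case 0
  then show ?case using stable_retract_projective[OF 0(1,2) _ 0(4)] by simp
next
  case (Suc n)
  obtain G' :: "('r, 'v) module" and g' where G': "projective R G'" "g' \<in> module_hom R G' M'" "g' ` carrier G' = carrier M'"
    "pd_le R n (ker_mod G' M' g')" using Suc.prems(5) by auto
  obtain G :: "('r, ('r + 'z) list) module" and g where G: "projective R G" "g \<in> module_hom R G M" "g ` carrier G = carrier M"
    using projective_cover_exists[OF Suc.prems(2)] by blast
  have "pd_le R n (ker_mod G M g)"
    by (rule Suc.IH[OF stable_retract_ker[OF Suc.prems(1-4) G G'(1-3)]
        module_ker_mod[OF projective_module[OF G(1)] Suc.prems(2) G(2)]
        module_ker_mod[OF projective_module[OF G'(1)] Suc.prems(3) G'(2)] G(1) G'(4)])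
  then show ?case using G by auto
qed

lemma pd_le_stable_retract:
  fixes M :: "('r, ('r + 'z) list) module" and M' :: "('r, 'v) module"
  assumes "stable_retract R M M' F" "module R M" "module R M'" "projective R F" "pd_le R n M'"
  shows "pd_le R n M"
proof (cases n)
  case 0
  then show ?thesis using stable_retract_projective[OF assms(1,2) _ assms(4)] assms(5) by simp
next
  case (Suc m)
  obtain G' :: "('r, 'v) module" and g' where G': "projective R G'" "g' \<in> module_hom R G' M'" "g' ` carrier G' = carrier M'"
    "pd_le R m (ker_mod G' M' g')" using assms(5) Suc by auto
  obtain G :: "('r, ('r + 'z) list) module" and g where G: "projective R G" "g \<in> module_hom R G M" "g ` carrier G = carrier M"
    using projective_cover_exists[OF assms(2)] by blast
  have "pd_le R m (ker_mod G M g)"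
    by (rule pd_le_stable_retract_aux[OF stable_retract_ker[OF assms(1-4) G G'(1-3)]
        module_ker_mod[OF projective_module[OF G(1)] assms(2) G(2)]
        module_ker_mod[OF projective_module[OF G'(1)] assms(3) G'(2)] G(1) G'(4)])
  then show ?thesis using G Suc by auto
qed

section \<open>Resolutions and the recursive bound\<close>

lemma projective_resolution_shift:
  assumes "projective_resolution R M P d \<epsilon>"
  shows "projective_resolution R (ker_mod (P 0) M \<epsilon>) (\<lambda>i. P (Suc i)) (\<lambda>i. d (Suc i)) (d 0)"
proof -
  have "d 0 ` carrier (P 1) = {x \<in> carrier (P 0). \<epsilon> x = \<zero>\<^bsub>M\<^esub>}" "d 0 \<in> module_hom R (P (Suc 0)) (P 0)"
    using assms by (auto simp: projective_resolution_def)
  then have "d 0 \<in> module_hom R (P (Suc 0)) (ker_mod (P 0) M \<epsilon>)"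
    by (auto simp: module_hom_def)
  then show ?thesis using assms by (simp add: projective_resolution_def)
qed

lemma pd_le_if_resolution:
  fixes M :: "('r, 'u) module" and P :: "nat \<Rightarrow> ('r, 'u) module"
  assumes "module R M" "projective_resolution R M P d \<epsilon>" "\<forall>i>n. carrier (P i) = {\<zero>\<^bsub>P i\<^esub>}"
  shows "pd_le R n M"
  using assms
proof (induction n arbitrary: M P d \<epsilon>)
  case 0
  note r = 0(2)[unfolded projective_resolution_def]
  have P: "module R (P i)" for i using r by (auto intro: projective_module)
  have e: "\<epsilon> \<in> module_hom R (P 0) M" "\<epsilon> ` carrier (P 0) = carrier M" using r by auto
  have "d 0 \<in> module_hom R (P 1) (P 0)" using r by auto
  then have "d 0 \<zero>\<^bsub>P 1\<^esub> = \<zero>\<^bsub>P 0\<^esub>" by (rule module_hom_zero[OF P P])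
  \<comment> \<open>\<open>P 1\<close> is zero, so exactness at \<open>P 0\<close> makes \<epsilon>
    injective and hence an isomorphism onto \<open>M\<close>.\<close>
  then have "\<epsilon> x = \<zero>\<^bsub>M\<^esub> \<Longrightarrow> x = \<zero>\<^bsub>P 0\<^esub>" if "x \<in> carrier (P 0)" for x
    using that r 0(3) by auto
  then obtain t where t: "t \<in> module_hom R M (P 0)" "\<forall>x\<in>carrier (P 0). t (\<epsilon> x) = x"
    using module_hom_factor[OF P 0(1) P e module_hom_id] by blast
  have "\<epsilon> (t y) = y" if "y \<in> carrier M" for y
    using t(2) that unfolding e(2)[symmetric] by auto
  then show ?case using projective_retract[OF 0(1) _ t(1) e(1)] r by auto
next
  case (Suc n)
  note r = Suc.prems(2)[unfolded projective_resolution_def]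
  have "module R (ker_mod (P 0) M \<epsilon>)"
    using r by (intro module_ker_mod Suc.prems(1)) (auto intro: projective_module)
  then have "pd_le R n (ker_mod (P 0) M \<epsilon>)"
    using Suc.prems(3) by (intro Suc.IH[OF _ projective_resolution_shift[OF Suc.prems(2)]]) auto
  then show ?case using r by auto
qed

lemma resolution_if_pd_le:
  fixes M :: "('r, 'u) module"
  assumes "module R M" "pd_le R n M"
  shows "\<exists>(P :: nat \<Rightarrow> ('r, 'u) module) d \<epsilon>. projective_resolution R M P d \<epsilon> \<and> (\<forall>i>n. carrier (P i) = {\<zero>\<^bsub>P i\<^esub>})"
  using assms
proof (induction n arbitrary: M)
  case 0
  let ?Z = "M\<lparr>carrier := {\<zero>\<^bsub>M\<^esub>}\<rparr>"
  interpret M: module R M by fact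
  have Z: "projective R ?Z" by (rule projective_zero_module) (auto intro: module_zero_sub 0)
  \<comment> \<open>\<open>M\<close> itself in degree 0 and zero modules above it, with zero
    differentials.\<close>
  have "projective_resolution R M (case_nat M (\<lambda>_. ?Z)) (\<lambda>_ _. \<zero>\<^bsub>M\<^esub>) (\<lambda>x. x)"
    using 0(2) Z by (auto simp: projective_resolution_def module_hom_def split: nat.split)
  then show ?case
    by (intro exI[of _ "case_nat M (\<lambda>_. ?Z)"] exI conjI) (auto split: nat.split)
next
  case (Suc n)
  obtain F :: "('r, 'u) module" and f where F: "projective R F" "f \<in> module_hom R F M" "f ` carrier F = carrier M"
    "pd_le R n (ker_mod F M f)" using Suc.prems(2) by auto
  obtain P :: "nat \<Rightarrow> ('r, 'u) module" and d \<epsilon> where P: "projective_resolution R (ker_mod F M f) P d \<epsilon>"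
    "\<forall>i>n. carrier (P i) = {\<zero>\<^bsub>P i\<^esub>}"
    using Suc.IH[OF module_ker_mod F(4)] F(1,2) Suc.prems(1) projective_module by blast
  note r = P(1)[unfolded projective_resolution_def]
  have e: "\<epsilon> \<in> module_hom R (P 0) F" using r by (auto simp: module_hom_def)
  have "projective_resolution R M (case_nat F P) (case_nat \<epsilon> d) f"
    unfolding projective_resolution_def
  proof (intro conjI allI)
    show "projective R (case i of 0 \<Rightarrow> F | Suc x \<Rightarrow> P x)" for i
      using F(1) r by (auto split: nat.split)
    show "(case i of 0 \<Rightarrow> \<epsilon> | Suc x \<Rightarrow> d x) \<in> module_hom R (case Suc i of 0 \<Rightarrow> F | Suc x \<Rightarrow> P x) (case i of 0 \<Rightarrow> F | Suc x \<Rightarrow> P x)" for i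
      using r e by (auto split: nat.split)
    show "(case Suc i of 0 \<Rightarrow> \<epsilon> | Suc x \<Rightarrow> d x) ` carrier (case Suc (Suc i) of 0 \<Rightarrow> F | Suc x \<Rightarrow> P x) =
      {x \<in> carrier (case Suc i of 0 \<Rightarrow> F | Suc x \<Rightarrow> P x). (case i of 0 \<Rightarrow> \<epsilon> | Suc x \<Rightarrow> d x) x = \<zero>\<^bsub>case i of 0 \<Rightarrow> F | Suc x \<Rightarrow> P x\<^esub>}" for i
      using r by (cases i) auto
  qed (use F r in auto)
  moreover have "\<forall>i>Suc n. carrier (case_nat F P i) = {\<zero>\<^bsub>case_nat F P i\<^esub>}"
    using P(2) by (auto split: nat.split)
  ultimately show ?case by blast
qed

lemma projective_resolution_iso:
  assumes "projective_resolution R M P d \<epsilon>" "module R M" "module R N"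
    and "f \<in> module_hom R M N" "bij_betw f (carrier M) (carrier N)"
  shows "projective_resolution R N P d (\<lambda>x. f (\<epsilon> x))"
proof -
  note r = assms(1)[unfolded projective_resolution_def]
  have "f (\<epsilon> x) = \<zero>\<^bsub>N\<^esub> \<longleftrightarrow> \<epsilon> x = \<zero>\<^bsub>M\<^esub>" if "x \<in> carrier (P 0)" for x
    using that r assms(5) module_hom_zero[OF assms(2-4)] module_hom_closed[of \<epsilon> R "P 0" M x]
      abelian_monoid.zero_closed[of M] assms(2)
    by (metis (no_types, lifting) bij_betw_inv_into_left abelian_group.axioms(1) module.axioms(2))
  moreover have "(\<lambda>x. f (\<epsilon> x)) ` carrier (P 0) = carrier N"
    using r assms(5) by (simp add: bij_betw_def flip: image_image)
  ultimately show ?thesis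
    unfolding projective_resolution_def using r module_hom_comp[OF _ assms(4), of \<epsilon> "P 0"]
    by (auto cong: conj_cong)
qed

lemma Inf_le_enat: "Inf A \<le> enat n \<longleftrightarrow> (\<exists>x\<in>A. x \<le> enat n)"
proof
  show "Inf A \<le> enat n \<Longrightarrow> \<exists>x\<in>A. x \<le> enat n"
  proof (rule ccontr)
    assume "Inf A \<le> enat n" "\<not> (\<exists>x\<in>A. x \<le> enat n)"
    then have "enat (Suc n) \<le> Inf A" by (intro Inf_greatest) (auto simp: Suc_ile_eq not_le)
    then show False using \<open>Inf A \<le> enat n\<close> Suc_ile_eq leD by blast
  qed
qed (auto intro: Inf_lower2)

text \<open>The bridge between the numerical \<open>pd\<close> and the recursive bound.
  \<open>M\<close> is first copied into the list type, because the recursion takes its covers in the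
  type of the module.\<close>

lemma pd_le_iff:
  fixes M :: "('r, 'm, 'd) module_scheme" and e :: "'m \<Rightarrow> ('r + 'm) list"
  assumes "module R M" "inj_on e (carrier M)"
  shows "pd R M \<le> enat n \<longleftrightarrow> pd_le R n (transport_module e M)"
proof -
  note T = transport_module[OF assms]
  have b: "bij_betw e (carrier M) (carrier (transport_module e M))"
    "bij_betw (inv_into (carrier M) e) (carrier (transport_module e M)) (carrier M)"
    using assms(2) by (auto simp: T(4) bij_betw_def intro!: inj_on_inv_into)
  show ?thesis
  proof
    assume "pd R M \<le> enat n"
    then obtain m and P :: "nat \<Rightarrow> ('r, ('r + 'm) list) module" and d \<epsilon> where
      P: "projective_resolution R M P d \<epsilon>" "m \<le> n" "\<forall>i>m. carrier (P i) = {\<zero>\<^bsub>P i\<^esub>}"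
      unfolding pd_def Inf_le_enat by auto
    show "pd_le R n (transport_module e M)"
      by (rule pd_le_if_resolution[OF T(1) projective_resolution_iso[OF P(1) assms(1) T(1,2) b(1)]])
        (use P in auto)
  next
    assume "pd_le R n (transport_module e M)"
    then obtain P :: "nat \<Rightarrow> ('r, ('r + 'm) list) module" and d \<epsilon> where
      P: "projective_resolution R (transport_module e M) P d \<epsilon>" "\<forall>i>n. carrier (P i) = {\<zero>\<^bsub>P i\<^esub>}"
      using resolution_if_pd_le[OF T(1)] by blast
    then show "pd R M \<le> enat n"
      unfolding pd_def Inf_le_enat using projective_resolution_iso[OF P(1) T(1) assms(1) T(3) b(2)]
      by (intro bexI[of _ "enat n"]) blast+
  qed
qed

section \<open>Invariance of the projective dimension\<close>

lemma stable_retract_transport: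
  assumes "module R M" "module R F" "inj_on e (carrier M)"
  shows "stable_retract R M (transport_module e M) F" "stable_retract R (transport_module e M) M F"
proof -
  note T = transport_module[OF assms(1,3)]
  let ?T = "transport_module e M"
  interpret M: module R M by fact
  interpret T: module R ?T by (rule T(1))
  interpret F: module R F by fact
  have z: "(\<lambda>_. \<zero>\<^bsub>F\<^esub>) \<in> module_hom R M F" "(\<lambda>_. \<zero>\<^bsub>M\<^esub>) \<in> module_hom R F M"
    "(\<lambda>_. \<zero>\<^bsub>F\<^esub>) \<in> module_hom R ?T F" "(\<lambda>_. \<zero>\<^bsub>?T\<^esub>) \<in> module_hom R F ?T"
    by (auto simp: module_hom_def)
  show "stable_retract R M ?T F" unfolding stable_retract_def
    using z T(2,3) assms(3)
    by (intro exI[of _ e] exI[of _ "inv_into (carrier M) e"] exI[of _ "\<lambda>_. \<zero>\<^bsub>F\<^esub>"] exI[of _ "\<lambda>_. \<zero>\<^bsub>M\<^esub>"]) auto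
  show "stable_retract R ?T M F" unfolding stable_retract_def
    using z T(2,3) assms(3) module_hom_closed[OF T(2)]
    by (intro exI[of _ e] exI[of _ "inv_into (carrier M) e"] exI[of _ "\<lambda>_. \<zero>\<^bsub>F\<^esub>"] exI[of _ "\<lambda>_. \<zero>\<^bsub>?T\<^esub>"])
      (auto simp: T(4))
qed

lemma stable_retract_transport_both:
  assumes "stable_retract R M N F" "module R M" "module R N" "inj_on e (carrier M)" "inj_on f (carrier N)"
  shows "stable_retract R (transport_module e M) (transport_module f N) F"
proof -
  note T = transport_module[OF assms(2,4)] and T' = transport_module[OF assms(3,5)]
  obtain a b q p where abqp: "a \<in> module_hom R M N" "b \<in> module_hom R N M" "q \<in> module_hom R M F" "p \<in> module_hom R F M"
    "\<And>x. x \<in> carrier M \<Longrightarrow> x = b (a x) \<oplus>\<^bsub>M\<^esub> p (q x)"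
    using assms(1) by (auto simp: stable_retract_def)
  show ?thesis
    unfolding stable_retract_def
  proof (intro exI conjI ballI)
    fix x assume "x \<in> carrier (transport_module e M)"
    then obtain y where y: "y \<in> carrier M" "x = e y" by (auto simp: T(4))
    show "x = e (b (inv_into (carrier N) f (f (a (inv_into (carrier M) e x)))))
      \<oplus>\<^bsub>transport_module e M\<^esub> e (p (q (inv_into (carrier M) e x)))"
      using y abqp(5)[OF y(1)] module_hom_closed[OF abqp(1)] module_hom_closed[OF abqp(2)] module_hom_closed[OF abqp(3)] module_hom_closed[OF abqp(4)]
        assms(4,5)
      by (simp flip: module_hom_add[OF T(2)])
  qed (rule module_hom_comp[OF T(3) module_hom_comp[OF abqp(1) T'(2)]]
        module_hom_comp[OF T'(3) module_hom_comp[OF abqp(2) T(2)]]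
        module_hom_comp[OF T(3) abqp(3)] module_hom_comp[OF abqp(4) T(2)])+
qed

lemma list_embedding_exists: "\<exists>e :: 'm \<Rightarrow> ('r + 'm) list. inj e"
  by (rule exI[of _ "\<lambda>x. [Inr x]"]) (simp add: inj_on_def)

lemma inj_on_carrier: "inj e \<Longrightarrow> inj_on e (carrier M)"
  by (rule inj_on_subset) auto

text \<open>Isomorphisms, retracts and the kernels of different covers are all handled as instances
  of this comparison.\<close>

theorem pd_stable_retract:
  assumes "stable_retract R M M' F" "module R M" "module R M'" "projective R F"
  shows "pd R M \<le> pd R M'"
proof (cases "pd R M'")
  case (enat n)
  obtain e :: "'c \<Rightarrow> ('a + 'c) list" where e: "inj_on e (carrier M)" using list_embedding_exists inj_on_carrier by blast
  obtain e' :: "'e \<Rightarrow> ('a + 'e) list" where e': "inj_on e' (carrier M')" using list_embedding_exists inj_on_carrier by blast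
  have "pd_le R n (transport_module e M)"
    using pd_le_iff[OF assms(3) e', of n] enat
      pd_le_stable_retract[OF stable_retract_transport_both[OF assms(1-3) e e'] transport_module(1)[OF assms(2) e]
        transport_module(1)[OF assms(3) e'] assms(4)] by simp
  then show ?thesis using pd_le_iff[OF assms(2) e] enat by auto
qed simp

text \<open>For a module already in a list type, \<open>pd\<close> looks for resolutions in a type
  of lists over that list type. The transported copy and \<open>M\<close> are stable retracts of
  each other, so the nesting is harmless.\<close>

lemma pd_le_iff_self:
  fixes M :: "('r, ('r + 'z) list) module"
  assumes "module R M"
  shows "pd R M \<le> enat n \<longleftrightarrow> pd_le R n M"
proof -
  obtain e :: "('r + 'z) list \<Rightarrow> ('r + ('r + 'z) list) list" where e: "inj_on e (carrier M)"
    using list_embedding_exists inj_on_carrier by blast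
  let ?Z = "M\<lparr>carrier := {\<zero>\<^bsub>M\<^esub>}\<rparr>"
  have Z: "projective R ?Z" by (rule projective_zero_module) (auto intro: module_zero_sub assms)
  note s = stable_retract_transport[OF assms projective_module[OF Z] e] and T = transport_module(1)[OF assms e]
  show ?thesis
    unfolding pd_le_iff[OF assms e]
    using pd_le_stable_retract[OF s(1) assms T Z] pd_le_stable_retract[OF s(2) T assms Z] by blast
qed

lemma pd_retract:
  assumes "module R M" "module R N" "i \<in> module_hom R M N" "p \<in> module_hom R N M"
    and "\<And>x. x \<in> carrier M \<Longrightarrow> p (i x) = x"
  shows "pd R M \<le> pd R N"
proof -
  interpret M: module R M by fact
  let ?Z = "M\<lparr>carrier := {\<zero>\<^bsub>M\<^esub>}\<rparr>"
  have "(\<lambda>_. \<zero>\<^bsub>M\<^esub>) \<in> module_hom R M ?Z" "(\<lambda>x. x) \<in> module_hom R ?Z M" by (auto simp: module_hom_def)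
  then have "stable_retract R M N ?Z" unfolding stable_retract_def
    using assms(3-5) by (intro exI[of _ i] exI[of _ p] exI[of _ "\<lambda>_. \<zero>\<^bsub>M\<^esub>"] exI[of _ "\<lambda>x. x"]) simp
  then show ?thesis
    by (rule pd_stable_retract[OF _ assms(1,2) projective_zero_module]) (auto intro: module_zero_sub assms)
qed

lemma pd_iso:
  assumes "module R M" "module R N" "f \<in> module_hom R M N" "bij_betw f (carrier M) (carrier N)"
  shows "pd R M = pd R N"
proof -
  let ?i = "inv_into (carrier M) f"
  have s: "f ` carrier M = carrier N" and i: "inj_on f (carrier M)" using assms(4) by (auto simp: bij_betw_def)
  interpret M: module R M by fact
  have h: "?i \<in> module_hom R N M"
  proof (rule module_homI)
    fix x y assume "x \<in> carrier N" "y \<in> carrier N"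
    then obtain x' y' where "x' \<in> carrier M" "y' \<in> carrier M" "x = f x'" "y = f y'" using s by (metis (no_types, lifting) imageE)
    then show "?i (x \<oplus>\<^bsub>N\<^esub> y) = ?i x \<oplus>\<^bsub>M\<^esub> ?i y"
      using i by (simp flip: module_hom_add[OF assms(3)])
  next
    fix r x assume "r \<in> carrier R" "x \<in> carrier N"
    then obtain x' where "x' \<in> carrier M" "x = f x'" using s by (metis (no_types, lifting) imageE)
    then show "?i (r \<odot>\<^bsub>N\<^esub> x) = r \<odot>\<^bsub>M\<^esub> ?i x"
      using i \<open>r \<in> _\<close> by (simp flip: module_hom_smult[OF assms(3)])
  next
    show "?i x \<in> carrier M" if "x \<in> carrier N" for x using that s by (simp add: inv_into_into)
  qed
  show ?thesis
    using pd_retract[OF assms(1,2,3) h] pd_retract[OF assms(2,1) h assms(3)] i s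
    by (intro antisym) (auto simp: f_inv_into_f)
qed

lemma pd_eq_0_iff:
  assumes "module R M"
  shows "pd R M = 0 \<longleftrightarrow> projective R M"
proof -
  obtain e :: "'c \<Rightarrow> ('a + 'c) list" where e: "inj_on e (carrier M)" using list_embedding_exists inj_on_carrier by blast
  note T = transport_module[OF assms e]
  have "pd R M \<le> enat 0 \<longleftrightarrow> projective R (transport_module e M)"
    unfolding pd_le_iff[OF assms e] by simp
  moreover have "projective R (transport_module e M) \<longleftrightarrow> projective R M"
    using projective_transport[OF _ e] projective_retract[OF assms _ T(2,3)] e by auto
  ultimately show ?thesis by (simp flip: zero_enat_def)
qed

text \<open>Dimension shifting along an arbitrary projective cover, of any type: the kernels of the
  given cover and of one in the list type are stable retracts of each other.\<close>

theorem pd_ker: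
  assumes "module R M" "projective R G" "g \<in> module_hom R G M" "g ` carrier G = carrier M"
  shows "pd R M \<le> enat (Suc n) \<longleftrightarrow> pd R (ker_mod G M g) \<le> enat n"
proof -
  obtain e :: "'c \<Rightarrow> ('a + 'c) list" where e: "inj_on e (carrier M)" using list_embedding_exists inj_on_carrier by blast
  note T = transport_module[OF assms(1) e]
  let ?T = "transport_module e M"
  note G = projective_module[OF assms(2)]
  have K: "module R (ker_mod G M g)" by (rule module_ker_mod[OF G assms(1,3)])
  show ?thesis
  proof
    assume "pd R M \<le> enat (Suc n)"
    then obtain F :: "('a, ('a + 'c) list) module" and f where F: "projective R F" "f \<in> module_hom R F ?T" "f ` carrier F = carrier ?T"
      "pd_le R n (ker_mod F ?T f)" using pd_le_iff[OF assms(1) e] by auto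
    have KF: "module R (ker_mod F ?T f)" by (rule module_ker_mod[OF projective_module[OF F(1)] T(1) F(2)])
    have "stable_retract R (ker_mod G M g) (ker_mod F ?T f) G"
      by (rule stable_retract_ker[OF stable_retract_transport(1)[OF assms(1) G e] assms(1) T(1) assms(2) assms(2-4) F(1-3)])
    moreover have "pd R (ker_mod F ?T f) \<le> enat n" using pd_le_iff_self[OF KF] F(4) by simp
    ultimately show "pd R (ker_mod G M g) \<le> enat n"
      using pd_stable_retract[OF _ K KF assms(2)] order_trans by blast
  next
    assume K': "pd R (ker_mod G M g) \<le> enat n"
    obtain F :: "('a, ('a + 'c) list) module" and f where F: "projective R F" "f \<in> module_hom R F ?T" "f ` carrier F = carrier ?T"
      using projective_cover_exists[OF T(1)] by blast
    have KF: "module R (ker_mod F ?T f)" by (rule module_ker_mod[OF projective_module[OF F(1)] T(1) F(2)])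
    have "stable_retract R (ker_mod F ?T f) (ker_mod G M g) F"
      by (rule stable_retract_ker[OF stable_retract_transport(2)[OF assms(1) projective_module[OF F(1)] e] T(1) assms(1) F(1) F(1-3) assms(2-4)])
    from pd_stable_retract[OF this KF K F(1)] K' have "pd R (ker_mod F ?T f) \<le> enat n" by (rule order_trans)
    then have "pd_le R n (ker_mod F ?T f)" using pd_le_iff_self[OF KF] by simp
    then show "pd R M \<le> enat (Suc n)" using pd_le_iff[OF assms(1) e] F by auto
  qed
qed

section \<open>Projective dimensions in short exact sequences\<close>

text \<open>The sequence splits. The map \<open>h\<close> projects \<open>M\<close> to the kernel
  along the image of \<open>s\<close>, and the two components of an element are lifted along
  \<open>p\<close> separately.\<close>

lemma projective_extension:
  assumes "module R M" "module R N" "g \<in> module_hom R M N" "g ` carrier M = carrier N"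
    and "projective R (ker_mod M N g)" "projective R N"
  shows "projective R M"
proof (rule projectiveI_section[OF assms(1)])
  fix X :: "('a, 'c \<Rightarrow> 'a) module" and p
  assume X: "module R X" "p \<in> module_hom R X M" "p ` carrier X = carrier M"
  interpret M: module R M by fact
  interpret N: module R N by fact
  interpret X: module R X by fact
  obtain s where s: "s \<in> module_hom R N M" "\<And>y. y \<in> carrier N \<Longrightarrow> g (s y) = y"
    using projective_lift[OF assms(6,1,2,3,4) module_hom_id] by blast
  obtain s' where s': "s' \<in> module_hom R N X" "\<And>y. y \<in> carrier N \<Longrightarrow> p (s' y) = s y"
    using projective_lift[OF assms(6) X(1) assms(1) X(2,3) s(1)] by blast
  have inc: "(\<lambda>x. x) \<in> module_hom R (ker_mod M N g) M" by (auto simp: module_hom_def)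
  obtain j where j: "j \<in> module_hom R (ker_mod M N g) X" "\<And>y. y \<in> carrier M \<Longrightarrow> g y = \<zero>\<^bsub>N\<^esub> \<Longrightarrow> p (j y) = y"
    using projective_lift[OF assms(5) X(1) assms(1) X(2,3) inc] by auto
  note cl = module_hom_closed[OF assms(3)] module_hom_closed[OF s(1)] module_hom_closed[OF s'(1)]
  define h where "h x = x \<ominus>\<^bsub>M\<^esub> s (g x)" for x
  have h0: "g (h x) = \<zero>\<^bsub>N\<^esub>" if "x \<in> carrier M" for x
    using that N.minus_eq_zero_iff[of "g x" "g x"]
    by (simp add: h_def module_hom_minus[OF assms(1-3)] cl s(2))
  have "h \<in> module_hom R M M" unfolding h_def
    by (rule module_hom_diff[OF assms(1,1) module_hom_id module_hom_comp[OF assms(3) s(1)]])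
  then have h: "h \<in> module_hom R M (ker_mod M N g)" using h0 by (auto simp: module_hom_def)
  have "p (s' (g x) \<oplus>\<^bsub>X\<^esub> j (h x)) = x" if "x \<in> carrier M" for x
  proof -
    have "h x \<in> carrier M" "j (h x) \<in> carrier X"
      using that module_hom_closed[OF h] module_hom_closed[OF j(1)] by auto
    then have "p (s' (g x) \<oplus>\<^bsub>X\<^esub> j (h x)) = s (g x) \<oplus>\<^bsub>M\<^esub> h x"
      using that by (simp add: module_hom_add[OF X(2)] cl s'(2) j(2) h0)
    also have "\<dots> = x" using that by (simp add: h_def a_minus_def cl M.a_lcomm M.r_neg)
    finally show ?thesis .
  qed
  then show "\<exists>t\<in>module_hom R M X. \<forall>x\<in>carrier M. p (t x) = x"
    by (intro bexI[OF _ module_hom_sum[OF X(1) module_hom_comp[OF assms(3) s'(1)] module_hom_comp[OF h j(1)]]]) simp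
qed

text \<open>A projective cover \<open>c\<close> of \<open>M\<close> turns \<open>0 \<rightarrow> ker g \<rightarrow> M \<rightarrow> N \<rightarrow> 0\<close> into
  \<open>0 \<rightarrow> ker c \<rightarrow> ker (g c) \<rightarrow> ker g \<rightarrow> 0\<close>; this rotation links the three estimates.\<close>

lemma rotate_ses:
  assumes "module R M" "module R N" "g \<in> module_hom R M N" "g ` carrier M = carrier N"
    and "projective R G" "c \<in> module_hom R G M" "c ` carrier G = carrier M"
  shows "module R (ker_mod G N (\<lambda>x. g (c x)))"
    and "c \<in> module_hom R (ker_mod G N (\<lambda>x. g (c x))) (ker_mod M N g)"
    and "c ` carrier (ker_mod G N (\<lambda>x. g (c x))) = carrier (ker_mod M N g)"
    and "ker_mod (ker_mod G N (\<lambda>x. g (c x))) (ker_mod M N g) c = ker_mod G M c"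
    and "pd R N \<le> enat (Suc n) \<longleftrightarrow> pd R (ker_mod G N (\<lambda>x. g (c x))) \<le> enat n"
    and "pd R M \<le> enat (Suc n) \<longleftrightarrow> pd R (ker_mod G M c) \<le> enat n"
proof -
  note gc = module_hom_comp[OF assms(6,3)]
  show "module R (ker_mod G N (\<lambda>x. g (c x)))"
    by (rule module_ker_mod[OF projective_module[OF assms(5)] assms(2) gc])
  show "c \<in> module_hom R (ker_mod G N (\<lambda>x. g (c x))) (ker_mod M N g)"
    using assms(6) by (auto simp: module_hom_def)
  show "c ` carrier (ker_mod G N (\<lambda>x. g (c x))) = carrier (ker_mod M N g)"
    using assms(7) by auto
  have "c \<zero>\<^bsub>G\<^esub> = \<zero>\<^bsub>M\<^esub>" "g \<zero>\<^bsub>M\<^esub> = \<zero>\<^bsub>N\<^esub>"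
    using module_hom_zero[OF projective_module[OF assms(5)] assms(1,6)] module_hom_zero[OF assms(1-3)] by auto
  then show "ker_mod (ker_mod G N (\<lambda>x. g (c x))) (ker_mod M N g) c = ker_mod G M c"
    by (auto simp: ker_mod_def intro!: arg_cong[where f = "\<lambda>Z. G\<lparr>carrier := Z\<rparr>"])
  have "(\<lambda>x. g (c x)) ` carrier G = carrier N"
    using assms(4,7) by (simp flip: image_image)
  then show "pd R N \<le> enat (Suc n) \<longleftrightarrow> pd R (ker_mod G N (\<lambda>x. g (c x))) \<le> enat n"
    by (rule pd_ker[OF assms(2,5) gc])
  show "pd R M \<le> enat (Suc n) \<longleftrightarrow> pd R (ker_mod G M c) \<le> enat n"
    by (rule pd_ker[OF assms(1,5-7)])
qed

text \<open>Three estimates share one strong induction, each linked to the next by a rotation: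
  \<open>quot\<close> at a level below \<open>n\<close> uses the induction hypothesis there,
  \<open>ker\<close> uses \<open>quot\<close> one level lower, and the claim at \<open>n\<close>
  uses \<open>ker\<close> at n - 1. Both modules have the same list type, so that covers and kernels
  stay within reach of the induction hypothesis.\<close>

lemma pd_extension_aux:
  fixes M N :: "('r, ('r + 'z) list) module"
  assumes "module R M" "module R N" "g \<in> module_hom R M N" "g ` carrier M = carrier N"
    and "pd R (ker_mod M N g) \<le> enat n" "pd R N \<le> enat n"
  shows "pd R M \<le> enat n"
  using assms
proof (induction n arbitrary: M N g rule: less_induct)
  case (less n)
  have quot: "pd R N' \<le> enat (Suc a)"
    if A: "a < n" "module R M'" "module R N'" "g' \<in> module_hom R M' N'" "g' ` carrier M' = carrier N'"
      "pd R M' \<le> enat (Suc a)" "pd R (ker_mod M' N' g') \<le> enat a"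
    for a and M' N' :: "('r, ('r + 'z) list) module" and g'
  proof -
    obtain G :: "('r, ('r + 'z) list) module" and c where G: "projective R G" "c \<in> module_hom R G M'" "c ` carrier G = carrier M'"
      using projective_cover_exists[OF A(2)] by blast
    note r = rotate_ses[OF A(2-5) G]
    have "pd R (ker_mod G N' (\<lambda>x. g' (c x))) \<le> enat a"
      by (rule less.IH[OF A(1) r(1) module_ker_mod[OF A(2-4)] r(2,3)])
        (use r(4) r(6) A(6,7) in auto)
    then show ?thesis using r(5) by simp
  qed
  have ker: "pd R (ker_mod M' N' g') \<le> enat a"
    if A: "a < n" "module R M'" "module R N'" "g' \<in> module_hom R M' N'" "g' ` carrier M' = carrier N'"
      "pd R M' \<le> enat a" "pd R N' \<le> enat (Suc a)"
    for a and M' N' :: "('r, ('r + 'z) list) module" and g'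
  proof (cases a)
    case 0
    then have "projective R M'" using A(2,6) by (simp add: pd_eq_0_iff flip: zero_enat_def)
    then show ?thesis using pd_ker[OF A(3) _ A(4,5)] A(7) by simp
  next
    case (Suc b)
    obtain G :: "('r, ('r + 'z) list) module" and c where G: "projective R G" "c \<in> module_hom R G M'" "c ` carrier G = carrier M'"
      using projective_cover_exists[OF A(2)] by blast
    note r = rotate_ses[OF A(2-5) G]
    show ?thesis unfolding Suc
      by (rule quot[OF _ r(1) module_ker_mod[OF A(2-4)] r(2,3)])
        (use r(4) r(5)[of a] r(6)[of b] A(1,6,7) Suc in auto)
  qed
  show ?case
  proof (cases n)
    case 0
    have "projective R (ker_mod M N g)" "projective R N"
      using less.prems 0 module_ker_mod[OF less.prems(1-3)] by (simp_all add: pd_eq_0_iff flip: zero_enat_def)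
    then show ?thesis
      using projective_extension[OF less.prems(1-4)] less.prems(1) 0 by (simp add: pd_eq_0_iff flip: zero_enat_def)
  next
    case (Suc m)
    obtain G :: "('r, ('r + 'z) list) module" and c where G: "projective R G" "c \<in> module_hom R G M" "c ` carrier G = carrier M"
      using projective_cover_exists[OF less.prems(1)] by blast
    note r = rotate_ses[OF less.prems(1-4) G]
    have "pd R (ker_mod G M c) \<le> enat m"
      unfolding r(4)[symmetric]
      by (rule ker[OF _ r(1) module_ker_mod[OF less.prems(1-3)] r(2,3)])
        (use r(5)[of m] less.prems(5,6) Suc in auto)
    then show ?thesis using r(6)[of m] Suc by simp
  qed
qed

theorem pd_extension:
  assumes "module R M" "module R N" "g \<in> module_hom R M N" "g ` carrier M = carrier N"
    and "pd R (ker_mod M N g) \<le> enat n" "pd R N \<le> enat n"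
  shows "pd R M \<le> enat n"
proof -
  \<comment> \<open>Different tags place both modules in one list type over the sum of their element
    types.\<close>
  define e :: "'c \<Rightarrow> ('a + ('c + 'e)) list" where "e x = [Inr (Inl x)]" for x
  define f :: "'e \<Rightarrow> ('a + ('c + 'e)) list" where "f x = [Inr (Inr x)]" for x
  have e: "inj_on e A" and f: "inj_on f B" for A B by (auto simp: e_def f_def inj_on_def)
  note M = transport_module[OF assms(1) e] and N = transport_module[OF assms(2) f]
  let ?M = "transport_module e M" and ?N = "transport_module f N"
  let ?g = "\<lambda>x. f (g (inv_into (carrier M) e x))"
  have g: "?g \<in> module_hom R ?M ?N" by (rule module_hom_comp[OF module_hom_comp[OF M(3) assms(3)] N(2)])
  have b: "bij_betw e (carrier M) (carrier ?M)" "bij_betw f (carrier N) (carrier ?N)"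
    using e f by (auto simp: bij_betw_def M(4) N(4))
  note K = module_ker_mod[OF assms(1-3)] and K' = module_ker_mod[OF M(1) N(1) g]
  have g_surj: "?g ` carrier ?M = carrier ?N"
    using assms(4) e by (simp add: M(4) N(4) image_image flip: assms(4))
  have "bij_betw e (carrier (ker_mod M N g)) (carrier (ker_mod ?M ?N ?g))"
    using e abelian_monoid.zero_closed[of N] assms(2) module_hom_closed[OF assms(3)]
    by (auto simp: bij_betw_def M(4) N(5) inj_on_eq_iff[OF f[of UNIV]])
  moreover from this have "e \<in> module_hom R (ker_mod M N g) (ker_mod ?M ?N ?g)"
    using M(2) unfolding bij_betw_def by (auto simp: module_hom_def)
  ultimately have "pd R (ker_mod ?M ?N ?g) \<le> enat n"
    using pd_iso[OF K K', of e] assms(5) by simp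
  moreover have "pd R ?N \<le> enat n" using pd_iso[OF assms(2) N(1,2) b(2)] assms(6) by simp
  ultimately have "pd R ?M \<le> enat n" by (intro pd_extension_aux[OF M(1) N(1) g g_surj])
  then show ?thesis using pd_iso[OF assms(1) M(1,2) b(1)] by simp
qed

lemma projective_free_cover:
  assumes "module R M"
  obtains c where "c \<in> module_hom R (free_module R (carrier M)) M" "c ` carrier (free_module R (carrier M)) = carrier M"
    "projective R (free_module R (carrier M))"
  using free_module_cover[OF assms] projective_free_module[OF module_cring[OF assms]] by blast

text \<open>After one rotation the claim is an extension estimate: the kernel of the composite cover
  is an extension of the kernel of \<open>g\<close> by the kernel of \<open>c\<close>.\<close>

theorem pd_quotient:
  assumes "module R M" "module R N" "g \<in> module_hom R M N" "g ` carrier M = carrier N"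
    and "pd R M \<le> enat (Suc a)" "pd R (ker_mod M N g) \<le> enat a"
  shows "pd R N \<le> enat (Suc a)"
proof -
  obtain c where c: "c \<in> module_hom R (free_module R (carrier M)) M" "c ` carrier (free_module R (carrier M)) = carrier M"
    "projective R (free_module R (carrier M))" by (rule projective_free_cover[OF assms(1)])
  note r = rotate_ses[OF assms(1-4) c(3,1,2)]
  have "pd R (ker_mod (free_module R (carrier M)) N (\<lambda>x. g (c x))) \<le> enat a"
    by (rule pd_extension[OF r(1) module_ker_mod[OF assms(1-3)] r(2,3)]) (use r(4,6) assms(5,6) in auto)
  then show ?thesis using r(5) by simp
qed

text \<open>For \<open>a = 0\<close> this is dimension shifting with \<open>M\<close> as the cover;
  otherwise one rotation leads to the quotient estimate.\<close>

theorem pd_kernel: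
  assumes "module R M" "module R N" "g \<in> module_hom R M N" "g ` carrier M = carrier N"
    and "pd R M \<le> enat a" "pd R N \<le> enat (Suc a)"
  shows "pd R (ker_mod M N g) \<le> enat a"
proof (cases a)
  case 0
  then have "projective R M" using assms(1,5) by (simp add: pd_eq_0_iff flip: zero_enat_def)
  then show ?thesis using pd_ker[OF assms(2) _ assms(3,4)] assms(6) by simp
next
  case (Suc b)
  obtain c where c: "c \<in> module_hom R (free_module R (carrier M)) M" "c ` carrier (free_module R (carrier M)) = carrier M"
    "projective R (free_module R (carrier M))" by (rule projective_free_cover[OF assms(1)])
  note r = rotate_ses[OF assms(1-4) c(3,1,2)]
  show ?thesis unfolding Suc
    by (rule pd_quotient[OF r(1) module_ker_mod[OF assms(1-3)] r(2,3)])
      (use r(4) r(5)[of a] r(6)[of b] assms(5,6) Suc in auto)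
qed

section \<open>Change of rings\<close>

definition restrict_scalars :: "('r \<Rightarrow> 's) \<Rightarrow> ('s, 'm, 'd) module_scheme \<Rightarrow> ('r, 'm) module"
  where "restrict_scalars h M = \<lparr>carrier = carrier M, mult = undefined, one = undefined, zero = zero M, add = add M,
    smult = (\<lambda>r x. h r \<odot>\<^bsub>M\<^esub> x)\<rparr>"

lemma restrict_scalars_simps [simp]:
  "carrier (restrict_scalars h M) = carrier M" "zero (restrict_scalars h M) = zero M"
  "add (restrict_scalars h M) = add M" "smult (restrict_scalars h M) r x = h r \<odot>\<^bsub>M\<^esub> x"
  by (simp_all add: restrict_scalars_def)

lemma abelian_group_cong:
  assumes "abelian_group M" "carrier N = carrier M" "zero N = zero M" "add N = add M"
  shows "abelian_group N"
proof -
  interpret M: abelian_group M by fact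
  show ?thesis
    by (rule abelian_groupI) (auto simp: assms M.a_ac intro: exI[of _ "\<ominus>\<^bsub>M\<^esub> _"] M.l_neg M.a_inv_closed)
qed

lemma module_restrict_scalars:
  assumes "module S M" "cring R" "h \<in> ring_hom R S"
  shows "module R (restrict_scalars h M)"
proof -
  interpret M: module S M by fact
  show ?thesis
  proof (rule moduleI[OF assms(2)])
    show "abelian_group (restrict_scalars h M)"
      by (rule abelian_group_cong[OF M.abelian_group_axioms]) simp_all
  qed (use ring_hom_closed[OF assms(3)] ring_hom_add[OF assms(3)] ring_hom_mult[OF assms(3)] ring_hom_one[OF assms(3)]
      in \<open>auto simp: M.smult_l_distr M.smult_r_distr M.smult_assoc1\<close>)
qed

lemma module_hom_restrict_scalars:
  assumes "h \<in> ring_hom R S" "f \<in> module_hom S M N"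
  shows "f \<in> module_hom R (restrict_scalars h M) (restrict_scalars h N)"
  using assms(2) ring_hom_closed[OF assms(1)] by (auto simp: module_hom_def)

lemma module_hom_restrict_scalars_surj:
  assumes "h ` carrier R = carrier S" "f \<in> module_hom R (restrict_scalars h M) (restrict_scalars h N)"
  shows "f \<in> module_hom S M N"
  using assms(2) unfolding module_hom_def assms(1)[symmetric] by auto

lemma ker_mod_restrict_scalars:
  "ker_mod (restrict_scalars h M) (restrict_scalars h N) f = restrict_scalars h (ker_mod M N f)"
  by (simp add: ker_mod_def restrict_scalars_def)

text \<open>\<open>S\<close> is R/\<alpha>R for a regular element \<alpha>, and \<delta> is a
  derivation from R to S. The descent of projective dimension from R to S rests on \<delta> \<alpha>
  = 1: for R = K[x] and \<alpha> = x^2, the residue field K has projective dimension 1 over R but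
  infinite projective dimension over S.\<close>

locale hypersurface_quotient =
  fixes R :: "('r, 'c) ring_scheme" and S :: "('s, 'd) ring_scheme" and h :: "'r \<Rightarrow> 's" and \<alpha> :: 'r
    and \<delta> :: "'r \<Rightarrow> 's"
  assumes R: "cring R" and S: "cring S" and h: "h \<in> ring_hom R S" and h_surj: "h ` carrier R = carrier S"
    and \<alpha>: "\<alpha> \<in> carrier R" and h_\<alpha>: "h \<alpha> = \<zero>\<^bsub>S\<^esub>"
    and h_ker: "\<And>r. r \<in> carrier R \<Longrightarrow> h r = \<zero>\<^bsub>S\<^esub> \<Longrightarrow> \<exists>q\<in>carrier R. r = \<alpha> \<otimes>\<^bsub>R\<^esub> q"
    and regular: "\<And>r. r \<in> carrier R \<Longrightarrow> \<alpha> \<otimes>\<^bsub>R\<^esub> r = \<zero>\<^bsub>R\<^esub> \<Longrightarrow> r = \<zero>\<^bsub>R\<^esub>"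
    and \<delta>_closed: "\<And>r. r \<in> carrier R \<Longrightarrow> \<delta> r \<in> carrier S"
    and \<delta>_add: "\<And>r s. r \<in> carrier R \<Longrightarrow> s \<in> carrier R \<Longrightarrow> \<delta> (r \<oplus>\<^bsub>R\<^esub> s) = \<delta> r \<oplus>\<^bsub>S\<^esub> \<delta> s"
    and \<delta>_mult: "\<And>r s. r \<in> carrier R \<Longrightarrow> s \<in> carrier R \<Longrightarrow>
      \<delta> (r \<otimes>\<^bsub>R\<^esub> s) = h r \<otimes>\<^bsub>S\<^esub> \<delta> s \<oplus>\<^bsub>S\<^esub> h s \<otimes>\<^bsub>S\<^esub> \<delta> r"
    and \<delta>_\<alpha>: "\<delta> \<alpha> = \<one>\<^bsub>S\<^esub>"
begin

sublocale R: cring R by (rule R)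
sublocale S: cring S by (rule S)

lemma h_closed: "r \<in> carrier R \<Longrightarrow> h r \<in> carrier S"
  and h_add: "r \<in> carrier R \<Longrightarrow> s \<in> carrier R \<Longrightarrow> h (r \<oplus>\<^bsub>R\<^esub> s) = h r \<oplus>\<^bsub>S\<^esub> h s"
  and h_mult: "r \<in> carrier R \<Longrightarrow> s \<in> carrier R \<Longrightarrow> h (r \<otimes>\<^bsub>R\<^esub> s) = h r \<otimes>\<^bsub>S\<^esub> h s"
  and h_one: "h \<one>\<^bsub>R\<^esub> = \<one>\<^bsub>S\<^esub>"
  using h by (auto simp: ring_hom_def)

lemma h_zero: "h \<zero>\<^bsub>R\<^esub> = \<zero>\<^bsub>S\<^esub>"
  using ring_hom_zero[OF h R.ring_axioms S.ring_axioms] .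

lemma module_restrict: "module S M \<Longrightarrow> module R (restrict_scalars h M)"
  by (rule module_restrict_scalars[OF _ R h])

definition reduce :: "'b set \<Rightarrow> ('b \<Rightarrow> 'r) \<Rightarrow> 'b \<Rightarrow> 's"
  where "reduce B c = (\<lambda>b\<in>B. h (c b))"

lemma reduce_hom: "reduce B \<in> module_hom R (free_module R B) (restrict_scalars h (free_module S B))"
proof (rule module_homI)
  fix c assume c: "c \<in> carrier (free_module R B)"
  have "finite {b \<in> B. h (c b) \<noteq> \<zero>\<^bsub>S\<^esub>}"
    by (rule finite_subset[of _ "{b \<in> B. c b \<noteq> \<zero>\<^bsub>R\<^esub>}"]) (use c in \<open>auto simp: free_module_simps h_zero\<close>)
  then show "reduce B c \<in> carrier (restrict_scalars h (free_module S B))"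
    using c by (auto simp: free_module_simps reduce_def h_closed PiE_iff cong: conj_cong)
qed (auto simp: free_module_simps reduce_def h_add h_mult PiE_iff fun_eq_iff)

lemma reduce_surj: "reduce B ` carrier (free_module R B) = carrier (restrict_scalars h (free_module S B))"
proof (intro equalityI subsetI)
  fix d assume d: "d \<in> carrier (restrict_scalars h (free_module S B))"
  \<comment> \<open>Zero must lift to zero, otherwise the lifted coefficients need not have finite
    support.\<close>
  have "\<forall>s\<in>carrier S. \<exists>r\<in>carrier R. h r = s \<and> (s = \<zero>\<^bsub>S\<^esub> \<longrightarrow> r = \<zero>\<^bsub>R\<^esub>)"
    using h_zero h_surj by (metis (no_types, lifting) R.zero_closed imageE)
  then obtain l where l: "\<And>s. s \<in> carrier S \<Longrightarrow> l s \<in> carrier R" "\<And>s. s \<in> carrier S \<Longrightarrow> h (l s) = s" "l \<zero>\<^bsub>S\<^esub> = \<zero>\<^bsub>R\<^esub>"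
    using S.zero_closed by metis
  have "finite {b \<in> B. l (d b) \<noteq> \<zero>\<^bsub>R\<^esub>}"
    by (rule finite_subset[of _ "{b \<in> B. d b \<noteq> \<zero>\<^bsub>S\<^esub>}"]) (use d l in \<open>auto simp: free_module_simps\<close>)
  then have "(\<lambda>b\<in>B. l (d b)) \<in> carrier (free_module R B)"
    using d l by (auto simp: free_module_simps cong: conj_cong)
  moreover have "d = reduce B (\<lambda>b\<in>B. l (d b))"
    using d l by (auto simp: free_module_simps reduce_def fun_eq_iff PiE_iff extensional_def)
  ultimately show "d \<in> reduce B ` carrier (free_module R B)" by blast
qed (use module_hom_closed[OF reduce_hom] in auto)

lemma reduce_smult_\<alpha>:
  assumes "c \<in> carrier (free_module R B)"
  shows "reduce B (\<alpha> \<odot>\<^bsub>free_module R B\<^esub> c) = \<zero>\<^bsub>free_module S B\<^esub>"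
  using assms by (auto simp: reduce_def free_module_simps h_mult \<alpha> h_\<alpha> PiE_iff h_closed fun_eq_iff)

text \<open>Since \<alpha> is regular, the kernel of coefficientwise reduction of the free module F
  is \<alpha> F, a copy of F; this is a resolution of length 1.\<close>

lemma pd_restrict_free: "pd R (restrict_scalars h (free_module S B)) \<le> enat (Suc 0)"
proof -
  let ?F = "free_module R B" and ?E = "restrict_scalars h (free_module S B)"
  interpret F: module R ?F by (rule module_free_module[OF R])
  have E: "module R ?E" by (rule module_restrict[OF module_free_module[OF S]])
  let ?K = "ker_mod ?F ?E (reduce B)"
  have K: "module R ?K" by (rule module_ker_mod[OF F.module_axioms E reduce_hom])
  let ?m = "\<lambda>c. \<alpha> \<odot>\<^bsub>?F\<^esub> c"
  have "?m \<in> module_hom R ?F ?K"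
    by (rule module_homI)
      (auto simp: \<alpha> reduce_smult_\<alpha> F.smult_r_distr R.m_comm simp flip: F.smult_assoc1)
  moreover have "bij_betw ?m (carrier ?F) (carrier ?K)"
  proof (rule bij_betw_imageI)
    show "inj_on ?m (carrier ?F)"
    proof (rule inj_onI)
      fix c d assume c: "c \<in> carrier ?F" and d: "d \<in> carrier ?F" and "?m c = ?m d"
      then have "\<alpha> \<odot>\<^bsub>?F\<^esub> (c \<ominus>\<^bsub>?F\<^esub> d) = \<zero>\<^bsub>?F\<^esub>"
        using \<alpha> F.minus_eq_zero_iff[of "?m c" "?m d"]
        by (simp add: a_minus_def F.smult_r_distr F.smult_r_minus)
      moreover have cl: "c \<ominus>\<^bsub>?F\<^esub> d \<in> carrier ?F" using c d by simp
      ultimately have "(\<alpha> \<odot>\<^bsub>?F\<^esub> (c \<ominus>\<^bsub>?F\<^esub> d)) b = \<zero>\<^bsub>?F\<^esub> b" for b by simp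
      then have "\<alpha> \<otimes>\<^bsub>R\<^esub> (c \<ominus>\<^bsub>?F\<^esub> d) b = \<zero>\<^bsub>R\<^esub>" if "b \<in> B" for b
        using that unfolding free_module_simps(2,4) by (metis restrict_apply')
      moreover have "(c \<ominus>\<^bsub>?F\<^esub> d) b \<in> carrier R" if "b \<in> B" for b
        using that cl unfolding free_module_simps(1) by (blast dest: PiE_mem)
      ultimately have "(c \<ominus>\<^bsub>?F\<^esub> d) b = \<zero>\<^bsub>R\<^esub>" if "b \<in> B" for b
        using that regular by blast
      then have "c \<ominus>\<^bsub>?F\<^esub> d = \<zero>\<^bsub>?F\<^esub>"
        using cl by (auto simp: free_module_simps fun_eq_iff PiE_iff extensional_def)
      then show "c = d" using c d by (simp add: F.minus_eq_zero_iff)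
    qed
    show "?m ` carrier ?F = carrier ?K"
    proof (intro equalityI subsetI)
      fix c assume c: "c \<in> carrier ?K"
      have "\<forall>b\<in>B. \<exists>q\<in>carrier R. c b = \<alpha> \<otimes>\<^bsub>R\<^esub> q"
      proof
        fix b assume b: "b \<in> B"
        have "reduce B c b = \<zero>\<^bsub>?E\<^esub> b" using c by simp
        then have "h (c b) = \<zero>\<^bsub>S\<^esub>" using b by (simp add: reduce_def free_module_simps(2))
        then show "\<exists>q\<in>carrier R. c b = \<alpha> \<otimes>\<^bsub>R\<^esub> q"
          using c b by (intro h_ker) (auto simp: free_module_simps)
      qed
      then obtain q where q: "\<And>b. b \<in> B \<Longrightarrow> q b \<in> carrier R" "\<And>b. b \<in> B \<Longrightarrow> c b = \<alpha> \<otimes>\<^bsub>R\<^esub> q b" by metis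
      have "finite {b \<in> B. q b \<noteq> \<zero>\<^bsub>R\<^esub>}"
        by (rule finite_subset[of _ "{b \<in> B. c b \<noteq> \<zero>\<^bsub>R\<^esub>}"])
          (use c q regular in \<open>auto simp: free_module_simps\<close>)
      then have "(\<lambda>b\<in>B. q b) \<in> carrier ?F"
        using q by (auto simp: free_module_simps cong: conj_cong)
      moreover have "c = ?m (\<lambda>b\<in>B. q b)"
        using c q by (auto simp: free_module_simps fun_eq_iff PiE_iff extensional_def)
      ultimately show "c \<in> ?m ` carrier ?F" by blast
    qed (auto simp: \<alpha> reduce_smult_\<alpha>)
  qed
  ultimately have "pd R ?K = pd R ?F" using pd_iso[OF F.module_axioms K] by simp
  also have "\<dots> = 0" using pd_eq_0_iff[OF F.module_axioms] projective_free_module[OF R] by simp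
  finally show ?thesis
    using pd_ker[OF E projective_free_module[OF R] reduce_hom reduce_surj] by simp
qed

lemma pd_restrict_projective:
  fixes N :: "('s, 'n, 'e) module_scheme"
  assumes "projective S N"
  shows "pd R (restrict_scalars h N) \<le> enat (Suc 0)"
proof -
  obtain B :: "'n set" and i p where ip: "i \<in> module_hom S N (free_module S B)" "p \<in> module_hom S (free_module S B) N"
    "\<forall>x\<in>carrier N. p (i x) = x"
    using assms by (auto simp: projective_def)
  have "pd R (restrict_scalars h N) \<le> pd R (restrict_scalars h (free_module S B))"
    using ip by (intro pd_retract[OF _ _ module_hom_restrict_scalars[OF h ip(1)] module_hom_restrict_scalars[OF h ip(2)]]
        module_restrict projective_module[OF assms] module_free_module[OF S]) auto
  then show ?thesis using pd_restrict_free order_trans by blast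
qed

lemma pd_restrict_le_aux:
  fixes N :: "('s, ('s + 'z) list) module"
  assumes "module S N" "pd S N \<le> enat m"
  shows "pd R (restrict_scalars h N) \<le> enat (Suc m)"
  using assms
proof (induction m arbitrary: N)
  case 0
  then have "projective S N" by (simp add: pd_eq_0_iff flip: zero_enat_def)
  then show ?case by (rule pd_restrict_projective)
next
  case (Suc m)
  obtain G :: "('s, ('s + 'z) list) module" and g where G: "projective S G" "g \<in> module_hom S G N" "g ` carrier G = carrier N"
    using projective_cover_exists[OF Suc.prems(1)] by blast
  have K: "module S (ker_mod G N g)" "pd S (ker_mod G N g) \<le> enat m"
    using module_ker_mod[OF projective_module[OF G(1)] Suc.prems(1) G(2)] pd_ker[OF Suc.prems(1) G] Suc.prems(2) by auto
  have "pd R (restrict_scalars h G) \<le> enat (Suc (Suc m))"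
    using pd_restrict_projective[OF G(1)] by (rule order_trans) simp
  then show ?case
    using Suc.IH[OF K] G(3)
    by (intro pd_quotient[OF _ _ module_hom_restrict_scalars[OF h G(2)]])
      (auto simp: ker_mod_restrict_scalars intro: module_restrict projective_module G Suc.prems)
qed

text \<open>The action of \<open>R\<close> on \<open>N \<oplus> N \<epsilon>\<close>, \<open>\<epsilon>\<^sup>2 = 0\<close>, through the ring homomorphism \<open>h + \<delta> \<epsilon>\<close>.\<close>

definition dual_module :: "('s, 'n, 'e) module_scheme \<Rightarrow> ('r, 'n \<times> 'n) module"
  where "dual_module N = \<lparr>carrier = carrier N \<times> carrier N, mult = undefined, one = undefined,
    zero = (\<zero>\<^bsub>N\<^esub>, \<zero>\<^bsub>N\<^esub>), add = (\<lambda>x y. (fst x \<oplus>\<^bsub>N\<^esub> fst y, snd x \<oplus>\<^bsub>N\<^esub> snd y)),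
    smult = (\<lambda>r x. (h r \<odot>\<^bsub>N\<^esub> fst x, h r \<odot>\<^bsub>N\<^esub> snd x \<oplus>\<^bsub>N\<^esub> \<delta> r \<odot>\<^bsub>N\<^esub> fst x))\<rparr>"

lemma module_dual_module:
  assumes "module S N"
  shows "module R (dual_module N)"
proof -
  interpret N: module S N by fact
  have \<delta>1: "\<delta> \<one>\<^bsub>R\<^esub> = \<zero>\<^bsub>S\<^esub>"
  proof -
    have "\<delta> \<one>\<^bsub>R\<^esub> = \<delta> \<one>\<^bsub>R\<^esub> \<oplus>\<^bsub>S\<^esub> \<delta> \<one>\<^bsub>R\<^esub>"
      using \<delta>_mult[OF R.one_closed R.one_closed] \<delta>_closed[OF R.one_closed] by (simp add: h_one)
    then show ?thesis using \<delta>_closed[OF R.one_closed] by (metis S.add.r_cancel_one')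
  qed
  have "abelian_group (dual_module N)"
  proof (rule abelian_groupI)
    fix x assume "x \<in> carrier (dual_module N)"
    then show "\<exists>y\<in>carrier (dual_module N). y \<oplus>\<^bsub>dual_module N\<^esub> x = \<zero>\<^bsub>dual_module N\<^esub>"
      by (intro bexI[of _ "(\<ominus>\<^bsub>N\<^esub> fst x, \<ominus>\<^bsub>N\<^esub> snd x)"]) (auto simp: dual_module_def N.l_neg)
  qed (auto simp: dual_module_def N.a_ac)
  moreover have "\<delta> b \<odot>\<^bsub>N\<^esub> (h a \<odot>\<^bsub>N\<^esub> x) = h a \<odot>\<^bsub>N\<^esub> (\<delta> b \<odot>\<^bsub>N\<^esub> x)"
    if "a \<in> carrier R" "b \<in> carrier R" "x \<in> carrier N" for a b x
    using that by (simp add: h_closed \<delta>_closed S.m_comm flip: N.smult_assoc1)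
  ultimately show ?thesis
    by (intro moduleI[OF R])
      (auto simp: dual_module_def h_closed \<delta>_closed h_add h_mult h_one \<delta>_add \<delta>_mult \<delta>1 N.smult_l_distr N.smult_r_distr N.smult_assoc1 N.a_ac)
qed

text \<open>Let \<open>T\<close> be the kernel of a free cover of \<open>N\<close> over \<open>R\<close>. Differentiating coefficients along \<open>\<delta>\<close>
  is linear on \<open>T\<close> and splits the map \<open>N \<rightarrow> T / \<alpha> T\<close> that lifts an element and multiplies it
  by \<open>\<alpha>\<close>.\<close>

lemma projective_if_pd_restrict_le_1:
  assumes "module S N" "pd R (restrict_scalars h N) \<le> enat (Suc 0)"
  shows "projective S (N :: ('s, 'n, 'e) module_scheme)"
proof -
  interpret N: module S N by fact
  let ?NR = "restrict_scalars h N"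
  have NR: "module R ?NR" by (rule module_restrict[OF assms(1)])
  let ?G = "free_module R (carrier N)"
  interpret G: module R ?G by (rule module_free_module[OF R])
  obtain \<pi> where \<pi>: "\<pi> \<in> module_hom R ?G ?NR" "\<And>x. x \<in> carrier N \<Longrightarrow> \<pi> (free_unit R (carrier N) x) = x" "\<pi> ` carrier ?G = carrier ?NR"
    using free_module_cover[OF NR] by auto
  let ?T = "ker_mod ?G ?NR \<pi>"
  have T: "module R ?T" by (rule module_ker_mod[OF G.module_axioms NR \<pi>(1)])
  have "projective R ?T"
    using pd_ker[OF NR projective_free_module[OF R] \<pi>(1,3)] assms(2) pd_eq_0_iff[OF T] by (simp flip: zero_enat_def)
  then obtain B :: "('n \<Rightarrow> 'r) set" and i p where ip: "i \<in> module_hom R ?T (free_module R B)" "p \<in> module_hom R (free_module R B) ?T"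
    "\<And>x. x \<in> carrier ?T \<Longrightarrow> p (i x) = x"
    unfolding projective_def by blast
  let ?D = "dual_module N"
  have D: "module R ?D" by (rule module_dual_module[OF assms(1)])
  \<comment> \<open>The first component of \<Phi> is \<pi>. The second, called \<open>r\<close>
    below, applies \<delta> to every coefficient of a formal combination of elements of
    \<open>N\<close>.\<close>
  obtain \<Phi> where \<Phi>: "\<Phi> \<in> module_hom R ?G ?D" "\<And>x. x \<in> carrier N \<Longrightarrow> \<Phi> (free_unit R (carrier N) x) = (x, \<zero>\<^bsub>N\<^esub>)"
    using free_module_hom_exists[OF D, of "carrier N" "\<lambda>x. (x, \<zero>\<^bsub>N\<^esub>)"] by (auto simp: dual_module_def)
  have "fst \<in> module_hom R ?D ?NR" by (rule module_homI) (auto simp: dual_module_def)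
  then have fst\<Phi>: "fst (\<Phi> x) = \<pi> x" if "x \<in> carrier ?G" for x
    using free_module_hom_eq[OF NR module_hom_comp[OF \<Phi>(1)] \<pi>(1)] that by (simp add: \<Phi>(2) \<pi>(2))
  define r where "r x = snd (\<Phi> x)" for x
  have r_closed: "r x \<in> carrier N" if "x \<in> carrier ?G" for x
    using module_hom_closed[OF \<Phi>(1) that] by (auto simp: r_def dual_module_def)
  have r_smult: "r (u \<odot>\<^bsub>?G\<^esub> x) = h u \<odot>\<^bsub>N\<^esub> r x \<oplus>\<^bsub>N\<^esub> \<delta> u \<odot>\<^bsub>N\<^esub> \<pi> x" if "u \<in> carrier R" "x \<in> carrier ?G" for u x
    using module_hom_smult[OF \<Phi>(1) that] fst\<Phi>[OF that(2)] by (simp add: r_def dual_module_def)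
  have r_add: "r (x \<oplus>\<^bsub>?G\<^esub> y) = r x \<oplus>\<^bsub>N\<^esub> r y" if "x \<in> carrier ?G" "y \<in> carrier ?G" for x y
    using module_hom_add[OF \<Phi>(1) that] by (simp add: r_def dual_module_def)
  \<comment> \<open>On \<open>?T\<close> the term with \<delta> drops out, because \<pi> vanishes
    there.\<close>
  have r: "r \<in> module_hom R ?T ?NR"
    by (rule module_homI) (auto simp: r_closed r_add r_smult \<delta>_closed h_closed)
  have \<pi>_closed: "\<pi> x \<in> carrier N" if "x \<in> carrier ?G" for x using module_hom_closed[OF \<pi>(1) that] by simp
  have r\<alpha>: "r (\<alpha> \<odot>\<^bsub>?G\<^esub> x) = \<pi> x" if "x \<in> carrier ?G" for x
    using that \<alpha> by (simp add: r_smult h_\<alpha> \<delta>_\<alpha> r_closed \<pi>_closed)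
  have \<alpha>T: "\<alpha> \<odot>\<^bsub>?G\<^esub> x \<in> carrier ?T" if "x \<in> carrier ?G" for x
    using that \<alpha> by (simp add: module_hom_smult[OF \<pi>(1)] h_\<alpha> \<pi>_closed)
  have m: "(\<lambda>x. \<alpha> \<odot>\<^bsub>?G\<^esub> x) \<in> module_hom R ?G ?T"
    by (rule module_homI) (use \<alpha>T \<alpha> in \<open>auto simp: G.smult_r_distr R.m_comm simp flip: G.smult_assoc1\<close>)
  let ?E = "restrict_scalars h (free_module S B)"
  have E: "module R ?E" by (rule module_restrict[OF module_free_module[OF S]])
  \<comment> \<open>For x in \<open>?T\<close> the map \<open>i\<close> can be applied before
    multiplying by \<alpha>, and multiples of \<alpha> reduce to 0; so the map descends from the
    cover to \<open>N\<close>.\<close>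
  have \<sigma>: "(\<lambda>x. reduce B (i (\<alpha> \<odot>\<^bsub>?G\<^esub> x))) \<in> module_hom R ?G ?E"
    by (rule module_hom_comp[OF module_hom_comp[OF m ip(1)] reduce_hom])
  have "reduce B (i (\<alpha> \<odot>\<^bsub>?G\<^esub> x)) = \<zero>\<^bsub>?E\<^esub>" if "x \<in> carrier ?G" "\<pi> x = \<zero>\<^bsub>?NR\<^esub>" for x
    using that module_hom_smult[OF ip(1) \<alpha>, of x] module_hom_closed[OF ip(1), of x] by (simp add: reduce_smult_\<alpha>)
  then obtain s where s: "s \<in> module_hom R ?NR ?E" "\<And>x. x \<in> carrier ?G \<Longrightarrow> s (\<pi> x) = reduce B (i (\<alpha> \<odot>\<^bsub>?G\<^esub> x))"
    using module_hom_factor[OF G.module_axioms NR E \<pi>(1,3) \<sigma>] by blast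
  have rp: "(\<lambda>c. r (p c)) \<in> module_hom R (free_module R B) ?NR" by (rule module_hom_comp[OF ip(2) r])
  have "r (p (free_unit R B b)) \<in> carrier N" if "b \<in> B" for b
    using module_hom_closed[OF rp free_unit_closed[OF R that]] by simp
  \<comment> \<open>\<beta> is r p read modulo \<alpha>, which is possible since the values lie in
    \<open>N\<close>. Following \<open>s\<close> it gives r (\<alpha> x) = \<pi> x.\<close>
  then obtain \<beta> where \<beta>: "\<beta> \<in> module_hom S (free_module S B) N" "\<And>b. b \<in> B \<Longrightarrow> \<beta> (free_unit S B b) = r (p (free_unit R B b))"
    using free_module_hom_exists[OF assms(1), of B "\<lambda>b. r (p (free_unit R B b))"] by blast
  have red_unit: "reduce B (free_unit R B b) = free_unit S B b" for b
    by (auto simp: reduce_def free_unit_def h_one h_zero)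
  have \<beta>r: "\<beta> (reduce B c) = r (p c)" if "c \<in> carrier (free_module R B)" for c
    by (rule free_module_hom_eq[OF NR module_hom_comp[OF reduce_hom module_hom_restrict_scalars[OF h \<beta>(1)]] rp _ that])
      (simp add: red_unit \<beta>(2))
  have "\<beta> (s y) = y" if "y \<in> carrier N" for y
  proof -
    have "y \<in> \<pi> ` carrier ?G" using \<pi>(3) that by simp
    then obtain x where x: "x \<in> carrier ?G" "y = \<pi> x" by blast
    have "\<beta> (s y) = r (p (i (\<alpha> \<odot>\<^bsub>?G\<^esub> x)))"
      unfolding x(2) s(2)[OF x(1)] by (rule \<beta>r[OF module_hom_closed[OF ip(1) \<alpha>T[OF x(1)]]])
    also have "\<dots> = y" using ip(3)[OF \<alpha>T[OF x(1)]] r\<alpha>[OF x(1)] x(2) by simp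
    finally show ?thesis .
  qed
  then show ?thesis
    by (rule projective_if_retract_free[OF assms(1) module_hom_restrict_scalars_surj[OF h_surj s(1)] \<beta>(1)])
qed

text \<open>Syzygies are taken over \<open>S\<close>. Their covers have projective dimension at most
  1 over \<open>R\<close>, so by the kernel estimate the bound over \<open>R\<close> drops along
  with the one over \<open>S\<close>, until \<open>projective_if_pd_restrict_le_1\<close>
  applies.\<close>

lemma pd_le_restrict_aux:
  fixes N :: "('s, ('s + 'z) list) module"
  assumes "module S N" "pd R (restrict_scalars h N) \<le> enat (Suc m)"
  shows "pd S N \<le> enat m"
  using assms
proof (induction m arbitrary: N)
  case 0
  then show ?case using projective_if_pd_restrict_le_1[OF 0] pd_eq_0_iff[OF 0(1)] by (simp flip: zero_enat_def)
next
  case (Suc m)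
  obtain G :: "('s, ('s + 'z) list) module" and g where G: "projective S G" "g \<in> module_hom S G N" "g ` carrier G = carrier N"
    using projective_cover_exists[OF Suc.prems(1)] by blast
  have K: "module S (ker_mod G N g)" by (rule module_ker_mod[OF projective_module[OF G(1)] Suc.prems(1) G(2)])
  have "pd R (restrict_scalars h G) \<le> enat (Suc m)"
    using pd_restrict_projective[OF G(1)] by (rule order_trans) simp
  then have "pd R (restrict_scalars h (ker_mod G N g)) \<le> enat (Suc m)"
    unfolding ker_mod_restrict_scalars[symmetric] using G(3) Suc.prems
    by (intro pd_kernel[OF _ _ module_hom_restrict_scalars[OF h G(2)]])
      (auto intro: module_restrict projective_module G)
  then show ?case using Suc.IH[OF K] pd_ker[OF Suc.prems(1) G] by simp
qed

theorem pd_restrict_scalars: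
  fixes N :: "('s, 'n, 'e) module_scheme"
  assumes "module S N"
  shows "pd R (restrict_scalars h N) \<le> enat (Suc m) \<longleftrightarrow> pd S N \<le> enat m"
proof -
  obtain e :: "'n \<Rightarrow> ('s + 'n) list" where e: "inj_on e (carrier N)" using list_embedding_exists inj_on_carrier by blast
  note T = transport_module[OF assms e]
  have b: "bij_betw e (carrier N) (carrier (transport_module e N))" using e by (simp add: bij_betw_def T(4))
  have "pd S N = pd S (transport_module e N)" by (rule pd_iso[OF assms T(1,2) b])
  moreover have "pd R (restrict_scalars h N) = pd R (restrict_scalars h (transport_module e N))"
    using b by (intro pd_iso[OF module_restrict[OF assms] module_restrict[OF T(1)] module_hom_restrict_scalars[OF h T(2)]]) simp
  ultimately show ?thesis
    using pd_restrict_le_aux[OF T(1)] pd_le_restrict_aux[OF T(1)] by auto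
qed

end

section \<open>Koszul cochains over a commutative ring\<close>

text \<open>Basis elements of the exterior algebra on \<open>length ys\<close> generators are encoded as lists of
  Booleans marking the generators that occur; the degree is the number of marks.\<close>

primrec koszul :: "'a::comm_ring_1 list \<Rightarrow> (bool list \<Rightarrow> 'a) \<Rightarrow> bool list \<Rightarrow> 'a"
  where "koszul [] f l = 0"
  | "koszul (y # ys) f l = (case l of [] \<Rightarrow> 0
      | b # l' \<Rightarrow> if b then y * f (False # l') - koszul ys (\<lambda>l. f (True # l)) l' else koszul ys (\<lambda>l. f (False # l)) l')"

text \<open>The degree is an integer, so that degree -1 exists and contains only the zero cochain;
  exactness in degree 0 needs no separate treatment.\<close>

definition cochain :: "nat \<Rightarrow> int \<Rightarrow> (bool list \<Rightarrow> 'a::zero) \<Rightarrow> bool"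
  where "cochain n i f \<longleftrightarrow> (\<forall>l. f l \<noteq> 0 \<longrightarrow> length l = n \<and> int (count_list l True) = i)"

text \<open>The ring as a module over itself: \<open>self.subspace\<close> means ideal and
  \<open>self.span\<close> the generated ideal.\<close>

interpretation self: Modules.module "(*) :: 'a::comm_ring_1 \<Rightarrow> 'a \<Rightarrow> 'a"
  by unfold_locales (simp_all add: algebra_simps)

declare self.scale_scale [simp del] \<comment> \<open>as a simplification rule it loops with \<open>mult.assoc\<close>\<close>

text \<open>Exactness of the Koszul complex over the ring modulo the ideal \<open>Q\<close>, with
  cochains given by representatives and equations replaced by congruences.\<close>

definition koszul_exact :: "'a::comm_ring_1 list \<Rightarrow> 'a set \<Rightarrow> int \<Rightarrow> bool"
  where "koszul_exact ys Q i \<longleftrightarrow> (\<forall>f. cochain (length ys) i f \<longrightarrow> (\<forall>l. koszul ys f l \<in> Q) \<longrightarrow>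
    (\<exists>g. cochain (length ys) (i - 1) g \<and> (\<forall>l. f l - koszul ys g l \<in> Q)))"

text \<open>Up to a shift, the complex on \<open>y # ys\<close> is the mapping cone of
  multiplication by \<open>y\<close> on the complex on \<open>ys\<close>: \<open>u\<close> holds the
  components without the first generator, \<open>v\<close> those with it.\<close>

definition join :: "(bool list \<Rightarrow> 'a::zero) \<Rightarrow> (bool list \<Rightarrow> 'a) \<Rightarrow> bool list \<Rightarrow> 'a"
  where "join u v l = (case l of [] \<Rightarrow> 0 | b # l' \<Rightarrow> if b then v l' else u l')"

lemma join_simps [simp]: "join u v [] = 0" "join u v (False # l) = u l" "join u v (True # l) = v l"
  by (simp_all add: join_def)

lemma cochain_join: "cochain n i u \<Longrightarrow> cochain n (i - 1) v \<Longrightarrow> cochain (Suc n) i (join u v)"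
  by (auto simp: cochain_def join_def split: list.splits)

lemma cochain_split:
  assumes "cochain (Suc n) i f"
  shows "cochain n i (\<lambda>l. f (False # l))" "cochain n (i - 1) (\<lambda>l. f (True # l))" "f [] = 0"
proof -
  have a: "f l \<noteq> 0 \<Longrightarrow> length l = Suc n \<and> int (count_list l True) = i" for l
    using assms by (simp add: cochain_def)
  show "cochain n i (\<lambda>l. f (False # l))" "cochain n (i - 1) (\<lambda>l. f (True # l))" "f [] = 0"
    using a[of "False # _"] a[of "True # _"] a[of "[]"] by (auto simp: cochain_def eq_diff_eq add.commute)
qed

lemma cochain_mult: "cochain n i f \<Longrightarrow> cochain n i (\<lambda>l. c * f l :: 'a::mult_zero)"
  unfolding cochain_def by (metis mult_zero_right)

lemma koszul_mult: "koszul ys (\<lambda>l. c * f l) l = c * koszul ys f l"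
proof (induction ys arbitrary: f l)
  case (Cons y ys)
  show ?case by (cases l) (simp_all add: Cons.IH[of "\<lambda>l. f (_ # l)"] right_diff_distrib mult.left_commute)
qed simp

lemma koszul_add: "koszul ys (\<lambda>l. f l + g l) l = koszul ys f l + koszul ys g l"
proof (induction ys arbitrary: f g l)
  case (Cons y ys)
  show ?case by (cases l) (simp_all add: Cons.IH[of "\<lambda>l. f (_ # l)" "\<lambda>l. g (_ # l)"] distrib_left)
qed simp

lemma koszul_zero [simp]: "koszul ys (\<lambda>l. 0) l = 0"
  using koszul_mult[of ys 0 "\<lambda>_. 0" l] by simp

lemma koszul_uminus: "koszul ys (\<lambda>l. - f l) l = - koszul ys f l"
  using koszul_mult[of ys "-1" f l] by simp

lemma koszul_diff: "koszul ys (\<lambda>l. f l - g l) l = koszul ys f l - koszul ys g l"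
  using koszul_add[of ys f "\<lambda>l. - g l" l] by (simp add: koszul_uminus)

lemma koszul_koszul: "koszul ys (koszul ys f) l = 0"
  by (induction ys arbitrary: f l) (auto simp: koszul_diff koszul_mult split: list.split)

lemma koszul_in_ideal: "self.subspace Q \<Longrightarrow> (\<And>l. f l \<in> Q) \<Longrightarrow> koszul ys f l \<in> Q"
  by (induction ys arbitrary: f l) (auto simp: self.subspace_0 intro!: self.subspace_diff self.subspace_scale split: list.split)

lemma cochain_koszul: "cochain (length ys) i f \<Longrightarrow> cochain (length ys) (i + 1) (koszul ys f)"
proof (induction ys arbitrary: f i)
  case (Cons y ys)
  note s = cochain_split[OF Cons.prems[simplified]]
  have u: "cochain (length ys) (i + 1) (koszul ys (\<lambda>l. f (False # l)))" by (rule Cons.IH) (rule s)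
  have v: "cochain (length ys) i (koszul ys (\<lambda>l. f (True # l)))" using Cons.IH[OF s(2)] by simp
  have "cochain (length ys) i (\<lambda>l. y * f (False # l) - koszul ys (\<lambda>l. f (True # l)) l)"
    unfolding cochain_def
  proof (intro allI impI)
    fix l assume "y * f (False # l) - koszul ys (\<lambda>l. f (True # l)) l \<noteq> 0"
    then have "f (False # l) \<noteq> 0 \<or> koszul ys (\<lambda>l. f (True # l)) l \<noteq> 0" by auto
    then show "length l = length ys \<and> int (count_list l True) = i" using s(1) v by (auto simp: cochain_def)
  qed
  then have "cochain (Suc (length ys)) (i + 1)
      (join (koszul ys (\<lambda>l. f (False # l))) (\<lambda>l. y * f (False # l) - koszul ys (\<lambda>l. f (True # l)) l))"
    by (intro cochain_join u) simp
  also have "join (koszul ys (\<lambda>l. f (False # l))) (\<lambda>l. y * f (False # l) - koszul ys (\<lambda>l. f (True # l)) l) = koszul (y # ys) f"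
    by (auto simp: join_def fun_eq_iff split: list.split)
  finally show ?case by simp
qed (simp add: cochain_def)

text \<open>A leading 1 makes the complex contractible. The contraction moves the components that
  contain the first generator to those that do not.\<close>

lemma koszul_exact_one:
  assumes "self.subspace Q"
  shows "koszul_exact (1 # ys) Q i"
  unfolding koszul_exact_def
proof (intro allI impI)
  fix f assume f: "cochain (length (1 # ys)) i f" "\<forall>l. koszul (1 # ys) f l \<in> Q"
  note s = cochain_split[OF f(1)[simplified]]
  let ?g = "join (\<lambda>l. f (True # l)) (\<lambda>_. 0)"
  have "cochain (length (1 # ys)) (i - 1) ?g"
    unfolding length_Cons by (rule cochain_join[OF s(2)]) (simp add: cochain_def)
  moreover have "f l - koszul (1 # ys) ?g l \<in> Q" for l
  proof (cases l)
    case (Cons x l')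
    then show ?thesis
      using f(2)[rule_format, of "True # l'"] self.subspace_0[OF assms] by (cases x) auto
  qed (use s(3) self.subspace_0[OF assms] in simp)
  ultimately show "\<exists>g. cochain (length (1 # ys)) (i - 1) g \<and> (\<forall>l. f l - koszul (1 # ys) g l \<in> Q)" by blast
qed

text \<open>For a cocycle (F, T) on \<open>a * b\<close>, the pair (b F, T) is a cocycle on
  \<open>a\<close>. If (u, v) bounds it, then (F, u) is a cocycle on \<open>b\<close>, bounded by
  some (u', v'), and (u', a v' + v) bounds (F, T).\<close>

lemma koszul_exact_mult:
  assumes Q: "self.subspace Q" and "koszul_exact (a # ys) Q i" "koszul_exact (b # ys) Q i"
  shows "koszul_exact (a * b # ys) Q i"
  unfolding koszul_exact_def
proof (intro allI impI)
  fix f assume f: "cochain (length (a * b # ys)) i f" "\<forall>l. koszul (a * b # ys) f l \<in> Q"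
  note s = cochain_split[OF f(1)[simplified]]
  let ?F = "\<lambda>l. f (False # l)" and ?T = "\<lambda>l. f (True # l)"
  have F: "koszul ys ?F l \<in> Q" for l using f(2)[rule_format, of "False # l"] by simp
  have T: "a * b * ?F l - koszul ys ?T l \<in> Q" for l using f(2)[rule_format, of "True # l"] by simp
  have "cochain (length (a # ys)) i (join (\<lambda>l. b * ?F l) ?T)"
    unfolding length_Cons by (rule cochain_join[OF cochain_mult[OF s(1)] s(2)])
  moreover have "koszul (a # ys) (join (\<lambda>l. b * ?F l) ?T) l \<in> Q" for l
    using F T self.subspace_0[OF Q] self.subspace_scale[OF Q] by (auto simp: koszul_mult mult.assoc[symmetric] split: list.split)
  ultimately obtain g where g: "cochain (length (a # ys)) (i - 1) g" "\<And>l. join (\<lambda>l. b * ?F l) ?T l - koszul (a # ys) g l \<in> Q"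
    using assms(2) unfolding koszul_exact_def by blast
  note sg = cochain_split[OF g(1)[simplified]]
  let ?u = "\<lambda>l. g (False # l)" and ?v = "\<lambda>l. g (True # l)"
  have u: "b * ?F l - koszul ys ?u l \<in> Q" for l using g(2)[of "False # l"] by simp
  have v: "?T l - (a * ?u l - koszul ys ?v l) \<in> Q" for l using g(2)[of "True # l"] by simp
  have "cochain (length (b # ys)) i (join ?F ?u)"
    unfolding length_Cons by (rule cochain_join[OF s(1) sg(1)])
  moreover have "koszul (b # ys) (join ?F ?u) l \<in> Q" for l
    using F u self.subspace_0[OF Q] by (auto split: list.split)
  ultimately obtain g' where g': "cochain (length (b # ys)) (i - 1) g'" "\<And>l. join ?F ?u l - koszul (b # ys) g' l \<in> Q"
    using assms(3) unfolding koszul_exact_def by blast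
  note sg' = cochain_split[OF g'(1)[simplified]]
  let ?u' = "\<lambda>l. g' (False # l)" and ?v' = "\<lambda>l. g' (True # l)"
  have u': "?F l - koszul ys ?u' l \<in> Q" for l using g'(2)[of "False # l"] by simp
  have v': "?u l - (b * ?u' l - koszul ys ?v' l) \<in> Q" for l using g'(2)[of "True # l"] by simp
  let ?h = "join ?u' (\<lambda>l. a * ?v' l + ?v l)"
  have "cochain (length ys) (i - 1 - 1) (\<lambda>l. a * ?v' l + ?v l)"
    unfolding cochain_def
  proof (intro allI impI)
    fix l assume "a * ?v' l + ?v l \<noteq> 0"
    then have "?v' l \<noteq> 0 \<or> ?v l \<noteq> 0" by auto
    then show "length l = length ys \<and> int (count_list l True) = i - 1 - 1"
      using sg(2) sg'(2) by (auto simp: cochain_def)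
  qed
  then have "cochain (length (a * b # ys)) (i - 1) ?h"
    using cochain_join[OF sg'(1)] by simp
  moreover have "f l - koszul (a * b # ys) ?h l \<in> Q" for l
  proof (cases l)
    case Nil
    then show ?thesis using s(3) self.subspace_0[OF Q] by simp
  next
    case (Cons x l')
    have "?T l' - (a * b * ?u' l' - koszul ys (\<lambda>l. a * ?v' l + ?v l) l') =
      (?T l' - (a * ?u l' - koszul ys ?v l')) + a * (?u l' - (b * ?u' l' - koszul ys ?v' l'))"
      unfolding koszul_add koszul_mult by (simp only: algebra_simps)
    also have "\<dots> \<in> Q" using v v' by (intro self.subspace_add[OF Q] self.subspace_scale[OF Q])
    finally show ?thesis using Cons u' by (cases x) auto
  qed
  ultimately show "\<exists>g. cochain (length (a * b # ys)) (i - 1) g \<and> (\<forall>l. f l - koszul (a * b # ys) g l \<in> Q)" by blast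
qed

lemma koszul_exact_power:
  assumes "self.subspace Q" "koszul_exact (b # ys) Q i"
  shows "koszul_exact (b ^ n # ys) Q i"
  using assms by (induction n) (auto intro: koszul_exact_one koszul_exact_mult)

text \<open>The long exact sequence for multiplication by an element regular modulo
  \<open>Q\<close>, written out. The ideal \<open>Q'\<close> is generated by \<open>Q\<close> and
  \<open>b\<close>, and the complex on \<open>ys\<close> is used over it in degree i - 1
  only.\<close>

lemma koszul_exact_Cons:
  assumes Q: "self.subspace Q" and Q': "self.subspace Q'" "Q \<subseteq> Q'" "b \<in> Q'"
    and regular: "\<And>x. b * x \<in> Q \<Longrightarrow> x \<in> Q" and mod: "\<And>x. x \<in> Q' \<Longrightarrow> \<exists>s. x - s * b \<in> Q"
    and ex: "koszul_exact ys Q' (i - 1)"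
  shows "koszul_exact (b # ys) Q i"
  unfolding koszul_exact_def
proof (intro allI impI)
  fix f assume f: "cochain (length (b # ys)) i f" "\<forall>l. koszul (b # ys) f l \<in> Q"
  note s = cochain_split[OF f(1)[simplified]]
  let ?F = "\<lambda>l. f (False # l)" and ?T = "\<lambda>l. f (True # l)"
  have T: "b * ?F l - koszul ys ?T l \<in> Q" for l using f(2)[rule_format, of "True # l"] by simp
  have "koszul ys ?T l \<in> Q'" for l
  proof -
    have "koszul ys ?T l = ?F l * b - (b * ?F l - koszul ys ?T l)" by (simp add: mult.commute)
    also have "\<dots> \<in> Q'" by (rule self.subspace_diff[OF Q'(1) self.subspace_scale[OF Q'(1,3)]]) (use T Q'(2) in blast)
    finally show ?thesis .
  qed
  then obtain h where h: "cochain (length ys) (i - 1 - 1) h" "\<And>l. ?T l - koszul ys h l \<in> Q'"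
    using ex s(2) unfolding koszul_exact_def by blast
  obtain g0 where g0: "\<And>l. ?T l - koszul ys h l - g0 l * b \<in> Q" using mod[OF h(2)] by metis
  \<comment> \<open>The coefficients of \<open>b\<close> are chosen entry by entry and then cut off
    outside the right degree, where the cochain to be expressed vanishes.\<close>
  define g where "g l = (if length l = length ys \<and> int (count_list l True) = i - 1 then g0 l else 0)" for l
  have hd: "cochain (length ys) (i - 1) (koszul ys h)" using cochain_koszul[OF h(1)] by simp
  have g: "?T l - koszul ys h l - b * g l \<in> Q" for l
    using g0[of l] s(2) hd self.subspace_0[OF Q] by (cases "?T l = 0"; cases "koszul ys h l = 0") (auto simp: g_def cochain_def mult.commute)
  have "b * (?F l - koszul ys g l) \<in> Q" for l
  proof -
    \<comment> \<open>The differential squares to zero, so \<open>koszul ys h\<close> contributes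
      nothing.\<close>
    have "b * (?F l - koszul ys g l) = (b * ?F l - koszul ys ?T l) + koszul ys (\<lambda>l. ?T l - koszul ys h l - b * g l) l"
      unfolding koszul_diff koszul_mult koszul_koszul by (simp only: algebra_simps) simp
    also have "\<dots> \<in> Q" using T g by (intro self.subspace_add[OF Q] koszul_in_ideal[OF Q])
    finally show ?thesis .
  qed
  then have F: "?F l - koszul ys g l \<in> Q" for l by (rule regular)
  have "cochain (length (b # ys)) (i - 1) (join g (\<lambda>l. - h l))"
    unfolding length_Cons by (rule cochain_join) (use h(1) in \<open>auto simp: g_def cochain_def split: if_splits\<close>)
  moreover have "f l - koszul (b # ys) (join g (\<lambda>l. - h l)) l \<in> Q" for l
  proof (cases l)
    case Nil
    then show ?thesis using s(3) self.subspace_0[OF Q] by simp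
  next
    case (Cons x l')
    then show ?thesis using F g[of l'] by (cases x) (auto simp: koszul_uminus algebra_simps)
  qed
  ultimately show "\<exists>g. cochain (length (b # ys)) (i - 1) g \<and> (\<forall>l. f l - koszul (b # ys) g l \<in> Q)" by blast
qed

section \<open>Koszul cochains with values in a module\<close>

text \<open>The sign is scalar multiplication by -1 rather than an additive inverse, so that the
  scalar rule for homomorphisms covers it.\<close>

primrec mod_koszul :: "('r, 'c) ring_scheme \<Rightarrow> ('r, 'm, 'd) module_scheme \<Rightarrow> 'r list \<Rightarrow> (bool list \<Rightarrow> 'm) \<Rightarrow> bool list \<Rightarrow> 'm"
  where "mod_koszul R M [] f l = \<zero>\<^bsub>M\<^esub>"
  | "mod_koszul R M (y # ys) f l = (case l of [] \<Rightarrow> \<zero>\<^bsub>M\<^esub>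
      | b # l' \<Rightarrow> if b then y \<odot>\<^bsub>M\<^esub> f (False # l') \<oplus>\<^bsub>M\<^esub> (\<ominus>\<^bsub>R\<^esub> \<one>\<^bsub>R\<^esub>) \<odot>\<^bsub>M\<^esub> mod_koszul R M ys (\<lambda>l. f (True # l)) l'
        else mod_koszul R M ys (\<lambda>l. f (False # l)) l')"

definition mod_cochain :: "('r, 'm, 'd) module_scheme \<Rightarrow> nat \<Rightarrow> int \<Rightarrow> (bool list \<Rightarrow> 'm) \<Rightarrow> bool"
  where "mod_cochain M n i f \<longleftrightarrow> (\<forall>l. f l \<in> carrier M \<and> (f l \<noteq> \<zero>\<^bsub>M\<^esub> \<longrightarrow> length l = n \<and> int (count_list l True) = i))"

definition mod_koszul_exact :: "('r, 'c) ring_scheme \<Rightarrow> ('r, 'm, 'd) module_scheme \<Rightarrow> 'r list \<Rightarrow> int \<Rightarrow> bool"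
  where "mod_koszul_exact R M ys i \<longleftrightarrow> (\<forall>f. mod_cochain M (length ys) i f \<longrightarrow> (\<forall>l. mod_koszul R M ys f l = \<zero>\<^bsub>M\<^esub>) \<longrightarrow>
    (\<exists>g. mod_cochain M (length ys) (i - 1) g \<and> (\<forall>l. mod_koszul R M ys g l = f l)))"

lemma mod_koszul_cong:
  assumes "zero N = zero M" "add N = add M" "smult N = smult M"
  shows "mod_koszul R N ys f l = mod_koszul R M ys f l"
  by (induction ys arbitrary: f l) (auto simp: assms split: list.split)

lemma mod_koszul_closed:
  assumes "module R M" "set ys \<subseteq> carrier R" "\<And>l. f l \<in> carrier M"
  shows "mod_koszul R M ys f l \<in> carrier M"
proof -
  interpret module R M by fact
  show ?thesis using assms(2,3)
    by (induction ys arbitrary: f l) (auto split: list.split)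
qed

lemma mod_koszul_hom:
  assumes "module R M" "module R N" "h \<in> module_hom R M N" "set ys \<subseteq> carrier R" "\<And>l. f l \<in> carrier M"
  shows "h (mod_koszul R M ys f l) = mod_koszul R N ys (\<lambda>l. h (f l)) l"
proof -
  interpret M: module R M by fact
  show ?thesis using assms(4,5)
    by (induction ys arbitrary: f l)
      (auto simp: module_hom_zero[OF assms(1-3)] module_hom_add[OF assms(3)] module_hom_smult[OF assms(3)]
        mod_koszul_closed[OF assms(1)] split: list.split)
qed

lemma mod_koszul_add:
  assumes "module R M" "set ys \<subseteq> carrier R" "\<And>l. f l \<in> carrier M" "\<And>l. g l \<in> carrier M"
  shows "mod_koszul R M ys (\<lambda>l. f l \<oplus>\<^bsub>M\<^esub> g l) l = mod_koszul R M ys f l \<oplus>\<^bsub>M\<^esub> mod_koszul R M ys g l"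
proof -
  interpret M: module R M by fact
  show ?thesis using assms(2-4)
    by (induction ys arbitrary: f g l)
      (auto simp: M.smult_r_distr mod_koszul_closed[OF assms(1)] M.a_ac split: list.split)
qed

lemma mod_koszul_smult:
  assumes "module R M" "set ys \<subseteq> carrier R" "\<And>l. f l \<in> carrier M" "r \<in> carrier R"
  shows "mod_koszul R M ys (\<lambda>l. r \<odot>\<^bsub>M\<^esub> f l) l = r \<odot>\<^bsub>M\<^esub> mod_koszul R M ys f l"
proof -
  interpret M: module R M by fact
  have "(\<lambda>x. r \<odot>\<^bsub>M\<^esub> x) \<in> module_hom R M M"
    using assms(4) by (auto simp: module_hom_def M.smult_r_distr M.m_comm simp flip: M.smult_assoc1)
  from mod_koszul_hom[OF assms(1,1) this assms(2,3)] show ?thesis by simp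
qed

lemma mod_koszul_minus:
  assumes "module R M" "set ys \<subseteq> carrier R" "\<And>l. f l \<in> carrier M" "\<And>l. g l \<in> carrier M"
  shows "mod_koszul R M ys (\<lambda>l. f l \<ominus>\<^bsub>M\<^esub> g l) l = mod_koszul R M ys f l \<ominus>\<^bsub>M\<^esub> mod_koszul R M ys g l"
proof -
  interpret M: module R M by fact
  have "mod_koszul R M ys (\<lambda>l. f l \<oplus>\<^bsub>M\<^esub> (\<ominus>\<^bsub>R\<^esub> \<one>\<^bsub>R\<^esub>) \<odot>\<^bsub>M\<^esub> g l) l = mod_koszul R M ys f l \<oplus>\<^bsub>M\<^esub> (\<ominus>\<^bsub>R\<^esub> \<one>\<^bsub>R\<^esub>) \<odot>\<^bsub>M\<^esub> mod_koszul R M ys g l"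
    using assms by (simp add: mod_koszul_add mod_koszul_smult)
  then show ?thesis using assms by (simp add: a_minus_def M.a_inv_smult mod_koszul_closed)
qed

lemma mod_koszul_mod_koszul:
  assumes "module R M" "set ys \<subseteq> carrier R" "\<And>l. f l \<in> carrier M"
  shows "mod_koszul R M ys (mod_koszul R M ys f) l = \<zero>\<^bsub>M\<^esub>"
proof -
  interpret M: module R M by fact
  show ?thesis using assms(2,3)
  proof (induction ys arbitrary: f l)
    case (Cons y ys)
    have y: "y \<in> carrier R" "set ys \<subseteq> carrier R" using Cons.prems by auto
    let ?F = "\<lambda>l. f (False # l)" and ?T = "\<lambda>l. f (True # l)"
    have cl: "mod_koszul R M ys ?F l \<in> carrier M" "mod_koszul R M ys ?T l \<in> carrier M" for l
      using Cons.prems by (auto intro!: mod_koszul_closed assms(1))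
    have IH: "mod_koszul R M ys (mod_koszul R M ys ?F) l = \<zero>\<^bsub>M\<^esub>" "mod_koszul R M ys (mod_koszul R M ys ?T) l = \<zero>\<^bsub>M\<^esub>" for l
      using Cons by auto
    have "mod_koszul R M ys (\<lambda>l. y \<odot>\<^bsub>M\<^esub> ?F l \<oplus>\<^bsub>M\<^esub> (\<ominus>\<^bsub>R\<^esub> \<one>\<^bsub>R\<^esub>) \<odot>\<^bsub>M\<^esub> mod_koszul R M ys ?T l) l = y \<odot>\<^bsub>M\<^esub> mod_koszul R M ys ?F l" for l
      using y Cons.prems(2) cl by (simp add: mod_koszul_add[OF assms(1)] mod_koszul_smult[OF assms(1)] IH)
    then show ?case
      using y cl IH by (auto simp: M.r_neg M.smult_l_minus split: list.split)
  qed simp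
qed

lemma mod_cochain_koszul:
  assumes "module R M" "set ys \<subseteq> carrier R" "mod_cochain M (length ys) i f"
  shows "mod_cochain M (length ys) (i + 1) (mod_koszul R M ys f)"
proof -
  interpret M: module R M by fact
  have cl: "f l \<in> carrier M" for l using assms(3) by (simp add: mod_cochain_def)
  have "mod_koszul R M ys f l \<noteq> \<zero>\<^bsub>M\<^esub> \<Longrightarrow> length l = length ys \<and> int (count_list l True) = i + 1" for l
    using assms(2,3)
  proof (induction ys arbitrary: f i l)
    case (Cons y ys)
    have f: "f l \<in> carrier M" and a: "f l \<noteq> \<zero>\<^bsub>M\<^esub> \<Longrightarrow> length l = Suc (length ys) \<and> int (count_list l True) = i" for l
      using Cons.prems(3) by (simp_all add: mod_cochain_def)
    have s: "mod_cochain M (length ys) i (\<lambda>l. f (False # l))" "mod_cochain M (length ys) (i - 1) (\<lambda>l. f (True # l))"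
      unfolding mod_cochain_def using f a[of "False # _"] a[of "True # _"] by (auto simp: eq_diff_eq add.commute)
    obtain b l' where l: "l = b # l'" using Cons.prems(1) by (cases l) auto
    show ?case
    proof (cases b)
      case True
      then have "f (False # l') \<noteq> \<zero>\<^bsub>M\<^esub> \<or> mod_koszul R M ys (\<lambda>l. f (True # l)) l' \<noteq> \<zero>\<^bsub>M\<^esub>"
        using Cons.prems l by auto
      then show ?thesis
        using Cons.IH[OF _ _ s(2), of l'] Cons.prems(2) s(1) l True by (auto simp: mod_cochain_def)
    qed (use Cons.IH[OF _ _ s(1), of l'] Cons.prems l in auto)
  qed simp
  then show ?thesis using mod_koszul_closed[OF assms(1,2) cl] by (simp add: mod_cochain_def)
qed

lemma mod_cochain_hom:
  assumes "module R M" "module R N" "h \<in> module_hom R M N" "mod_cochain M n i f"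
  shows "mod_cochain N n i (\<lambda>l. h (f l))"
  using assms(4) module_hom_closed[OF assms(3)] module_hom_zero[OF assms(1-3)] unfolding mod_cochain_def by metis

section \<open>Koszul exactness along retracts and short exact sequences\<close>

lemma mod_koszul_exact_retract:
  assumes "module R M" "module R N" "i \<in> module_hom R M N" "p \<in> module_hom R N M"
    and "\<And>x. x \<in> carrier M \<Longrightarrow> p (i x) = x" and ys: "set ys \<subseteq> carrier R" and "mod_koszul_exact R N ys j"
  shows "mod_koszul_exact R M ys j"
  unfolding mod_koszul_exact_def
proof (intro allI impI)
  fix f assume f: "mod_cochain M (length ys) j f" "\<forall>l. mod_koszul R M ys f l = \<zero>\<^bsub>M\<^esub>"
  have fc: "f l \<in> carrier M" for l using f(1) by (simp add: mod_cochain_def)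
  have "mod_koszul R N ys (\<lambda>l. i (f l)) l = \<zero>\<^bsub>N\<^esub>" for l
    using mod_koszul_hom[OF assms(1-3) ys, of f l, OF fc] f(2) module_hom_zero[OF assms(1-3)] by simp
  then obtain g where g: "mod_cochain N (length ys) (j - 1) g" "\<And>l. mod_koszul R N ys g l = i (f l)"
    using assms(7) mod_cochain_hom[OF assms(1-3) f(1)] unfolding mod_koszul_exact_def by blast
  have gc: "g l \<in> carrier N" for l using g(1) by (simp add: mod_cochain_def)
  have "mod_koszul R M ys (\<lambda>l. p (g l)) l = f l" for l
    using mod_koszul_hom[OF assms(2,1,4) ys, of g l, OF gc] by (simp add: g(2) assms(5) fc)
  then show "\<exists>g. mod_cochain M (length ys) (j - 1) g \<and> (\<forall>l. mod_koszul R M ys g l = f l)"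
    using mod_cochain_hom[OF assms(2,1,4) g(1)] by blast
qed

text \<open>The part H^i(P) \<rightarrow> H^i(M) \<rightarrow> H^(i+1)(ker g) of the long exact
  sequence, as a diagram chase on cochains.\<close>

lemma mod_koszul_exact_quotient:
  assumes "module R P" "module R M" "g \<in> module_hom R P M" "g ` carrier P = carrier M"
    and ys: "set ys \<subseteq> carrier R" and "mod_koszul_exact R P ys i" "mod_koszul_exact R (ker_mod P M g) ys (i + 1)"
  shows "mod_koszul_exact R M ys i"
  unfolding mod_koszul_exact_def
proof (intro allI impI)
  interpret P: module R P by fact
  interpret M: module R M by fact
  fix f assume f: "mod_cochain M (length ys) i f" "\<forall>l. mod_koszul R M ys f l = \<zero>\<^bsub>M\<^esub>"
  let ?K = "ker_mod P M g"
  have K: "mod_koszul R ?K ys u l = mod_koszul R P ys u l" for u l by (rule mod_koszul_cong) simp_all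
  have g0: "g \<zero>\<^bsub>P\<^esub> = \<zero>\<^bsub>M\<^esub>" by (rule module_hom_zero[OF assms(1-3)])
  \<comment> \<open>Zero values are lifted to zero, so that the lift is again a cochain of degree
    \<open>i\<close>.\<close>
  have "\<forall>l. \<exists>x\<in>carrier P. g x = f l \<and> (f l = \<zero>\<^bsub>M\<^esub> \<longrightarrow> x = \<zero>\<^bsub>P\<^esub>)"
  proof
    fix l
    have "f l \<in> g ` carrier P" using f(1) assms(4) by (simp add: mod_cochain_def)
    then show "\<exists>x\<in>carrier P. g x = f l \<and> (f l = \<zero>\<^bsub>M\<^esub> \<longrightarrow> x = \<zero>\<^bsub>P\<^esub>)"
      using g0 by (cases "f l = \<zero>\<^bsub>M\<^esub>") auto
  qed
  then obtain F where F: "\<And>l. F l \<in> carrier P" "\<And>l. g (F l) = f l" "\<And>l. f l = \<zero>\<^bsub>M\<^esub> \<Longrightarrow> F l = \<zero>\<^bsub>P\<^esub>" by metis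
  have Fc: "mod_cochain P (length ys) i F" using f(1) F by (auto simp: mod_cochain_def)
  have dF: "mod_cochain P (length ys) (i + 1) (mod_koszul R P ys F)" by (rule mod_cochain_koszul[OF assms(1) ys Fc])
  have "g (mod_koszul R P ys F l) = \<zero>\<^bsub>M\<^esub>" for l
    using mod_koszul_hom[OF assms(1-3) ys, of F l, OF F(1)] f(2) F(2) by simp
  then have "mod_cochain ?K (length ys) (i + 1) (mod_koszul R P ys F)"
    using dF by (simp add: mod_cochain_def)
  moreover have "\<forall>l. mod_koszul R ?K ys (mod_koszul R P ys F) l = \<zero>\<^bsub>?K\<^esub>"
    unfolding K using mod_koszul_mod_koszul[OF assms(1) ys, of F, OF F(1)] by simp
  ultimately obtain \<kappa> where \<kappa>: "mod_cochain ?K (length ys) (i + 1 - 1) \<kappa>" "\<And>l. mod_koszul R P ys \<kappa> l = mod_koszul R P ys F l"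
    using assms(7) unfolding mod_koszul_exact_def K by blast
  have \<kappa>c: "\<kappa> l \<in> carrier P" "g (\<kappa> l) = \<zero>\<^bsub>M\<^esub>" for l using \<kappa>(1) by (auto simp: mod_cochain_def)
  have "mod_koszul R P ys (\<lambda>l. F l \<ominus>\<^bsub>P\<^esub> \<kappa> l) l = \<zero>\<^bsub>P\<^esub>" for l
    using F(1) \<kappa>c(1) mod_koszul_closed[OF assms(1) ys, of F, OF F(1)] by (simp add: mod_koszul_minus[OF assms(1) ys] \<kappa>(2) P.minus_eq_zero_iff)
  moreover have "mod_cochain P (length ys) i (\<lambda>l. F l \<ominus>\<^bsub>P\<^esub> \<kappa> l)"
    unfolding mod_cochain_def
  proof (intro allI conjI impI)
    fix l
    show "F l \<ominus>\<^bsub>P\<^esub> \<kappa> l \<in> carrier P" using F(1) \<kappa>c(1) by simp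
    assume "F l \<ominus>\<^bsub>P\<^esub> \<kappa> l \<noteq> \<zero>\<^bsub>P\<^esub>"
    then have "F l \<noteq> \<zero>\<^bsub>P\<^esub> \<or> \<kappa> l \<noteq> \<zero>\<^bsub>P\<^esub>" by (auto simp: P.minus_eq_zero_iff)
    then show "length l = length ys" "int (count_list l True) = i"
      using Fc \<kappa>(1) by (auto simp: mod_cochain_def)
  qed
  ultimately obtain \<xi> where \<xi>: "mod_cochain P (length ys) (i - 1) \<xi>" "\<And>l. mod_koszul R P ys \<xi> l = F l \<ominus>\<^bsub>P\<^esub> \<kappa> l"
    using assms(6) unfolding mod_koszul_exact_def by blast
  have \<xi>c: "\<xi> l \<in> carrier P" for l using \<xi>(1) by (simp add: mod_cochain_def)
  have "mod_koszul R M ys (\<lambda>l. g (\<xi> l)) l = f l" for l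
  proof -
    have "mod_koszul R M ys (\<lambda>l. g (\<xi> l)) l = g (F l \<ominus>\<^bsub>P\<^esub> \<kappa> l)"
      using mod_koszul_hom[OF assms(1-3) ys, of \<xi> l, OF \<xi>c] \<xi>(2) by simp
    also have "\<dots> = f l"
      unfolding module_hom_minus[OF assms(1-3) F(1) \<kappa>c(1)] F(2) \<kappa>c(2)
      using f(1) by (simp add: a_minus_def mod_cochain_def)
    finally show ?thesis .
  qed
  then show "\<exists>g. mod_cochain M (length ys) (i - 1) g \<and> (\<forall>l. mod_koszul R M ys g l = f l)"
    using mod_cochain_hom[OF assms(1-3) \<xi>(1)] by blast
qed

text \<open>Each syzygy trades one step of projective dimension for one degree: exactness for
  \<open>M\<close> in degree i follows from exactness for its syzygy in degree i + 1. Hence the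
  range i + n < c.\<close>

lemma mod_koszul_exact_pd_aux:
  fixes M :: "('r, ('r + 'z) list) module"
  assumes "\<And>(B :: ('r + 'z) list set) i. i < int c \<Longrightarrow> mod_koszul_exact R (free_module R B) ys i"
    and ys: "set ys \<subseteq> carrier R"
    and "module R M" "pd R M \<le> enat n" "i + int n < int c"
  shows "mod_koszul_exact R M ys i"
proof -
  have proj: "mod_koszul_exact R P ys i" if P: "projective R P" "i < int c" for P :: "('r, ('r + 'z) list) module" and i
  proof -
    obtain B :: "('r + 'z) list set" and j p where jp: "j \<in> module_hom R P (free_module R B)" "p \<in> module_hom R (free_module R B) P"
      "\<forall>x\<in>carrier P. p (j x) = x" using P(1) by (auto simp: projective_def)
    show ?thesis
      using assms(1)[OF P(2)] jp(3)
      by (intro mod_koszul_exact_retract[OF projective_module[OF P(1)] _ jp(1,2) _ ys] module_free_module module_cring[OF assms(3)]) auto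
  qed
  show ?thesis using assms(3-5)
  proof (induction n arbitrary: M i)
    case 0
    then have "projective R M" by (simp add: pd_eq_0_iff flip: zero_enat_def)
    then show ?case using 0 by (intro proj) auto
  next
    case (Suc n)
    obtain G :: "('r, ('r + 'z) list) module" and g where G: "projective R G" "g \<in> module_hom R G M" "g ` carrier G = carrier M"
      using projective_cover_exists[OF Suc.prems(1)] by blast
    show ?case
      using Suc.prems pd_ker[OF Suc.prems(1) G]
      by (intro mod_koszul_exact_quotient[OF projective_module[OF G(1)] Suc.prems(1) G(2,3) ys proj[OF G(1)]] Suc.IH
          module_ker_mod[OF projective_module[OF G(1)] Suc.prems(1) G(2)]) auto
  qed
qed

lemma mod_koszul_exact_pd:
  fixes M :: "('r, 'm, 'd) module_scheme"
  assumes "\<And>(B :: ('r + 'm) list set) i. i < int c \<Longrightarrow> mod_koszul_exact R (free_module R B) ys i"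
    and ys: "set ys \<subseteq> carrier R"
    and "module R M" "pd R M \<le> enat n" "i + int n < int c"
  shows "mod_koszul_exact R M ys i"
proof -
  obtain e :: "'m \<Rightarrow> ('r + 'm) list" where e: "inj_on e (carrier M)" using list_embedding_exists inj_on_carrier by blast
  note T = transport_module[OF assms(3) e]
  have b: "bij_betw e (carrier M) (carrier (transport_module e M))" using e by (simp add: bij_betw_def T(4))
  have "mod_koszul_exact R (transport_module e M) ys i"
    using pd_iso[OF assms(3) T(1,2) b] assms(4) by (intro mod_koszul_exact_pd_aux[OF assms(1) ys T(1) _ assms(5)]) auto
  then show ?thesis
    using e by (intro mod_koszul_exact_retract[OF assms(3) T(1,2,3) _ ys]) auto
qed

section \<open>Polynomials and linear forms\<close>

text \<open>The target ring is arbitrary because two substitutions are used: one into polynomials in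
  variables indexed by \<open>nat\<close>, and linear substitutions of the polynomial ring into
  itself.\<close>

definition poly_subst :: "('k::field \<Rightarrow> 'r) \<Rightarrow> ('n \<Rightarrow> 'r) \<Rightarrow> ('k, 'n::finite) poly_ring_elem \<Rightarrow> 'r::comm_ring_1"
  where "poly_subst h g f = (\<Sum>m\<in>Poly_Mapping.keys f. h (Poly_Mapping.lookup f m) * (\<Prod>i\<in>UNIV. g i ^ Poly_Mapping.lookup m i))"

locale coefficient_hom =
  fixes h :: "'k::field \<Rightarrow> 'r::comm_ring_1"
  assumes zero: "h 0 = 0" and one: "h 1 = 1" and add: "h (a + b) = h a + h b" and mult: "h (a * b) = h a * h b"
begin

lemma poly_subst_superset:
  assumes "finite A" "Poly_Mapping.keys f \<subseteq> A"
  shows "poly_subst h g f = (\<Sum>m\<in>A. h (Poly_Mapping.lookup f m) * (\<Prod>i\<in>UNIV. g i ^ Poly_Mapping.lookup m i))"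
  unfolding poly_subst_def using assms by (intro sum.mono_neutral_left) (auto simp: in_keys_iff zero)

lemma poly_subst_single: "poly_subst h g (Poly_Mapping.single m c) = h c * (\<Prod>i\<in>UNIV. g i ^ Poly_Mapping.lookup m i)"
  by (subst poly_subst_superset[where A = "{m}"]) (auto simp: when_def)

lemma poly_subst_add: "poly_subst h g (f + f') = poly_subst h g f + poly_subst h g f'"
proof -
  let ?A = "Poly_Mapping.keys f \<union> Poly_Mapping.keys f'"
  have "Poly_Mapping.keys (f + f') \<subseteq> ?A" by (rule Poly_Mapping.keys_add)
  then show ?thesis
    by (simp add: poly_subst_superset[where A = "?A"] lookup_add distrib_right add sum.distrib)
qed

lemma poly_subst_mult: "poly_subst h g (f * f') = poly_subst h g f * poly_subst h g f'"
proof (induction f rule: poly_add_induct)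
  case (1 m c)
  show ?case
  proof (induction f' rule: poly_add_induct)
    case (1 m' c')
    show ?case unfolding mult_single poly_subst_single mult lookup_add power_add prod.distrib by (simp only: ac_simps)
  qed (simp add: distrib_left poly_subst_add)
qed (simp add: distrib_right poly_subst_add)

lemma poly_subst_const: "poly_subst h g (const c) = h c"
  by (simp add: const_def poly_subst_single)

lemma poly_subst_var: "poly_subst h g (var i) = g i"
proof -
  have "(\<Prod>j\<in>UNIV. g j ^ Poly_Mapping.lookup (Poly_Mapping.single i (1::nat)) j) = (\<Prod>j\<in>UNIV. if j = i then g j else 1)"
    by (intro prod.cong) (auto simp: lookup_single when_def)
  then show ?thesis by (simp add: var_def poly_subst_single one)
qed

lemma poly_subst_zero: "poly_subst h g 0 = 0"
  by (simp add: poly_subst_def)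

lemma poly_subst_sum: "poly_subst h g (sum F A) = (\<Sum>x\<in>A. poly_subst h g (F x))"
  by (induction A rule: infinite_finite_induct) (auto simp: poly_subst_zero poly_subst_add)

end

lemma const_add: "const (a + b) = const a + const b"
  and const_mult: "const (a * b) = const a * const b"
  and const_0 [simp]: "const 0 = 0"
  and const_1 [simp]: "const 1 = 1"
  by (simp_all add: const_def single_add mult_single)

interpretation const: coefficient_hom const
  by unfold_locales (simp_all add: const_add const_mult)

lemma const_eq_iff [simp]: "const a = const b \<longleftrightarrow> a = b"
  unfolding const_def by (metis lookup_single_eq)

text \<open>The library proves that polynomials over a field have no zero divisors only for linearly
  ordered index types.\<close>

lemma poly_no_zero_divisors:
  fixes f g :: "('k::field, 'n::finite) poly_ring_elem"
  assumes "f * g = 0"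
  shows "f = 0 \<or> g = 0"
proof -
  obtain idx :: "'n \<Rightarrow> nat" where idx: "inj idx"
    using finite_imp_inj_to_nat_seg[of "UNIV :: 'n set"] by auto
  \<comment> \<open>Variables are renamed by an injection into \<open>nat\<close>. The induced map
    \<open>E\<close> on exponents is injective, hence so is the substitution, and the absence of
    zero divisors is inherited from the larger ring.\<close>
  define x :: "'n \<Rightarrow> (nat \<Rightarrow>\<^sub>0 nat) \<Rightarrow>\<^sub>0 'k" where "x i = Poly_Mapping.single (Poly_Mapping.single (idx i) 1) 1" for i
  define E :: "('n \<Rightarrow>\<^sub>0 nat) \<Rightarrow> (nat \<Rightarrow>\<^sub>0 nat)" where "E m = (\<Sum>i\<in>UNIV. Poly_Mapping.single (idx i) (Poly_Mapping.lookup m i))" for m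
  interpret s: coefficient_hom "Poly_Mapping.single (0 :: nat \<Rightarrow>\<^sub>0 nat) :: 'k \<Rightarrow> _"
    by unfold_locales (simp_all add: single_add mult_single)
  have x_power: "x i ^ k = Poly_Mapping.single (Poly_Mapping.single (idx i) k) 1" for i k
    by (induction k) (auto simp: x_def mult_single simp flip: single_add)
  have x_prod: "(\<Prod>i\<in>A. x i ^ k i) = Poly_Mapping.single (\<Sum>i\<in>A. Poly_Mapping.single (idx i) (k i)) 1" for A k
    by (induction A rule: infinite_finite_induct) (auto simp: x_power mult_single)
  have "Poly_Mapping.lookup (E m) (idx i) = Poly_Mapping.lookup m i" for m i
  proof -
    have "Poly_Mapping.lookup (E m) (idx i) = (\<Sum>j\<in>UNIV. if j = i then Poly_Mapping.lookup m j else 0)"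
      using idx by (auto simp: E_def lookup_sum lookup_single when_def inj_eq intro!: sum.cong)
    then show ?thesis by simp
  qed
  then have E: "E m = E m' \<longleftrightarrow> m = m'" for m m' by (metis poly_mapping_eqI)
  have "Poly_Mapping.lookup (poly_subst (Poly_Mapping.single 0) x p) (E m) = Poly_Mapping.lookup p m" for p :: "('k, 'n) poly_ring_elem" and m
  proof -
    have "Poly_Mapping.lookup (poly_subst (Poly_Mapping.single 0) x p) (E m) =
        (\<Sum>m'\<in>Poly_Mapping.keys p. if m' = m then Poly_Mapping.lookup p m' else 0)"
      unfolding poly_subst_def x_prod E_def[symmetric]
      by (auto simp: lookup_sum mult_single lookup_single when_def E intro!: sum.cong)
    then show ?thesis by (simp add: in_keys_iff)
  qed
  then have inj: "poly_subst (Poly_Mapping.single 0) x p = 0 \<longleftrightarrow> p = 0" for p :: "('k, 'n) poly_ring_elem"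
    by (metis lookup_zero poly_mapping_eqI s.poly_subst_zero)
  have "poly_subst (Poly_Mapping.single 0) x f * poly_subst (Poly_Mapping.single 0) x g = 0"
    unfolding s.poly_subst_mult[symmetric] assms by (rule s.poly_subst_zero)
  then show ?thesis using inj by simp
qed

section \<open>Linear forms and the ideals they generate\<close>

lemma lin_form_add: "lin_form (a + b) = lin_form a + lin_form b"
  by (simp add: lin_form_def const_add distrib_right sum.distrib)

lemma lin_form_scale: "lin_form (c *s a) = const c * lin_form a"
  unfolding lin_form_def sum_distrib_left by (simp add: const_mult mult.assoc)

lemma lin_form_zero [simp]: "lin_form 0 = 0"
  by (simp add: lin_form_def)

lemma lin_form_diff: "lin_form (a - b) = lin_form a - lin_form b"
  using lin_form_add[of "a - b" b] by simp

lemma lin_form_axis: "lin_form (axis i 1) = var i"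
proof -
  have "lin_form (axis i 1) = (\<Sum>j\<in>UNIV. if j = i then var j else 0)"
    unfolding lin_form_def by (intro sum.cong) (auto simp: axis_def)
  then show ?thesis by simp
qed

lemma partial_zero [simp]: "partial i 0 = 0"
  by (simp add: partial_def)

lemma partial_sum: "partial i (sum F A) = (\<Sum>x\<in>A. partial i (F x))"
  by (induction A rule: infinite_finite_induct) (auto simp: partial_add)

lemma partial_lin_form: "partial i (lin_form a) = const (a $ i)"
proof -
  have "partial i (lin_form a) = (\<Sum>j\<in>UNIV. if j = i then const (a $ j) else 0)"
    unfolding lin_form_def partial_sum by (intro sum.cong) (auto simp: partial_mult partial_var)
  then show ?thesis by simp
qed

lemma lin_form_eq_0_iff: "lin_form a = 0 \<longleftrightarrow> a = 0"
proof
  assume "lin_form a = 0"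
  then have "partial i (lin_form a) = const 0" for i by simp
  then show "a = 0" unfolding partial_lin_form const_eq_iff by (simp add: vec_eq_iff)
qed simp

lemma lin_form_span: "a \<in> vec.span T \<Longrightarrow> lin_form a \<in> self.span (lin_form ` T)"
proof (induction rule: vec.span_induct_alt)
  case (step c x y)
  then show ?case
    by (simp add: lin_form_add lin_form_scale self.span_add self.span_scale self.span_base)
qed (simp add: self.span_zero)

lemma vec_linear_components:
  assumes "Vector_Spaces.linear (*s) (*s) p"
  shows "p (a :: 'k::field ^ 'n::finite) = (\<Sum>i\<in>UNIV. a $ i *s p (axis i 1))"
proof -
  interpret p: Vector_Spaces.linear "(*s)" "(*s)" p by fact
  have "a = (\<Sum>i\<in>UNIV. a $ i *s axis i 1)" by (simp add: basis_expansion)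
  then have "p a = p (\<Sum>i\<in>UNIV. a $ i *s axis i 1)" by simp
  also have "\<dots> = (\<Sum>i\<in>UNIV. a $ i *s p (axis i 1))" by (simp add: p.sum p.scale)
  finally show ?thesis .
qed

lemma lin_form_sum: "lin_form (sum F A) = (\<Sum>x\<in>A. lin_form (F x))"
  by (induction A rule: infinite_finite_induct) (auto simp: lin_form_add)

text \<open>An ideal generated by linear forms is the kernel of a substitution induced by a linear
  projection, so linear independence yields regularity.\<close>

lemma lin_form_regular:
  fixes b :: "'k::field ^ 'n::finite"
  assumes "b \<notin> vec.span T" "lin_form b * s \<in> self.span (lin_form ` T)"
  shows "s \<in> self.span (lin_form ` T)"
proof -
  obtain B where B: "B \<subseteq> T" "vec.independent B" "T \<subseteq> vec.span B" using vec.maximal_independent_subset by blast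
  obtain C where C: "B \<subseteq> C" "vec.independent C" "UNIV \<subseteq> vec.span C"
    by (rule vec.maximal_independent_subset_extend[OF subset_UNIV B(2)])
  \<comment> \<open>\<open>p\<close> projects along the span of \<open>T\<close> onto the span of
    the remaining basis vectors.\<close>
  obtain p where p: "Vector_Spaces.linear (*s) (*s) p" "\<And>x. x \<in> C \<Longrightarrow> p x = (if x \<in> B then 0 else x)"
    using vec.linear_independent_extend[OF C(2), of "\<lambda>x. if x \<in> B then 0 else x"] by blast
  interpret p: Vector_Spaces.linear "(*s)" "(*s)" p by fact
  have BT: "vec.span B = vec.span T"
    using vec.span_mono[OF B(1)] vec.span_minimal[OF B(3) vec.subspace_span] by auto
  have diff: "v - p v \<in> vec.span T" for v
  proof -
    have "v \<in> vec.span C" using C(3) by auto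
    then show ?thesis unfolding BT[symmetric]
    proof (induction rule: vec.span_induct_alt)
      case (step c x y)
      have "c *s x + y - p (c *s x + y) = c *s (x - p x) + (y - p y)"
        by (simp add: p.add p.scale vec.scale_right_diff_distrib)
      moreover have "x - p x \<in> vec.span B" using p(2)[OF step(1)] by (auto simp: vec.span_base vec.span_zero)
      ultimately show ?case using step by (metis vec.span_add vec.span_scale)
    qed (simp add: vec.span_zero)
  qed
  have "p x = 0" if "x \<in> B" for x using p(2)[of x] that C(1) by auto
  then have pB: "p x = 0" if "x \<in> vec.span T" for x
    using that unfolding BT[symmetric] by (rule p.eq_0_on_span)
  define \<phi> where "\<phi> = poly_subst const (\<lambda>i. lin_form (p (axis i 1)))"
  have \<phi>_lin: "\<phi> (lin_form a) = lin_form (p a)" for a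
    unfolding \<phi>_def lin_form_def[of a] const.poly_subst_sum
    by (subst vec_linear_components[OF p(1)]) (simp add: lin_form_sum lin_form_scale const.poly_subst_mult const.poly_subst_const const.poly_subst_var)
  let ?Q = "self.span (lin_form ` T)"
  \<comment> \<open>\<phi> is the identity modulo \<open>?Q\<close>. As \<phi> also vanishes on
    \<open>?Q\<close>, this ideal is exactly its kernel.\<close>
  have \<phi>_diff: "\<phi> f - f \<in> ?Q" for f
  proof -
    have m: "\<phi> (f * g) - f * g \<in> ?Q" if "\<phi> f - f \<in> ?Q" "\<phi> g - g \<in> ?Q" for f g
    proof -
      have "\<phi> (f * g) - f * g = \<phi> f * (\<phi> g - g) + g * (\<phi> f - f)" by (simp add: \<phi>_def const.poly_subst_mult algebra_simps)
      then show ?thesis using that by (simp add: self.span_add self.span_scale)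
    qed
    have "\<phi> (const 1) = const 1" unfolding \<phi>_def by (rule const.poly_subst_const)
    then have one: "\<phi> 1 - 1 \<in> ?Q" by (simp add: self.span_zero)
    have v: "\<phi> (var i) - var i \<in> ?Q" for i
    proof -
      have "\<phi> (var i) - var i = - lin_form (axis i 1 - p (axis i 1))"
        by (simp add: \<phi>_def const.poly_subst_var lin_form_diff lin_form_axis)
      then show ?thesis using lin_form_span[OF diff] by (metis self.span_neg)
    qed
    have pow: "\<phi> (var i ^ k) - var i ^ k \<in> ?Q" for i k
      by (induction k) (auto intro: m one v)
    have pr: "\<phi> (\<Prod>i\<in>A. var i ^ k i) - (\<Prod>i\<in>A. var i ^ k i) \<in> ?Q" for A k
      by (induction A rule: infinite_finite_induct) (auto intro: m one pow)
    show ?thesis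
    proof (induction f rule: poly_add_induct)
      case (1 m c)
      have "\<phi> (const c) - const c \<in> ?Q" by (simp add: \<phi>_def const.poly_subst_const self.span_zero)
      then show ?case unfolding single_eq_prod_var by (rule m) (rule pr)
    next
      case (2 f g)
      have "\<phi> (f + g) - (f + g) = (\<phi> f - f) + (\<phi> g - g)" by (simp add: \<phi>_def const.poly_subst_add)
      then show ?case using 2 by (metis self.span_add)
    qed
  qed
  have \<phi>_zero: "\<phi> x = 0" if "x \<in> ?Q" for x
    using that
  proof (induction rule: self.span_induct_alt)
    case (step c x y)
    then obtain t where "t \<in> T" "x = lin_form t" by auto
    then have "\<phi> x = 0" using \<phi>_lin[of t] pB[of t] by (simp add: vec.span_base)
    then show ?case using step by (simp add: \<phi>_def const.poly_subst_add const.poly_subst_mult)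
  qed (simp add: \<phi>_def const.poly_subst_zero)
  \<comment> \<open>Otherwise b = b - p b would lie in the span of \<open>T\<close>.\<close>
  have "p b \<noteq> 0" using diff[of b] assms(1) by auto
  then have "\<phi> (lin_form b) \<noteq> 0" by (simp add: \<phi>_lin lin_form_eq_0_iff)
  moreover have "\<phi> (lin_form b) * \<phi> s = 0" using \<phi>_zero[OF assms(2)] by (simp add: \<phi>_def const.poly_subst_mult)
  ultimately have "\<phi> s = 0" using poly_no_zero_divisors by blast
  then show ?thesis using \<phi>_diff[of s] self.span_neg by fastforce
qed

lemma lin_form_power_regular:
  fixes b :: "'k::field ^ 'n::finite"
  assumes "b \<notin> vec.span T" "lin_form b ^ N * s \<in> self.span (lin_form ` T)"
  shows "s \<in> self.span (lin_form ` T)"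
  using assms(2)
proof (induction N)
  case (Suc N)
  then show ?case using lin_form_regular[OF assms(1), of "lin_form b ^ N * s"] by (simp add: mult.assoc)
qed simp

text \<open>\<open>T\<close> collects the forms already divided out. Each form enters first with
  exponent 1, so the ideals that occur are generated by linear forms and regularity is linear
  algebra; \<open>koszul_exact_power\<close> then raises it to the exponent
  \<open>N\<close>.\<close>

lemma koszul_exact_lin_forms:
  fixes bs :: "('k::field ^ 'n::finite) list"
  assumes "vec.independent (T \<union> set bs)" "distinct bs" "T \<inter> set bs = {}" "i < int (length bs)"
  shows "koszul_exact (map (\<lambda>b. lin_form b ^ N) bs) (self.span (lin_form ` T)) i"
  using assms
proof (induction bs arbitrary: T i)
  case Nil
  show ?case unfolding koszul_exact_def
  proof (intro allI impI exI[of _ "\<lambda>_. 0"] conjI)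
    fix f :: "bool list \<Rightarrow> ('k, 'n) poly_ring_elem" and l
    assume "cochain (length (map (\<lambda>b. lin_form b ^ N) ([] :: ('k ^ 'n) list))) i f"
    then have "f l = 0" using Nil(4) by (auto simp: cochain_def)
    then show "f l - koszul (map (\<lambda>b. lin_form b ^ N) []) (\<lambda>_. 0) l \<in> self.span (lin_form ` T)"
      by (simp add: self.span_zero)
  qed (simp add: cochain_def)
next
  case (Cons b bs)
  have b: "b \<notin> vec.span T"
  proof -
    have "b \<notin> vec.span (T \<union> set (b # bs) - {b})" using Cons.prems(1) unfolding vec.dependent_def by auto
    then show ?thesis using vec.span_mono[of T "T \<union> set (b # bs) - {b}"] Cons.prems(3) by auto
  qed
  have "koszul_exact (lin_form b # map (\<lambda>b. lin_form b ^ N) bs) (self.span (lin_form ` T)) i"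
  proof (rule koszul_exact_Cons)
    show "koszul_exact (map (\<lambda>b. lin_form b ^ N) bs) (self.span (lin_form ` insert b T)) (i - 1)"
      using Cons.prems by (intro Cons.IH) auto
    show "self.span (lin_form ` T) \<subseteq> self.span (lin_form ` insert b T)" by (rule self.span_mono) auto
    show "lin_form b \<in> self.span (lin_form ` insert b T)" by (rule self.span_base) auto
    show "\<exists>s. x - s * lin_form b \<in> self.span (lin_form ` T)" if "x \<in> self.span (lin_form ` insert b T)" for x
      using that by (simp add: self.span_breakdown_eq)
  qed (auto intro: lin_form_regular[OF b])
  then show ?case by (simp add: koszul_exact_power)
qed

section \<open>Koszul exactness from projective dimension\<close>

lemma coord_ring_simps [simp]:
  "carrier coord_ring = UNIV" "mult coord_ring = (*)" "one coord_ring = 1" "zero coord_ring = 0" "add coord_ring = (+)"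
  by (simp_all add: coord_ring_def)

lemma a_inv_coord_ring [simp]: "\<ominus>\<^bsub>coord_ring\<^esub> x = - x"
proof -
  interpret cring "coord_ring :: ('k::field, 'n) poly_ring_elem ring" by (rule cring_coord_ring)
  show ?thesis by (rule minus_equality) simp_all
qed

lemma mod_koszul_free_module:
  assumes "b \<in> B"
  shows "mod_koszul coord_ring (free_module coord_ring B) ys f l b = koszul ys (\<lambda>l. f l b) l"
  by (induction ys arbitrary: f l) (auto simp: free_module_simps assms split: list.split)

text \<open>The complex splits into the coordinates of the free module. A coordinate in which the
  cocycle vanishes entirely gets the zero cochain, which keeps the supports finite.\<close>

lemma mod_koszul_exact_free_module:
  fixes ys :: "('k::field, 'n) poly_ring_elem list" and B :: "'b set"
  assumes "koszul_exact ys {0} i"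
  shows "mod_koszul_exact coord_ring (free_module coord_ring B) ys i"
  unfolding mod_koszul_exact_def
proof (intro allI impI)
  let ?F = "free_module (coord_ring :: ('k, 'n) poly_ring_elem ring) B"
  fix f assume f: "mod_cochain ?F (length ys) i f" "\<forall>l. mod_koszul coord_ring ?F ys f l = \<zero>\<^bsub>?F\<^esub>"
  have fc: "f l \<in> carrier ?F" for l using f(1) by (simp add: mod_cochain_def)
  have "\<exists>g. cochain (length ys) (i - 1) g \<and> (\<forall>l. koszul ys g l = f l b) \<and> ((\<forall>l. f l b = 0) \<longrightarrow> g = (\<lambda>_. 0))" if b: "b \<in> B" for b
  proof (cases "\<forall>l. f l b = 0")
    case True
    then show ?thesis by (intro exI[of _ "\<lambda>_. 0"]) (auto simp: cochain_def)
  next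
    case False
    have "cochain (length ys) i (\<lambda>l. f l b)" unfolding cochain_def
    proof (intro allI impI)
      fix l assume "f l b \<noteq> 0"
      then have "f l \<noteq> \<zero>\<^bsub>?F\<^esub>" using b by (auto simp: free_module_simps)
      then show "length l = length ys \<and> int (count_list l True) = i" using f(1) by (simp add: mod_cochain_def)
    qed
    moreover have "koszul ys (\<lambda>l. f l b) l = 0" for l
      using f(2) mod_koszul_free_module[OF b, of ys f l] b by (simp add: free_module_simps(2))
    ultimately have "\<exists>g. cochain (length ys) (i - 1) g \<and> (\<forall>l. f l b - koszul ys g l \<in> {0})"
      using assms unfolding koszul_exact_def by blast
    then show ?thesis using False by auto
  qed
  then obtain g where g: "\<And>b. b \<in> B \<Longrightarrow> cochain (length ys) (i - 1) (g b)" "\<And>b l. b \<in> B \<Longrightarrow> koszul ys (g b) l = f l b"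
    "\<And>b. b \<in> B \<Longrightarrow> (\<forall>l. f l b = 0) \<Longrightarrow> g b = (\<lambda>_. 0)" by metis
  define G where "G l = (\<lambda>b\<in>B. g b l)" for l
  \<comment> \<open>Only finitely many index lists carry nonzero values of \<open>f\<close>, and
    each value has finite support.\<close>
  have fin: "finite {b \<in> B. g b l \<noteq> 0}" for l
  proof (rule finite_subset)
    show "{b \<in> B. g b l \<noteq> 0} \<subseteq> (\<Union>l\<in>{l. length l = length ys}. {b \<in> B. f l b \<noteq> 0})"
    proof
      fix b assume "b \<in> {b \<in> B. g b l \<noteq> 0}"
      then have b: "b \<in> B" "g b \<noteq> (\<lambda>_. 0)" by auto
      then obtain l' where l': "f l' b \<noteq> 0" using g(3) by blast
      then have "f l' \<noteq> \<zero>\<^bsub>?F\<^esub>" using b by (auto simp: free_module_simps)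
      then have "length l' = length ys" using f(1) by (simp add: mod_cochain_def)
      then show "b \<in> (\<Union>l\<in>{l. length l = length ys}. {b \<in> B. f l b \<noteq> 0})" using b l' by blast
    qed
    have "finite {l. set l \<subseteq> (UNIV :: bool set) \<and> length l = length ys}" by (rule finite_lists_length_eq) simp
    then have "finite {l :: bool list. length l = length ys}" by simp
    then show "finite (\<Union>l\<in>{l. length l = length ys}. {b \<in> B. f l b \<noteq> 0})"
      using fc by (intro finite_UN_I) (auto simp: free_module_simps)
  qed
  have "mod_cochain ?F (length ys) (i - 1) G" unfolding mod_cochain_def
  proof (intro allI conjI impI)
    show "G l \<in> carrier ?F" for l
      using fin[of l] by (auto simp: G_def free_module_simps cong: conj_cong)
    fix l assume "G l \<noteq> \<zero>\<^bsub>?F\<^esub>"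
    then obtain b where "b \<in> B" "g b l \<noteq> 0" by (auto simp: G_def free_module_simps fun_eq_iff split: if_splits)
    then show "length l = length ys" "int (count_list l True) = i - 1"
      using g(1) by (auto simp: cochain_def)
  qed
  moreover have "mod_koszul coord_ring ?F ys G l = f l" for l
  proof -
    have "mod_koszul coord_ring ?F ys G l \<in> carrier ?F"
      using calculation by (intro mod_koszul_closed module_free_module cring_coord_ring) (auto simp: mod_cochain_def)
    then show ?thesis
      using fc[of l] mod_koszul_free_module[of _ B ys G l] g(2)
      by (intro extensionalityI[of _ B]) (auto simp: free_module_simps PiE_iff G_def)
  qed
  ultimately show "\<exists>g. mod_cochain ?F (length ys) (i - 1) g \<and> (\<forall>l. mod_koszul coord_ring ?F ys g l = f l)" by blast
qed

theorem mod_koszul_exact_lin_forms: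
  fixes bs :: "('k::field ^ 'n::finite) list"
  assumes "vec.independent (set bs)" "distinct bs"
    and "module coord_ring M" "pd coord_ring M \<le> enat n" "i + int n < int (length bs)"
  shows "mod_koszul_exact coord_ring M (map (\<lambda>b. lin_form b ^ N) bs) i"
proof (rule mod_koszul_exact_pd[OF _ _ assms(3,4,5)])
  fix B :: "(('k, 'n) poly_ring_elem + 'a) list set" and j
  assume "j < int (length bs)"
  then show "mod_koszul_exact coord_ring (free_module coord_ring B) (map (\<lambda>b. lin_form b ^ N) bs) j"
    using koszul_exact_lin_forms[of "{}" bs j N] assms(1,2) by (intro mod_koszul_exact_free_module) simp
qed simp

section \<open>Hyperplanes and linear forms\<close>

lemma ker_form_subspace: "vec.subspace (ker_form a)"
  unfolding vec.subspace_def ker_form_def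
  by (auto simp: distrib_left sum.distrib mult.left_commute simp flip: sum_distrib_left)

text \<open>The entries \<open>p (axis i 1) $ j\<close> form a point representing the functional
  that takes \<open>a\<close> to \<open>p a $ j\<close>. This turns linear maps, which can be
  prescribed on a basis, into points at which forms are evaluated.\<close>

lemma dual_vector:
  assumes "Vector_Spaces.linear (*s) (*s) p"
  shows "(\<Sum>i\<in>UNIV. (a :: 'k::field ^ 'n::finite) $ i * p (axis i 1) $ j) = p a $ j"
  by (subst vec_linear_components[OF assms, of a]) simp

text \<open>By duality: if \<open>b\<close> were outside the span of \<open>T\<close>, some
  functional would vanish on \<open>T\<close> but not at \<open>b\<close>, and the point
  representing it would lie in every \<open>ker_form a\<close> with a in \<open>T\<close> but not in
  \<open>ker_form b\<close>.\<close>

lemma in_span_if_ker_form: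
  fixes b :: "'k::field ^ 'n::finite"
  assumes "(\<Inter>a\<in>T. ker_form a) \<subseteq> ker_form b"
  shows "b \<in> vec.span T"
proof (rule ccontr)
  assume b: "b \<notin> vec.span T"
  obtain B where B: "B \<subseteq> T" "vec.independent B" "T \<subseteq> vec.span B" using vec.maximal_independent_subset by blast
  have "vec.span B = vec.span T"
    using vec.span_mono[OF B(1)] vec.span_minimal[OF B(3) vec.subspace_span] by auto
  then have "vec.independent (insert b B)" using b B(2) by (simp add: vec.independent_insertI)
  \<comment> \<open>A linear map with values in one coordinate line serves as a functional;
    \<open>undefined\<close> is just some index.\<close>
  then obtain p where p: "Vector_Spaces.linear (*s) (*s) p" "\<And>x. x \<in> insert b B \<Longrightarrow> p x = (if x = b then axis undefined 1 else 0 :: 'k ^ 'n)"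
    using vec.linear_independent_extend[of "insert b B" "\<lambda>x. if x = b then axis undefined 1 else 0 :: 'k ^ 'n"] by blast
  interpret p: Vector_Spaces.linear "(*s)" "(*s)" p by fact
  have "p a = 0" if "a \<in> vec.span B" for a
    by (rule p.eq_0_on_span[OF _ that]) (use p(2) b \<open>vec.span B = vec.span T\<close> in \<open>auto simp: vec.span_base\<close>)
  then have pT: "p a = 0" if "a \<in> T" for a using that B(3) by auto
  define v where "v = (\<chi> i. p (axis i 1) $ (undefined :: 'n))"
  have v: "(\<Sum>i\<in>UNIV. a $ i * v $ i) = p a $ undefined" for a
    using dual_vector[OF p(1), of a undefined] by (simp add: v_def)
  have "v \<in> (\<Inter>a\<in>T. ker_form a)" using v pT by (simp add: ker_form_def)
  moreover have "v \<notin> ker_form b" using v[of b] p(2)[of b] by (simp add: ker_form_def axis_def)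
  ultimately show False using assms by blast
qed

lemma dim_Int_ker_form:
  assumes "vec.subspace S"
  shows "vec.dim S \<le> vec.dim (S \<inter> ker_form a) + 1"
proof (cases "S \<subseteq> ker_form a")
  case True
  then show ?thesis by (simp add: Int_absorb2)
next
  case False
  let ?d = "\<lambda>v. \<Sum>i\<in>UNIV. a $ i * v $ i"
  obtain s where s: "s \<in> S" "?d s \<noteq> 0" using False by (auto simp: ker_form_def)
  have lin: "?d (v - c *s s) = ?d v - c * ?d s" for v c
    by (simp add: right_diff_distrib sum_subtractf sum_distrib_left mult.left_commute)
  have "S \<subseteq> vec.span (insert s (S \<inter> ker_form a))"
  proof
    fix v assume v: "v \<in> S"
    have "v - (?d v / ?d s) *s s \<in> S \<inter> ker_form a"
      using v s assms lin[of v "?d v / ?d s"] by (auto simp: ker_form_def vec.subspace_diff vec.subspace_scale)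
    then show "v \<in> vec.span (insert s (S \<inter> ker_form a))"
      unfolding vec.span_breakdown_eq by (auto intro: vec.span_base)
  qed
  then have "vec.dim S \<le> vec.dim (insert s (S \<inter> ker_form a))" by (rule vec.dim_mono)
  also have "\<dots> \<le> vec.dim (S \<inter> ker_form a) + 1" by (simp add: vec.dim_insert)
  finally show ?thesis .
qed

lemma dim_Inter_ker_form:
  assumes "finite B"
  shows "vec.dim (UNIV :: ('k::field ^ 'n::finite) set) \<le> vec.dim (\<Inter>a\<in>B. ker_form a :: ('k ^ 'n) set) + card B"
  using assms
proof (induction B)
  case (insert a B)
  have "vec.dim (\<Inter>a\<in>B. ker_form a :: ('k ^ 'n) set) \<le> vec.dim ((\<Inter>a\<in>B. ker_form a) \<inter> ker_form a) + 1"
    by (rule dim_Int_ker_form) (intro vec.subspace_Inter; auto simp: ker_form_subspace)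
  then show ?case using insert by (simp add: Int_commute)
qed simp

text \<open>A functional that vanishes on \<open>L\<close> but not at some point outside has a
  kernel between \<open>L\<close> and the whole space, and the dimensions leave only
  \<open>L\<close>.\<close>

lemma hyperplane_ker_form:
  fixes L :: "('k::field ^ 'n::finite) set"
  assumes "vec.subspace L" "codim_in UNIV L = 1"
  shows "\<exists>a. ker_form a = L"
proof -
  have dim: "vec.dim L + 1 = vec.dim (UNIV :: ('k ^ 'n) set)" using assms(2) by (simp add: codim_in_def)
  then have "L \<noteq> UNIV" by auto
  then obtain b where b: "b \<notin> L" by auto
  obtain B where B: "B \<subseteq> L" "vec.independent B" "L \<subseteq> vec.span B" using vec.maximal_independent_subset by blast
  have sB: "vec.span B = L" using B vec.span_minimal[OF B(1) assms(1)] by auto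
  then have "vec.independent (insert b B)" using b B(2) by (simp add: vec.independent_insertI)
  then obtain p where p: "Vector_Spaces.linear (*s) (*s) p" "\<And>x. x \<in> insert b B \<Longrightarrow> p x = (if x = b then axis undefined 1 else 0 :: 'k ^ 'n)"
    using vec.linear_independent_extend[of "insert b B" "\<lambda>x. if x = b then axis undefined 1 else 0 :: 'k ^ 'n"] by blast
  interpret p: Vector_Spaces.linear "(*s)" "(*s)" p by fact
  have pL: "p a = 0" if "a \<in> L" for a
    by (rule p.eq_0_on_span[of B]) (use p(2) b B that in auto)
  define v where "v = (\<chi> i. p (axis i 1) $ (undefined :: 'n))"
  have v: "(\<Sum>i\<in>UNIV. v $ i * a $ i) = p a $ undefined" for a
    using dual_vector[OF p(1), of a undefined] by (simp add: v_def mult.commute)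
  have L: "L \<subseteq> ker_form v" using v pL by (auto simp: ker_form_def)
  have "b \<notin> ker_form v" using v[of b] p(2)[of b] by (simp add: ker_form_def axis_def)
  then have "vec.dim (ker_form v) \<noteq> vec.dim (UNIV :: ('k ^ 'n) set)"
    using vec.subspace_dim_equal[OF ker_form_subspace vec.subspace_UNIV, of v] by auto
  then have "vec.dim (ker_form v) \<le> vec.dim L"
    using vec.dim_subset[of "ker_form v" UNIV] dim by simp
  then show ?thesis using vec.subspace_dim_equal[OF assms(1) ker_form_subspace L] by blast
qed

section \<open>Logarithmic derivations and reduction modulo a linear form\<close>

abbreviation dform :: "('k::field ^ 'n::finite) set \<Rightarrow> ('k, 'n) poly_ring_elem"
  where "dform \<equiv> def_form UNIV"

definition hyperplane :: "('k::field ^ 'n::finite) set \<Rightarrow> bool"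
  where "hyperplane L \<longleftrightarrow> vec.subspace L \<and> codim_in UNIV L = 1"

text \<open>The choice is the one made inside \<open>def_form UNIV\<close>, so that the form of
  \<open>L\<close> is literally \<open>lin_form (normal_vec L)\<close>.\<close>

definition normal_vec :: "('k::field ^ 'n::finite) set \<Rightarrow> 'k ^ 'n"
  where "normal_vec L = (SOME a. UNIV \<inter> ker_form a = L)"

lemma dform_normal_vec: "dform L = lin_form (normal_vec L)"
  by (simp add: def_form_def normal_vec_def)

lemma ker_normal_vec:
  assumes "hyperplane L"
  shows "ker_form (normal_vec L) = L"
proof -
  have "\<exists>a. UNIV \<inter> ker_form a = L" using hyperplane_ker_form[of L] assms unfolding hyperplane_def by simp
  then have "UNIV \<inter> ker_form (normal_vec L) = L" unfolding normal_vec_def by (rule someI_ex)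
  then show ?thesis by simp
qed

lemma dim_hyperplane: "hyperplane (L :: ('k::field ^ 'n::finite) set) \<Longrightarrow> vec.dim L + 1 = vec.dim (UNIV :: ('k ^ 'n) set)"
  unfolding hyperplane_def codim_in_def by arith

lemma hyperplane_subset_eq:
  assumes "hyperplane L" "hyperplane L'" "L \<subseteq> L'"
  shows "L = L'"
  using vec.subspace_dim_equal[of L L'] assms dim_hyperplane[of L] dim_hyperplane[of L'] by (simp add: hyperplane_def)

lemma normal_vec_nonzero: "hyperplane L \<Longrightarrow> normal_vec L \<noteq> 0"
proof
  assume L: "hyperplane L" "normal_vec L = 0"
  then have "L = UNIV" using ker_normal_vec[OF L(1)] by (simp add: ker_form_def)
  then show False using dim_hyperplane[OF L(1)] by simp
qed

lemma dform_nonzero: "hyperplane L \<Longrightarrow> dform L \<noteq> 0"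
  by (simp add: dform_normal_vec lin_form_eq_0_iff normal_vec_nonzero)

lemma ker_form_span_subset:
  assumes "b \<in> vec.span T" "v \<in> (\<Inter>a\<in>T. ker_form a)"
  shows "v \<in> ker_form b"
  using assms(1)
proof (induction rule: vec.span_induct_alt)
  case (step c x y)
  have "(\<Sum>i\<in>UNIV. (c *s x + y) $ i * v $ i) = c * (\<Sum>i\<in>UNIV. x $ i * v $ i) + (\<Sum>i\<in>UNIV. y $ i * v $ i)"
    by (simp add: distrib_right sum.distrib sum_distrib_left mult.assoc)
  then show ?case using step assms(2) by (simp add: ker_form_def)
qed (simp add: ker_form_def)

lemma normal_vec_not_in_span:
  assumes "hyperplane L" "hyperplane L'" "L \<noteq> L'"
  shows "normal_vec L' \<notin> vec.span {normal_vec L}"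
proof
  assume "normal_vec L' \<in> vec.span {normal_vec L}"
  from ker_form_span_subset[OF this] have "L \<subseteq> L'"
    using ker_normal_vec assms(1,2) by blast
  then show False using hyperplane_subset_eq assms by blast
qed

lemma in_span_singleton_iff_dvd: "x \<in> self.span {a} \<longleftrightarrow> a dvd (x :: 'a::comm_ring_1)"
  by (auto simp: self.span_singleton dvd_def mult.commute)

lemma lin_form_dvd_regular:
  assumes "b \<notin> vec.span {a}" "lin_form a dvd lin_form b ^ N * s"
  shows "lin_form a dvd s"
  using lin_form_power_regular[OF assms(1), of N s] assms(2) by (simp add: in_span_singleton_iff_dvd)

lemma dform_dvd_regular:
  assumes "hyperplane L" "hyperplane L'" "L \<noteq> L'" "dform L dvd dform L' * s"
  shows "dform L dvd s"
  using lin_form_dvd_regular[OF normal_vec_not_in_span[OF assms(1-3)], of 1 s] assms(4) by (simp add: dform_normal_vec)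

section \<open>Derivations and logarithmic derivations of the polynomial ring\<close>

lemma PIdl_coord_ring: "x \<in> PIdl\<^bsub>coord_ring\<^esub> a \<longleftrightarrow> a dvd x"
  by (auto simp: cgenideal_def dvd_def mult.commute)

lemma log_mod_carrier:
  "\<theta> \<in> carrier (log_mod \<A>) \<longleftrightarrow> \<theta> \<in> Der coord_ring const \<and> (\<forall>L\<in>\<A>. dform L dvd \<theta> (dform L))"
  by (simp add: log_mod_def log_der_def PIdl_coord_ring)

lemma log_mod_simps [simp]:
  "zero (log_mod \<A>) = (\<lambda>f. 0)" "add (log_mod \<A>) = (\<lambda>\<theta> \<eta> f. \<theta> f + \<eta> f)" "smult (log_mod \<A>) = (\<lambda>r \<theta> f. r * \<theta> f)"
  by (simp_all add: log_mod_def log_der_def restrict_UNIV)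

lemma module_log_mod: "module coord_ring (log_mod \<A>)"
  unfolding log_mod_def by (rule module_log_der) (simp_all add: cring_coord_ring)

lemma Der_add: "\<theta> \<in> Der coord_ring const \<Longrightarrow> \<theta> (f + g) = \<theta> f + \<theta> g"
  and Der_const_mult: "\<theta> \<in> Der coord_ring const \<Longrightarrow> \<theta> (const c * f) = const c * \<theta> f"
  and Der_mult: "\<theta> \<in> Der coord_ring const \<Longrightarrow> \<theta> (f * g) = f * \<theta> g + g * \<theta> f"
  unfolding Der_coord_ring_iff by blast+

lemma Der_0: "\<theta> \<in> Der coord_ring const \<Longrightarrow> \<theta> 0 = 0"
  using Der_add[of \<theta> 0 0] by simp

lemma Der_const: "\<theta> \<in> Der coord_ring const \<Longrightarrow> \<theta> (const c) = 0"
  using Der_mult[of \<theta> 1 1] Der_const_mult[of \<theta> c 1] by simp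

lemma DerI:
  assumes "\<And>f g. \<theta> (f + g) = \<theta> f + \<theta> g" "\<And>c f. \<theta> (const c * f) = const c * \<theta> f"
    and "\<And>f g. \<theta> (f * g) = f * \<theta> g + g * \<theta> f"
  shows "\<theta> \<in> Der coord_ring const"
  using assms unfolding Der_coord_ring_iff by blast

lemma zero_in_Der: "(\<lambda>f. 0) \<in> Der coord_ring const"
  and add_in_Der: "\<theta> \<in> Der coord_ring const \<Longrightarrow> \<eta> \<in> Der coord_ring const \<Longrightarrow> (\<lambda>f. \<theta> f + \<eta> f) \<in> Der coord_ring const"
  and smult_in_Der: "\<theta> \<in> Der coord_ring const \<Longrightarrow> (\<lambda>f. r * \<theta> f) \<in> Der coord_ring const"
  and diff_in_Der: "\<theta> \<in> Der coord_ring const \<Longrightarrow> \<eta> \<in> Der coord_ring const \<Longrightarrow> (\<lambda>f. \<theta> f - \<eta> f) \<in> Der coord_ring const"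
  by (rule DerI; simp add: Der_add Der_mult Der_const algebra_simps)+

lemma Der_lin_form_add: "\<theta> \<in> Der coord_ring const \<Longrightarrow> \<theta> (lin_form (c *s a + b)) = const c * \<theta> (lin_form a) + \<theta> (lin_form b)"
  by (simp add: lin_form_add lin_form_scale Der_add Der_const_mult)

text \<open>The preimage of \<open>D(\<A>\<^sup>H)\<close> under reduction modulo the linear form of \<open>H\<close>.\<close>

definition rel_log :: "('k::field ^ 'n::finite) set set \<Rightarrow> ('k ^ 'n) set \<Rightarrow> (('k, 'n) poly_ring_elem \<Rightarrow> ('k, 'n) poly_ring_elem) set"
  where "rel_log \<A> H = {\<theta> \<in> Der coord_ring const. dform H dvd \<theta> (dform H) \<and>
    (\<forall>L\<in>\<A> - {H}. \<theta> (dform L) \<in> self.span {dform H, dform L})}"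

lemma rel_log_mono: "\<B> \<subseteq> \<A> \<Longrightarrow> rel_log \<A> H \<subseteq> rel_log \<B> H"
  by (auto simp: rel_log_def)

lemma log_mod_subset_rel_log:
  assumes "H \<in> \<A>"
  shows "carrier (log_mod \<A>) \<subseteq> rel_log \<A> H"
proof
  fix \<theta> assume \<theta>: "\<theta> \<in> carrier (log_mod \<A>)"
  have "\<theta> (dform L) \<in> self.span {dform H, dform L}" if "L \<in> \<A>" for L
  proof -
    have "\<theta> (dform L) \<in> self.span {dform L}" using \<theta> that by (simp add: log_mod_carrier in_span_singleton_iff_dvd)
    then show ?thesis using self.span_mono[of "{dform L}" "{dform H, dform L}"] by auto
  qed
  then show "\<theta> \<in> rel_log \<A> H" using \<theta> assms by (auto simp: rel_log_def log_mod_carrier)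
qed

subsection \<open>The coordinate ring of a hyperplane\<close>

lemma hyp_ideal: "ideal (hyp_ideal H) coord_ring"
  unfolding hyp_ideal_def by (intro cring.cgenideal_ideal cring_coord_ring) simp

lemma cring_coord_ring_in: "cring (coord_ring_in H)"
  unfolding coord_ring_in_def by (intro ideal.quotient_is_cring hyp_ideal cring_coord_ring)

lemma reduce_mod_ring_hom: "reduce_mod H \<in> ring_hom coord_ring (coord_ring_in H)"
  using ideal.rcos_ring_hom[OF hyp_ideal, of H] unfolding coord_ring_in_def reduce_mod_def[abs_def] .

lemma carrier_coord_ring_in: "carrier (coord_ring_in H) = range (reduce_mod H)"
  unfolding coord_ring_in_def FactRing_def A_RCOSETS_def' reduce_mod_def[abs_def] by auto

lemma reduce_mod_closed: "reduce_mod H f \<in> carrier (coord_ring_in H)"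
  by (simp add: carrier_coord_ring_in)

lemma reduce_mod_add: "reduce_mod H f \<oplus>\<^bsub>coord_ring_in H\<^esub> reduce_mod H g = reduce_mod H (f + g)"
  and reduce_mod_mult: "reduce_mod H f \<otimes>\<^bsub>coord_ring_in H\<^esub> reduce_mod H g = reduce_mod H (f * g)"
  and reduce_mod_1: "\<one>\<^bsub>coord_ring_in H\<^esub> = reduce_mod H 1"
  using ring_hom_add[OF reduce_mod_ring_hom, of f g H] ring_hom_mult[OF reduce_mod_ring_hom, of f g H]
    ring_hom_one[OF reduce_mod_ring_hom, of H] by simp_all

lemma reduce_mod_0: "\<zero>\<^bsub>coord_ring_in H\<^esub> = reduce_mod H 0"
  using ring_hom_zero[OF reduce_mod_ring_hom cring.axioms(1)[OF cring_coord_ring] cring.axioms(1)[OF cring_coord_ring_in], of H] by simp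

lemma reduce_mod_eq_iff: "reduce_mod H f = reduce_mod H g \<longleftrightarrow> dform H dvd f - g"
proof -
  have mem: "g \<in> hyp_ideal H \<longleftrightarrow> dform H dvd g" for g
    by (simp add: hyp_ideal_def PIdl_coord_ring)
  have coset: "reduce_mod H f = {g. dform H dvd g - f}" for f
  proof -
    have "reduce_mod H f = {h + f | h. h \<in> hyp_ideal H}"
      by (auto simp: reduce_mod_def a_r_coset_def r_coset_def)
    also have "\<dots> = {g. dform H dvd g - f}" unfolding mem by (auto, metis diff_add_cancel)
    finally show ?thesis .
  qed
  show ?thesis
  proof
    assume "reduce_mod H f = reduce_mod H g"
    moreover have "f \<in> reduce_mod H f" by (simp add: coset)
    ultimately show "dform H dvd f - g" by (simp add: coset)
  next
    assume *: "dform H dvd f - g"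
    have "dform H dvd h - f \<longleftrightarrow> dform H dvd h - g" for h
      using dvd_add[OF _ *, of "h - f"] dvd_diff[OF _ *, of "h - g"] by (auto simp: algebra_simps)
    then show "reduce_mod H f = reduce_mod H g" by (simp add: coset)
  qed
qed

lemma PIdl_coord_ring_in:
  "reduce_mod H f \<in> PIdl\<^bsub>coord_ring_in H\<^esub> (reduce_mod H g) \<longleftrightarrow> f \<in> self.span {dform H, g}"
proof -
  have "reduce_mod H f \<in> PIdl\<^bsub>coord_ring_in H\<^esub> (reduce_mod H g) \<longleftrightarrow> (\<exists>x. reduce_mod H f = reduce_mod H (x * g))"
    unfolding reduce_mod_mult[symmetric] cgenideal_def carrier_coord_ring_in by blast
  also have "\<dots> \<longleftrightarrow> (\<exists>x. f - x * g \<in> self.span {dform H})"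
    by (simp add: reduce_mod_eq_iff in_span_singleton_iff_dvd)
  also have "\<dots> \<longleftrightarrow> f \<in> self.span {g, dform H}" by (simp add: self.span_breakdown_eq)
  finally show ?thesis by (simp add: insert_commute)
qed

definition restricted_form :: "('k::field ^ 'n::finite) set \<Rightarrow> ('k ^ 'n) set \<Rightarrow> ('k, 'n) poly_ring_elem"
  where "restricted_form H L = def_form H (H \<inter> L)"

text \<open>The defining form of \<open>H \<inter> L\<close> in \<open>H\<close> agrees with that of \<open>L\<close> only up to a scalar and modulo
  the form of \<open>H\<close>.\<close>

lemma restricted_form_span:
  assumes "hyperplane H" "hyperplane L"
  obtains b where "restricted_form H L = lin_form b" "b \<in> vec.span {normal_vec H, normal_vec L}" "normal_vec L \<in> vec.span {normal_vec H, b}"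
proof
  let ?b = "SOME a. H \<inter> ker_form a = H \<inter> L"
  show "restricted_form H L = lin_form ?b" by (simp add: restricted_form_def def_form_def)
  have "H \<inter> ker_form (normal_vec L) = H \<inter> L" by (simp add: ker_normal_vec assms)
  then have b: "H \<inter> ker_form ?b = H \<inter> L" by (rule someI)
  show "?b \<in> vec.span {normal_vec H, normal_vec L}"
    by (rule in_span_if_ker_form) (use b in \<open>auto simp: ker_normal_vec assms\<close>)
  show "normal_vec L \<in> vec.span {normal_vec H, ?b}"
    by (rule in_span_if_ker_form) (use b in \<open>auto simp: ker_normal_vec assms\<close>)
qed

lemma Der_span:
  assumes "\<theta> \<in> Der coord_ring const" "b \<in> vec.span {a, c}" "\<theta> (lin_form a) \<in> self.span Q" "\<theta> (lin_form c) \<in> self.span Q"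
  shows "\<theta> (lin_form b) \<in> self.span Q"
  using assms(2)
proof (induction rule: vec.span_induct_alt)
  case (step r x y)
  then show ?case using assms(1,3,4) by (auto simp: Der_lin_form_add self.span_add self.span_scale)
qed (simp add: Der_0 assms(1) self.span_zero)

lemma span_lin_form_eq:
  assumes "b \<in> vec.span {a, c}" "c \<in> vec.span {a, b}"
  shows "self.span {lin_form a, lin_form b} = self.span {lin_form a, lin_form c}"
proof -
  have "lin_form b \<in> self.span {lin_form a, lin_form c}" "lin_form c \<in> self.span {lin_form a, lin_form b}"
    using lin_form_span[OF assms(1)] lin_form_span[OF assms(2)] by simp_all
  then show ?thesis by (auto simp: self.span_eq self.span_base)
qed

text \<open>This is why \<open>rel_log\<close> can be stated with the forms of the hyperplanes
  themselves: together with the form of \<open>H\<close> they generate the same ideals as the forms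
  chosen inside \<open>H\<close>.\<close>

lemma Der_restricted_form_iff:
  assumes "hyperplane H" "hyperplane L" "\<theta> \<in> Der coord_ring const" "dform H dvd \<theta> (dform H)"
  shows "\<theta> (restricted_form H L) \<in> self.span {dform H, restricted_form H L} \<longleftrightarrow> \<theta> (dform L) \<in> self.span {dform H, dform L}"
proof -
  obtain b where b: "restricted_form H L = lin_form b" "b \<in> vec.span {normal_vec H, normal_vec L}" "normal_vec L \<in> vec.span {normal_vec H, b}"
    using restricted_form_span[OF assms(1,2)] .
  have Q: "self.span {dform H, restricted_form H L} = self.span {dform H, dform L}"
    unfolding b(1) dform_normal_vec by (rule span_lin_form_eq[OF b(2,3)])
  have "\<theta> (dform H) \<in> self.span {dform H}" using assms(4) by (simp add: in_span_singleton_iff_dvd)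
  then have H: "\<theta> (lin_form (normal_vec H)) \<in> self.span {dform H, dform L}"
    using self.span_mono[of "{dform H}" "{dform H, dform L}"] by (auto simp: dform_normal_vec)
  show ?thesis unfolding Q
    using Der_span[OF assms(3) b(2) H] Der_span[OF assms(3) b(3) H] by (auto simp: b(1) dform_normal_vec[of L])
qed

subsection \<open>The Euler restriction map\<close>

text \<open>Only tangency to \<open>H\<close> matters, so the arrangement consisting of
  \<open>H\<close> alone is used.\<close>

lemma euler_restriction_apply:
  assumes "\<theta> \<in> Der coord_ring const" "dform H dvd \<theta> (dform H)"
  shows "euler_restriction H \<theta> (reduce_mod H f) = reduce_mod H (\<theta> f)"
  by (rule euler_restriction_reduce_mod[of H "{H}"]) (use assms in \<open>simp_all add: log_mod_carrier\<close>)

lemma euler_restriction_eq_iff: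
  assumes "\<theta> \<in> Der coord_ring const" "dform H dvd \<theta> (dform H)" "\<eta> \<in> Der coord_ring const" "dform H dvd \<eta> (dform H)"
  shows "euler_restriction H \<theta> = euler_restriction H \<eta> \<longleftrightarrow> (\<forall>f. dform H dvd \<theta> f - \<eta> f)"
proof
  assume "euler_restriction H \<theta> = euler_restriction H \<eta>"
  then show "\<forall>f. dform H dvd \<theta> f - \<eta> f"
    using euler_restriction_apply[OF assms(1,2)] euler_restriction_apply[OF assms(3,4)] by (metis reduce_mod_eq_iff)
next
  assume *: "\<forall>f. dform H dvd \<theta> f - \<eta> f"
  show "euler_restriction H \<theta> = euler_restriction H \<eta>"
  proof (rule extensionalityI[of _ "carrier (coord_ring_in H)"])
    fix G assume "G \<in> carrier (coord_ring_in H)"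
    then obtain f where "G = reduce_mod H f" by (auto simp: carrier_coord_ring_in)
    then show "euler_restriction H \<theta> G = euler_restriction H \<eta> G"
      using * by (simp add: euler_restriction_apply assms reduce_mod_eq_iff)
  qed (simp_all add: euler_restriction_def)
qed

lemma euler_restriction_Der:
  assumes "\<theta> \<in> Der coord_ring const" "dform H dvd \<theta> (dform H)"
  shows "euler_restriction H \<theta> \<in> Der (coord_ring_in H) (\<lambda>c. reduce_mod H (const c))"
proof -
  note e = euler_restriction_apply[OF assms]
  have "euler_restriction H \<theta> \<in> extensional (carrier (coord_ring_in H))" by (simp add: euler_restriction_def)
  then show ?thesis
    unfolding Der_def PiE_def carrier_coord_ring_in
    by (auto simp: e reduce_mod_add reduce_mod_mult Der_add[OF assms(1)] Der_const[OF assms(1)] Der_mult[OF assms(1)])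
qed

lemma log_mod_in_carrier:
  "\<phi> \<in> carrier (log_mod_in H (restriction \<A> H)) \<longleftrightarrow> \<phi> \<in> Der (coord_ring_in H) (\<lambda>c. reduce_mod H (const c)) \<and>
    (\<forall>L\<in>\<A> - {H}. \<phi> (reduce_mod H (restricted_form H L)) \<in> PIdl\<^bsub>coord_ring_in H\<^esub> (reduce_mod H (restricted_form H L)))"
  by (auto simp: log_mod_in_def log_der_def restriction_def restricted_form_def)

lemma euler_restriction_in_log_mod_in:
  assumes "hyperplane H" "\<And>L. L \<in> \<A> \<Longrightarrow> hyperplane L" "\<theta> \<in> Der coord_ring const" "dform H dvd \<theta> (dform H)"
  shows "euler_restriction H \<theta> \<in> carrier (log_mod_in H (restriction \<A> H)) \<longleftrightarrow> \<theta> \<in> rel_log \<A> H"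
  using Der_restricted_form_iff[OF assms(1) assms(2) assms(3,4)] assms(3,4)
  by (auto simp: log_mod_in_carrier euler_restriction_Der euler_restriction_apply PIdl_coord_ring_in rel_log_def)

text \<open>The images of the variables are lifted arbitrarily and define a derivation of S. Modulo
  the form of \<open>H\<close> it agrees with \<phi> on the variables and obeys the same rules,
  hence it agrees everywhere.\<close>

lemma euler_restriction_lift:
  fixes H :: "('k::field ^ 'n::finite) set"
  assumes "\<phi> \<in> Der (coord_ring_in H) (\<lambda>c. reduce_mod H (const c))"
  shows "\<exists>\<theta>\<in>Der coord_ring const. dform H dvd \<theta> (dform H) \<and> euler_restriction H \<theta> = \<phi>"
proof -
  have \<phi>_closed: "\<phi> (reduce_mod H f) \<in> range (reduce_mod H)" for f
    using assms reduce_mod_closed[of H f] by (auto simp: Der_def PiE_iff carrier_coord_ring_in)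
  have \<phi>_add: "\<phi> (reduce_mod H (f + g)) = \<phi> (reduce_mod H f) \<oplus>\<^bsub>coord_ring_in H\<^esub> \<phi> (reduce_mod H g)"
    and \<phi>_const: "\<phi> (reduce_mod H (const c * f)) = reduce_mod H (const c) \<otimes>\<^bsub>coord_ring_in H\<^esub> \<phi> (reduce_mod H f)"
    and \<phi>_mult: "\<phi> (reduce_mod H (f * g)) =
      reduce_mod H f \<otimes>\<^bsub>coord_ring_in H\<^esub> \<phi> (reduce_mod H g) \<oplus>\<^bsub>coord_ring_in H\<^esub> reduce_mod H g \<otimes>\<^bsub>coord_ring_in H\<^esub> \<phi> (reduce_mod H f)"
    for f g c
  proof -
    have "\<phi> (reduce_mod H f \<oplus>\<^bsub>coord_ring_in H\<^esub> reduce_mod H g) = \<phi> (reduce_mod H f) \<oplus>\<^bsub>coord_ring_in H\<^esub> \<phi> (reduce_mod H g)"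
      "\<phi> (reduce_mod H (const c) \<otimes>\<^bsub>coord_ring_in H\<^esub> reduce_mod H f) = reduce_mod H (const c) \<otimes>\<^bsub>coord_ring_in H\<^esub> \<phi> (reduce_mod H f)"
      "\<phi> (reduce_mod H f \<otimes>\<^bsub>coord_ring_in H\<^esub> reduce_mod H g) =
        reduce_mod H f \<otimes>\<^bsub>coord_ring_in H\<^esub> \<phi> (reduce_mod H g) \<oplus>\<^bsub>coord_ring_in H\<^esub> reduce_mod H g \<otimes>\<^bsub>coord_ring_in H\<^esub> \<phi> (reduce_mod H f)"
      using assms reduce_mod_closed unfolding Der_def by blast+
    then show "\<phi> (reduce_mod H (f + g)) = \<phi> (reduce_mod H f) \<oplus>\<^bsub>coord_ring_in H\<^esub> \<phi> (reduce_mod H g)"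
      "\<phi> (reduce_mod H (const c * f)) = reduce_mod H (const c) \<otimes>\<^bsub>coord_ring_in H\<^esub> \<phi> (reduce_mod H f)"
      "\<phi> (reduce_mod H (f * g)) =
        reduce_mod H f \<otimes>\<^bsub>coord_ring_in H\<^esub> \<phi> (reduce_mod H g) \<oplus>\<^bsub>coord_ring_in H\<^esub> reduce_mod H g \<otimes>\<^bsub>coord_ring_in H\<^esub> \<phi> (reduce_mod H f)"
      unfolding reduce_mod_add reduce_mod_mult by simp_all
  qed
  have "\<forall>i. \<exists>p. \<phi> (reduce_mod H (var i)) = reduce_mod H p" using \<phi>_closed by blast
  then obtain p where p: "\<And>i. \<phi> (reduce_mod H (var i)) = reduce_mod H (p i)" by metis
  define \<theta> where "\<theta> f = (\<Sum>i\<in>UNIV. p i * partial i f)" for f :: "('k, 'n) poly_ring_elem"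
  have \<theta>: "\<theta> \<in> Der coord_ring const" unfolding \<theta>_def[abs_def] by (rule sum_partial_Der)
  let ?P = "\<lambda>f. \<phi> (reduce_mod H f) = reduce_mod H (\<theta> f)"
  have m: "?P (f * g)" if "?P f" "?P g" for f g
    using that by (simp add: \<phi>_mult reduce_mod_add reduce_mod_mult Der_mult[OF \<theta>])
  have one: "?P 1"
  proof -
    obtain u where u: "\<phi> (reduce_mod H 1) = reduce_mod H u" using \<phi>_closed by blast
    then have "reduce_mod H u = reduce_mod H (u + u)"
      using \<phi>_mult[of 1 1] by (simp add: reduce_mod_add reduce_mod_mult)
    then have "dform H dvd u - (u + u)" by (simp only: reduce_mod_eq_iff)
    then have "reduce_mod H u = reduce_mod H 0" by (simp add: reduce_mod_eq_iff)
    moreover have "\<theta> 1 = 0" using Der_mult[OF \<theta>, of 1 1] by simp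
    ultimately show ?thesis using u by simp
  qed
  have v: "?P (var i)" for i
    by (simp add: p \<theta>_def partial_var if_distrib cong: if_cong)
  have pow: "?P (var i ^ k)" for i k
    by (induction k) (simp_all add: m one v)
  have pr: "?P (\<Prod>i\<in>A. var i ^ k i)" for A k
    by (induction A rule: infinite_finite_induct) (simp_all add: m one pow)
  have P: "?P f" for f
  proof (induction f rule: poly_add_induct)
    case (1 m c)
    show ?case unfolding single_eq_prod_var \<phi>_const pr by (simp add: reduce_mod_mult Der_const_mult[OF \<theta>])
  next
    case (2 f g)
    then show ?case by (simp add: \<phi>_add reduce_mod_add Der_add[OF \<theta>])
  qed
  \<comment> \<open>The form of \<open>H\<close> and 0 have the same class, so \<theta> must take
    this form into the ideal it generates.\<close>
  have "reduce_mod H (dform H) = reduce_mod H 0" by (simp add: reduce_mod_eq_iff)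
  then have "reduce_mod H (\<theta> (dform H)) = reduce_mod H (\<theta> 0)" by (metis P)
  then have H: "dform H dvd \<theta> (dform H)" by (simp add: reduce_mod_eq_iff Der_0[OF \<theta>])
  have "euler_restriction H \<theta> = \<phi>"
  proof (rule extensionalityI[of _ "carrier (coord_ring_in H)"])
    fix G assume "G \<in> carrier (coord_ring_in H)"
    then obtain f where "G = reduce_mod H f" by (auto simp: carrier_coord_ring_in)
    then show "euler_restriction H \<theta> G = \<phi> G" by (simp add: euler_restriction_apply[OF \<theta> H] P)
  next
    show "\<phi> \<in> extensional (carrier (coord_ring_in H))" using assms by (simp add: Der_def PiE_iff)
  qed (simp add: euler_restriction_def)
  then show ?thesis using \<theta> H by blast
qed

text \<open>Every element of \<open>D(\<A>\<^sup>H)\<close> is the restriction of an element of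
  \<open>rel_log\<close>, which turns surjectivity into a lifting problem among derivations of
  S.\<close>

lemma euler_restriction_surj_iff:
  assumes "H \<in> \<A>" "\<And>L. L \<in> \<A> \<Longrightarrow> hyperplane L"
  shows "euler_restriction H ` carrier (log_mod \<A>) = carrier (log_mod_in H (restriction \<A> H)) \<longleftrightarrow>
    (\<forall>\<theta>\<in>rel_log \<A> H. \<exists>\<eta>\<in>carrier (log_mod \<A>). \<forall>f. dform H dvd \<eta> f - \<theta> f)"
proof -
  note H = assms(2)[OF assms(1)]
  have D: "\<theta> \<in> Der coord_ring const" "dform H dvd \<theta> (dform H)" if "\<theta> \<in> rel_log \<A> H" for \<theta>
    using that by (auto simp: rel_log_def)
  have sub: "carrier (log_mod \<A>) \<subseteq> rel_log \<A> H" by (rule log_mod_subset_rel_log) fact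
  have img: "euler_restriction H ` rel_log \<A> H = carrier (log_mod_in H (restriction \<A> H))"
  proof (intro equalityI subsetI)
    fix \<phi> assume \<phi>: "\<phi> \<in> carrier (log_mod_in H (restriction \<A> H))"
    then obtain \<theta> where "\<theta> \<in> Der coord_ring const" "dform H dvd \<theta> (dform H)" "euler_restriction H \<theta> = \<phi>"
      using euler_restriction_lift[of \<phi> H] by (auto simp: log_mod_in_carrier)
    then show "\<phi> \<in> euler_restriction H ` rel_log \<A> H"
      using euler_restriction_in_log_mod_in[OF H assms(2)] \<phi> by blast
  qed (use D euler_restriction_in_log_mod_in[OF H assms(2)] in blast)
  have "euler_restriction H ` carrier (log_mod \<A>) = euler_restriction H ` rel_log \<A> H \<longleftrightarrow>
    (\<forall>\<theta>\<in>rel_log \<A> H. \<exists>\<eta>\<in>carrier (log_mod \<A>). euler_restriction H \<eta> = euler_restriction H \<theta>)"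
  proof -
    have "euler_restriction H ` carrier (log_mod \<A>) = euler_restriction H ` rel_log \<A> H \<longleftrightarrow>
      euler_restriction H ` rel_log \<A> H \<subseteq> euler_restriction H ` carrier (log_mod \<A>)"
      using image_mono[OF sub, of "euler_restriction H"] by blast
    then show ?thesis unfolding image_subset_iff image_iff by (metis (no_types))
  qed
  also have "\<dots> \<longleftrightarrow> (\<forall>\<theta>\<in>rel_log \<A> H. \<exists>\<eta>\<in>carrier (log_mod \<A>). \<forall>f. dform H dvd \<eta> f - \<theta> f)"
    using euler_restriction_eq_iff D sub by (meson subsetD)
  finally show ?thesis unfolding img .
qed

section \<open>Surjectivity of the Euler restriction map\<close>

text \<open>Surjectivity of the Euler restriction map in the form given by
  \<open>euler_restriction_surj_iff\<close>, free of the quotient ring.\<close>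

definition liftable :: "('k::field ^ 'n::finite) set set \<Rightarrow> ('k ^ 'n) set \<Rightarrow> bool"
  where "liftable \<A> H \<longleftrightarrow> (\<forall>\<theta>\<in>rel_log \<A> H. \<exists>\<eta>\<in>carrier (log_mod \<A>). \<forall>f. dform H dvd \<eta> f - \<theta> f)"

text \<open>Distinct hyperplanes have independent forms, so there are constant vector fields dual to
  them; \<psi> combines these with coefficients \<open>u\<close> and \<open>w\<close>.\<close>

lemma Der_with_values:
  assumes "hyperplane H" "hyperplane L" "H \<noteq> L"
  shows "\<exists>\<psi>\<in>Der coord_ring const. \<psi> (dform H) = u \<and> \<psi> (dform L) = w"
proof -
  have ex: "\<exists>v. (\<Sum>i\<in>UNIV. normal_vec H $ i * v $ i) = 1 \<and> (\<Sum>i\<in>UNIV. normal_vec L $ i * v $ i) = 0"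
    if HL: "hyperplane H" "hyperplane L" "H \<noteq> L" for H L :: "('a ^ 'b) set"
  proof -
    have "\<not> ker_form (normal_vec L) \<subseteq> ker_form (normal_vec H)"
      using normal_vec_not_in_span[of L H] in_span_if_ker_form[of "{normal_vec L}" "normal_vec H"] HL by auto
    then obtain v where v: "(\<Sum>i\<in>UNIV. normal_vec L $ i * v $ i) = 0" "(\<Sum>i\<in>UNIV. normal_vec H $ i * v $ i) \<noteq> 0" by (auto simp: ker_form_def)
    let ?c = "inverse (\<Sum>i\<in>UNIV. normal_vec H $ i * v $ i)"
    have "(\<Sum>i\<in>UNIV. a $ i * (?c *s v) $ i) = ?c * (\<Sum>i\<in>UNIV. a $ i * v $ i)" for a
      by (simp add: sum_distrib_left mult.left_commute)
    then show ?thesis using v by (intro exI[of _ "?c *s v"]) simp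
  qed
  obtain x where x: "(\<Sum>i\<in>UNIV. normal_vec H $ i * x $ i) = 1" "(\<Sum>i\<in>UNIV. normal_vec L $ i * x $ i) = 0"
    using ex[OF assms] by blast
  obtain y where y: "(\<Sum>i\<in>UNIV. normal_vec L $ i * y $ i) = 1" "(\<Sum>i\<in>UNIV. normal_vec H $ i * y $ i) = 0"
    using ex[OF assms(2,1) assms(3)[symmetric]] by blast
  define \<psi> where "\<psi> f = (\<Sum>i\<in>UNIV. (u * const (x $ i) + w * const (y $ i)) * partial i f)" for f
  have const_sum: "const (sum F A) = (\<Sum>i\<in>A. const (F i))" for F :: "'b \<Rightarrow> 'a" and A
    by (induction A rule: infinite_finite_induct) (auto simp: const_add)
  have "\<psi> (lin_form a) = u * const (\<Sum>i\<in>UNIV. a $ i * x $ i) + w * const (\<Sum>i\<in>UNIV. a $ i * y $ i)" for a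
    unfolding \<psi>_def const_sum sum_distrib_left sum.distrib[symmetric] partial_lin_form
    by (intro sum.cong) (simp_all add: const_mult algebra_simps)
  then have "\<psi> (dform H) = u" "\<psi> (dform L) = w" by (simp_all add: dform_normal_vec x y)
  moreover have "\<psi> \<in> Der coord_ring const" unfolding \<psi>_def[abs_def] by (rule sum_partial_Der)
  ultimately show ?thesis by blast
qed

lemma normal_vec_in_span:
  assumes "hyperplane H" "hyperplane L" "hyperplane M" "H \<inter> L \<subseteq> M"
  shows "normal_vec M \<in> vec.span {normal_vec H, normal_vec L}"
  by (rule in_span_if_ker_form) (use assms in \<open>auto simp: ker_normal_vec\<close>)

lemma liftable_singleton: "liftable {H} H"
  unfolding liftable_def
proof
  fix \<theta> assume "\<theta> \<in> rel_log {H} H"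
  then have "\<theta> \<in> carrier (log_mod {H})" by (simp add: rel_log_def log_mod_carrier)
  then show "\<exists>\<eta>\<in>carrier (log_mod {H}). \<forall>f. dform H dvd \<eta> f - \<theta> f" by (intro bexI[of _ \<theta>]) auto
qed

text \<open>A multiple of the form of \<open>H\<close> is added so that the result multiplies the
  forms of \<open>H\<close> and \<open>L\<close> by the same factor \<open>a\<close>. It then
  multiplies every form in their span by \<open>a\<close>, and all forms of the arrangement lie
  there.\<close>

lemma liftable_rank_2:
  assumes "\<And>M. M \<in> \<A> \<Longrightarrow> hyperplane M" "H \<in> \<A>" "L \<in> \<A>" "L \<noteq> H" "\<And>M. M \<in> \<A> \<Longrightarrow> H \<inter> L \<subseteq> M"
  shows "liftable \<A> H"
  unfolding liftable_def
proof
  fix \<theta> assume "\<theta> \<in> rel_log \<A> H"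
  then have \<theta>: "\<theta> \<in> Der coord_ring const" "dform H dvd \<theta> (dform H)" "\<theta> (dform L) \<in> self.span {dform L, dform H}"
    using assms by (auto simp: rel_log_def insert_commute)
  obtain h where h: "\<theta> (dform H) = dform H * h" using \<theta>(2) by (auto simp: dvd_def)
  obtain a where "\<theta> (dform L) - a * dform L \<in> self.span {dform H}" using \<theta>(3) by (auto simp: self.span_breakdown_eq)
  then obtain b where b: "\<theta> (dform L) = a * dform L + dform H * b"
    by (auto simp: in_span_singleton_iff_dvd dvd_def diff_eq_eq add.commute)
  \<comment> \<open>The values are dictated by h + \<psi>(\<alpha>_H) = a and b + \<psi>(\<alpha>_L)
    = 0.\<close>
  obtain \<psi> where \<psi>: "\<psi> \<in> Der coord_ring const" "\<psi> (dform H) = a - h" "\<psi> (dform L) = - b"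
    using Der_with_values[OF assms(1)[OF assms(2)] assms(1)[OF assms(3)], of "a - h" "- b"] assms(4) by auto
  define \<eta> where "\<eta> f = \<theta> f + dform H * \<psi> f" for f
  have \<eta>: "\<eta> \<in> Der coord_ring const" unfolding \<eta>_def[abs_def] by (intro add_in_Der smult_in_Der \<theta> \<psi>)
  have HL: "\<eta> (dform H) = a * dform H" "\<eta> (dform L) = a * dform L"
    by (simp_all add: \<eta>_def h b \<psi> algebra_simps)
  have e: "\<eta> (lin_form m) = a * lin_form m" if "m \<in> vec.span {normal_vec H, normal_vec L}" for m
    using that
  proof (induction rule: vec.span_induct_alt)
    case (step c x y)
    then have "\<eta> (lin_form x) = a * lin_form x" using HL by (auto simp: dform_normal_vec)
    then show ?case using step by (simp add: Der_lin_form_add[OF \<eta>]) (simp add: lin_form_add lin_form_scale algebra_simps)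
  qed (simp add: Der_0[OF \<eta>])
  have "\<eta> (dform M) = a * dform M" if "M \<in> \<A>" for M
    unfolding dform_normal_vec[of M] using assms that by (intro e normal_vec_in_span) auto
  then have "\<eta> \<in> carrier (log_mod \<A>)" using \<eta> by (simp add: log_mod_carrier)
  moreover have "dform H dvd \<eta> f - \<theta> f" for f by (simp add: \<eta>_def)
  ultimately show "\<exists>\<eta>\<in>carrier (log_mod \<A>). \<forall>f. dform H dvd \<eta> f - \<theta> f" by blast
qed

subsection \<open>Annihilators of the cokernel\<close>

definition coker_ann :: "('k::field ^ 'n::finite) set set \<Rightarrow> ('k ^ 'n) set \<Rightarrow> ('k, 'n) poly_ring_elem set"
  where "coker_ann \<A> H = {s. \<forall>\<theta>\<in>rel_log \<A> H. \<exists>\<eta>\<in>carrier (log_mod \<A>). \<forall>f. dform H dvd \<eta> f - s * \<theta> f}"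

lemma log_mod_add: "\<theta> \<in> carrier (log_mod \<A>) \<Longrightarrow> \<eta> \<in> carrier (log_mod \<A>) \<Longrightarrow> (\<lambda>f. \<theta> f + \<eta> f) \<in> carrier (log_mod \<A>)"
  and log_mod_smult: "\<theta> \<in> carrier (log_mod \<A>) \<Longrightarrow> (\<lambda>f. r * \<theta> f) \<in> carrier (log_mod \<A>)"
  and log_mod_zero: "(\<lambda>f. 0) \<in> carrier (log_mod \<A>)"
  by (simp_all add: log_mod_carrier add_in_Der smult_in_Der zero_in_Der)

lemma subspace_coker_ann: "self.subspace (coker_ann \<A> H)"
proof (rule self.subspaceI)
  show "0 \<in> coker_ann \<A> H" unfolding coker_ann_def by (auto intro: bexI[OF _ log_mod_zero])
next
  fix s t assume s: "s \<in> coker_ann \<A> H" and t: "t \<in> coker_ann \<A> H"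
  show "s + t \<in> coker_ann \<A> H" unfolding coker_ann_def
  proof (intro CollectI ballI)
    fix \<theta> assume "\<theta> \<in> rel_log \<A> H"
    then obtain \<eta> \<zeta> where e: "\<eta> \<in> carrier (log_mod \<A>)" "\<zeta> \<in> carrier (log_mod \<A>)"
      "\<And>f. dform H dvd \<eta> f - s * \<theta> f" "\<And>f. dform H dvd \<zeta> f - t * \<theta> f"
      using s t unfolding coker_ann_def by blast
    have "dform H dvd (\<eta> f + \<zeta> f) - (s + t) * \<theta> f" for f
      using dvd_add[OF e(3)[of f] e(4)[of f]] by (simp add: algebra_simps)
    then show "\<exists>\<eta>\<in>carrier (log_mod \<A>). \<forall>f. dform H dvd \<eta> f - (s + t) * \<theta> f"
      by (intro bexI[OF _ log_mod_add[OF e(1,2)]]) blast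
  qed
next
  fix r s assume s: "s \<in> coker_ann \<A> H"
  show "r * s \<in> coker_ann \<A> H" unfolding coker_ann_def
  proof (intro CollectI ballI)
    fix \<theta> assume "\<theta> \<in> rel_log \<A> H"
    then obtain \<eta> where e: "\<eta> \<in> carrier (log_mod \<A>)" "\<And>f. dform H dvd \<eta> f - s * \<theta> f"
      using s unfolding coker_ann_def by blast
    have "dform H dvd r * \<eta> f - (r * s) * \<theta> f" for f
      using dvd_mult[OF e(2)[of f], of r] by (simp add: algebra_simps)
    then show "\<exists>\<eta>\<in>carrier (log_mod \<A>). \<forall>f. dform H dvd \<eta> f - (r * s) * \<theta> f"
      by (intro bexI[OF _ log_mod_smult[OF e(1), of r]]) blast
  qed
qed

lemma dform_in_coker_ann: "dform H \<in> coker_ann \<A> H"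
  unfolding coker_ann_def by (auto intro!: bexI[OF _ log_mod_zero])

text \<open>A lift for the smaller arrangement becomes logarithmic for the larger one after
  multiplication by the missing forms.\<close>

lemma prod_in_coker_ann:
  assumes "finite \<A>" "\<B> \<subseteq> \<A>" "H \<in> \<B>" "liftable \<B> H"
  shows "(\<Prod>L\<in>\<A> - \<B>. dform L) \<in> coker_ann \<A> H"
  unfolding coker_ann_def
proof (intro CollectI ballI)
  fix \<theta> assume "\<theta> \<in> rel_log \<A> H"
  then have "\<theta> \<in> rel_log \<B> H" using rel_log_mono[OF assms(2)] by blast
  then obtain \<eta> where \<eta>: "\<eta> \<in> carrier (log_mod \<B>)" "\<And>f. dform H dvd \<eta> f - \<theta> f"
    using assms(4) unfolding liftable_def by blast
  let ?p = "\<Prod>L\<in>\<A> - \<B>. dform L"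
  have "(\<lambda>f. ?p * \<eta> f) \<in> carrier (log_mod \<A>)"
    unfolding log_mod_carrier
  proof (intro conjI ballI)
    show "(\<lambda>f. ?p * \<eta> f) \<in> Der coord_ring const" using \<eta>(1) by (simp add: log_mod_carrier smult_in_Der)
    fix L assume "L \<in> \<A>"
    then show "dform L dvd ?p * \<eta> (dform L)"
      using \<eta>(1) assms(1) by (cases "L \<in> \<B>") (auto simp: log_mod_carrier intro: dvd_mult dvd_mult2 dvd_prodI)
  qed
  moreover have "dform H dvd ?p * \<eta> f - ?p * \<theta> f" for f
    using dvd_mult[OF \<eta>(2)[of f], of ?p] by (simp add: right_diff_distrib)
  ultimately show "\<exists>\<eta>\<in>carrier (log_mod \<A>). \<forall>f. dform H dvd \<eta> f - ?p * \<theta> f"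
    by (intro bexI[of _ "\<lambda>f. ?p * \<eta> f"]) blast+
qed

text \<open>The radical of J + (g g') contains the intersection of the radicals of J + (g) and J +
  (g'), iterated over a finite product; the exponents add up.\<close>

lemma power_mod_prod:
  assumes "self.subspace J" "finite F" "\<And>x. x \<in> F \<Longrightarrow> \<exists>N s. \<beta> ^ N - s * g x \<in> J"
  shows "\<exists>N s. \<beta> ^ N - s * (\<Prod>x\<in>F. g x) \<in> J"
  using assms(2,3)
proof (induction F)
  case empty
  show ?case by (intro exI[of _ 0] exI[of _ 1]) (simp add: self.subspace_0[OF assms(1)])
next
  case (insert x F)
  obtain N s where 1: "\<beta> ^ N - s * (\<Prod>x\<in>F. g x) \<in> J" using insert by auto
  obtain M t where 2: "\<beta> ^ M - t * g x \<in> J" using insert.prems by blast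
  have "\<beta> ^ (M + N) - (s * t) * (\<Prod>x\<in>insert x F. g x) =
      \<beta> ^ M * (\<beta> ^ N - s * (\<Prod>x\<in>F. g x)) + (s * (\<Prod>x\<in>F. g x)) * (\<beta> ^ M - t * g x)"
    using insert.hyps by (simp add: power_add algebra_simps)
  also have "\<dots> \<in> J" using 1 2 by (intro self.subspace_add[OF assms(1)] self.subspace_scale[OF assms(1)])
  finally show ?case by blast
qed

text \<open>A power of every form vanishing on the center kills the cokernel, provided that all proper
  localizations along \<open>H\<close> are liftable: an elementary substitute for the statement that the cokernel
  is supported on the center.\<close>

lemma power_in_coker_ann:
  assumes "finite \<A>" "\<And>M. M \<in> \<A> \<Longrightarrow> hyperplane M" "H \<in> \<A>" "\<Inter>\<A> \<subseteq> ker_form b"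
    and loc: "\<And>T. T \<subseteq> \<A> \<Longrightarrow> H \<in> T \<Longrightarrow> \<Inter>T \<noteq> \<Inter>\<A> \<Longrightarrow> liftable (localization \<A> (\<Inter>T)) H"
  shows "\<exists>N. lin_form b ^ N \<in> coker_ann \<A> H"
proof -
  \<comment> \<open>Induction on the number of hyperplanes outside \<open>T\<close>, whose forms are
    adjoined to the annihilator. If \<open>T\<close> already cuts out the center, \<open>b\<close>
    is a combination of its normals. Otherwise the product of the forms outside the localization at
    \<open>\<Inter>T\<close> kills the cokernel, and adjoining any one factor is covered by the
    induction. For \<open>T = {H}\<close> nothing new is adjoined.\<close>
  have *: "\<exists>N. lin_form b ^ N \<in> self.span (coker_ann \<A> H \<union> dform ` T)" if "T \<subseteq> \<A>" "H \<in> T" for T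
    using that
  proof (induction "card (\<A> - T)" arbitrary: T rule: less_induct)
    case less
    let ?J = "self.span (coker_ann \<A> H \<union> dform ` T)"
    show ?case
    proof (cases "\<Inter>T = \<Inter>\<A>")
      case True
      have "b \<in> vec.span (normal_vec ` T)"
      proof (rule in_span_if_ker_form)
        have "\<forall>M\<in>T. ker_form (normal_vec M) = M" using ker_normal_vec assms(2) less.prems by blast
        then have "(\<Inter>a\<in>normal_vec ` T. ker_form a) = \<Inter>T" by simp
        then show "(\<Inter>a\<in>normal_vec ` T. ker_form a) \<subseteq> ker_form b" using True assms(4) by simp
      qed
      then have "lin_form b \<in> self.span (lin_form ` normal_vec ` T)" by (rule lin_form_span)
      also have "lin_form ` normal_vec ` T = dform ` T" by (simp add: image_image dform_normal_vec)
      also have "self.span (dform ` T) \<subseteq> ?J" by (rule self.span_mono) auto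
      finally show ?thesis by (intro exI[of _ 1]) simp
    next
      case False
      let ?B = "localization \<A> (\<Inter>T)"
      have B: "?B \<subseteq> \<A>" "T \<subseteq> ?B" using less.prems by (auto simp: localization_def)
      have "\<exists>N s. lin_form b ^ N - s * dform L \<in> ?J" if "L \<in> \<A> - ?B" for L
      proof -
        have L: "L \<in> \<A>" "L \<notin> T" using that B by auto
        have "card (\<A> - insert L T) < card (\<A> - T)"
          using L assms(1) by (intro psubset_card_mono) auto
        then obtain N where "lin_form b ^ N \<in> self.span (coker_ann \<A> H \<union> dform ` insert L T)"
          using less.hyps[of "insert L T"] L less.prems by blast
        then show ?thesis by (auto simp: self.span_breakdown_eq)
      qed
      then obtain N s where Ns: "lin_form b ^ N - s * (\<Prod>L\<in>\<A> - ?B. dform L) \<in> ?J"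
        using power_mod_prod[of ?J "\<A> - ?B" "lin_form b" dform] assms(1) by (auto simp: self.subspace_span)
      have "(\<Prod>L\<in>\<A> - ?B. dform L) \<in> coker_ann \<A> H"
        using B less.prems False by (intro prod_in_coker_ann assms(1) loc) auto
      then have "s * (\<Prod>L\<in>\<A> - ?B. dform L) \<in> ?J" by (intro self.span_scale self.span_base) auto
      from self.span_add[OF Ns this] show ?thesis by auto
    qed
  qed
  have "self.span (coker_ann \<A> H \<union> dform ` {H}) = coker_ann \<A> H"
    using dform_in_coker_ann[of H \<A>] subspace_coker_ann[of \<A> H] by (simp add: insert_absorb)
  then show ?thesis using *[of "{H}"] assms(3) by auto
qed

subsection \<open>The Koszul argument\<close>

lemma mod_koszul_log_mod: "mod_koszul coord_ring (log_mod \<A>) ys F l f = koszul ys (\<lambda>l. F l f) l"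
  by (induction ys arbitrary: F l) (auto split: list.split)

text \<open>The derivations of S are free on the partial derivatives.\<close>

lemma projective_log_mod_empty: "projective coord_ring (log_mod ({} :: ('k::field ^ 'n::finite) set set))"
proof -
  let ?M = "log_mod ({} :: ('k ^ 'n) set set)"
  let ?F = "free_module (coord_ring :: ('k, 'n) poly_ring_elem ring) (UNIV :: 'n set)"
  have c: "carrier ?M = Der coord_ring const" by (auto simp: log_mod_carrier)
  show ?thesis
  proof (rule projective_if_retract_free[OF module_log_mod])
    show "(\<lambda>\<theta> i. \<theta> (var i)) \<in> module_hom coord_ring ?M ?F"
      by (rule module_homI) (auto simp: free_module_simps)
    show "(\<lambda>p f. \<Sum>i\<in>UNIV. p i * partial i f) \<in> module_hom coord_ring ?F ?M"
      by (rule module_homI)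
        (auto simp: c sum_partial_Der free_module_simps distrib_right sum.distrib sum_distrib_left mult.assoc)
    fix \<theta> assume "\<theta> \<in> carrier ?M"
    then show "(\<lambda>f. \<Sum>i\<in>UNIV. \<theta> (var i) * partial i f) = \<theta>"
      unfolding c by (intro Der_eqI sum_partial_Der) (auto simp: partial_var if_distrib cong: if_cong)
  qed
qed

text \<open>A cochain of degree 0 has a single component. The index \<open>l\<close> marks the first
  occurrence of \<open>y\<close> only and does not depend on the cochain, so that two cochains can
  be compared at the same index.\<close>

lemma koszul_degree_0:
  assumes "y \<in> set ys"
  shows "\<exists>l. \<forall>F. cochain (length ys) 0 F \<longrightarrow> koszul ys F l = y * F (replicate (length ys) False)"
  using assms
proof (induction ys)
  case (Cons z ys)
  have F: "cochain (length ys) 0 (\<lambda>l. F (False # l))" if "cochain (length (z # ys)) 0 F" for F :: "bool list \<Rightarrow> 'a"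
    using cochain_split[of "length ys" 0 F] that by simp
  show ?case
  proof (cases "y = z")
    case True
    have "koszul (z # ys) F (True # replicate (length ys) False) = y * F (replicate (length (z # ys)) False)"
      if "cochain (length (z # ys)) 0 F" for F :: "bool list \<Rightarrow> 'a"
    proof -
      have "F (True # l) = 0" for l using that by (auto simp: cochain_def)
      then show ?thesis using True by simp
    qed
    then show ?thesis by blast
  next
    case False
    then obtain l where "\<forall>F. cochain (length ys) 0 F \<longrightarrow> koszul ys F l = y * F (replicate (length ys) False)"
      using Cons by auto
    then have "\<forall>F. cochain (length (z # ys)) 0 F \<longrightarrow> koszul (z # ys) F (False # l) = y * F (replicate (length (z # ys)) False)"
      using F by simp
    then show ?thesis by blast
  qed
qed simp

text \<open>For fixed \<open>u\<close> and \<open>l\<close> the boundary multiplies \<theta> by one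
  element of \<open>Q\<close>, the same for every \<open>f\<close>. With \<open>Q\<close> the
  annihilator of the cokernel, each entry of the boundary of \<theta> can be lifted.\<close>

lemma koszul_multiple:
  assumes "self.subspace Q" "set ys \<subseteq> Q"
  shows "\<exists>s\<in>Q. \<forall>f. koszul ys (\<lambda>l. u l * \<theta> f) l = s * \<theta> f"
  using assms(2)
proof (induction ys arbitrary: u l)
  case Nil
  then show ?case using self.subspace_0[OF assms(1)] by (intro bexI[of _ 0]) simp_all
next
  case (Cons y ys)
  show ?case
  proof (cases l)
    case Nil
    then show ?thesis using self.subspace_0[OF assms(1)] by (intro bexI[of _ 0]) simp_all
  next
    case l: (Cons b l')
    have IH: "\<exists>s\<in>Q. \<forall>f. koszul ys (\<lambda>l. u (c # l) * \<theta> f) l' = s * \<theta> f" for c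
      using Cons by simp
    show ?thesis
    proof (cases b)
      case True
      obtain s where s: "s \<in> Q" "\<And>f. koszul ys (\<lambda>l. u (True # l) * \<theta> f) l' = s * \<theta> f" using IH by blast
      have "u (False # l') * y - s \<in> Q"
        using s(1) Cons.prems by (intro self.subspace_diff self.subspace_scale assms(1)) auto
      moreover have "koszul (y # ys) (\<lambda>l. u l * \<theta> f) l = (u (False # l') * y - s) * \<theta> f" for f
        using True l s(2) by (simp add: algebra_simps)
      ultimately show ?thesis by blast
    next
      case False
      then show ?thesis using IH[of False] l by simp
    qed
  qed
qed

text \<open>Exactness of the Euler sequence in the middle: the form of \<open>H\<close> can be
  cancelled, and the quotient stays logarithmic along the other hyperplanes because their forms are
  coprime to that of \<open>H\<close>.\<close>

lemma log_mod_divide: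
  assumes "H \<in> \<A>" "\<And>M. M \<in> \<A> \<Longrightarrow> hyperplane M" "\<psi> \<in> carrier (log_mod \<A>)" "\<And>f. dform H dvd \<psi> f"
  shows "\<exists>\<zeta>\<in>carrier (log_mod (\<A> - {H})). \<forall>f. \<psi> f = dform H * \<zeta> f"
proof -
  have H: "dform H \<noteq> 0" by (rule dform_nonzero[OF assms(2)[OF assms(1)]])
  have cancel: "a = b" if "dform H * a = dform H * b" for a b
    using poly_no_zero_divisors[of "dform H" "a - b"] H that by (simp add: right_diff_distrib)
  obtain \<zeta> where \<zeta>: "\<And>f. \<psi> f = dform H * \<zeta> f" using assms(4) unfolding dvd_def by metis
  have \<psi>: "\<psi> \<in> Der coord_ring const" using assms(3) by (simp add: log_mod_carrier)
  have "\<zeta> \<in> Der coord_ring const"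
  proof (rule DerI; rule cancel)
    show "dform H * \<zeta> (f + g) = dform H * (\<zeta> f + \<zeta> g)" for f g
      using Der_add[OF \<psi>, of f g] by (simp add: \<zeta> distrib_left)
    show "dform H * \<zeta> (const c * f) = dform H * (const c * \<zeta> f)" for c f
      using Der_const_mult[OF \<psi>, of c f] by (simp add: \<zeta> mult.left_commute)
    show "dform H * \<zeta> (f * g) = dform H * (f * \<zeta> g + g * \<zeta> f)" for f g
      using Der_mult[OF \<psi>, of f g] by (simp add: \<zeta> distrib_left mult.left_commute)
  qed
  moreover have "dform L dvd \<zeta> (dform L)" if "L \<in> \<A> - {H}" for L
  proof (rule dform_dvd_regular[of L H])
    show "dform L dvd dform H * \<zeta> (dform L)"
      unfolding \<zeta>[symmetric] using that assms(3) by (simp add: log_mod_carrier)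
  qed (use that assms(1,2) in auto)
  ultimately have "\<zeta> \<in> carrier (log_mod (\<A> - {H}))" by (simp add: log_mod_carrier)
  then show ?thesis using \<zeta> by blast
qed

lemma log_mod_times:
  assumes "\<zeta> \<in> carrier (log_mod (\<A> - {H}))"
  shows "(\<lambda>f. dform H * \<zeta> f) \<in> carrier (log_mod \<A>)"
  using assms by (auto simp: log_mod_carrier smult_in_Der intro: dvd_mult)

text \<open>Lifting \<open>y \<theta>\<close> for each \<open>y\<close> in \<open>ys\<close> gives a 1-cochain \<open>\<eta>\<close>. Its boundary is the form of \<open>H\<close> times a
  2-cocycle of the deletion; since this cocycle is a boundary, \<open>\<eta>\<close> can be corrected to a cocycle, and
  hence to the boundary of a single derivation, which lifts \<open>\<theta>\<close>.\<close>

lemma liftable_if_koszul_exact: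
  fixes \<A> :: "('k::field ^ 'n::finite) set set"
  assumes \<A>: "\<And>M. M \<in> \<A> \<Longrightarrow> hyperplane M" "H \<in> \<A>"
    and bs: "vec.independent (set bs)" "distinct bs" "length bs \<ge> 2"
    and ys: "ys = map (\<lambda>b. lin_form b ^ N) bs" "set ys \<subseteq> coker_ann \<A> H"
    and ex: "mod_koszul_exact coord_ring (log_mod (\<A> - {H})) ys 2"
  shows "liftable \<A> H"
  unfolding liftable_def
proof
  fix \<theta> assume \<theta>: "\<theta> \<in> rel_log \<A> H"
  let ?n = "length ys" and ?D = "log_mod ({} :: ('k ^ 'n) set set)" and ?M = "log_mod \<A>" and ?M' = "log_mod (\<A> - {H})"
  have H: "hyperplane H" "dform H \<noteq> 0" using \<A> dform_nonzero by blast+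
  have cancel: "a = b" if "dform H * a = dform H * b" for a b
    using poly_no_zero_divisors[of "dform H" "a - b"] H(2) that by (simp add: right_diff_distrib)
  \<comment> \<open>Two independent vectors are not both proportional to a given one. So for each
    hyperplane the list contains a form whose powers can be cancelled modulo the form of the
    hyperplane.\<close>
  have sub: "\<exists>b\<in>set bs. b \<notin> vec.span {a}" for a
  proof (rule ccontr)
    assume "\<not> (\<exists>b\<in>set bs. b \<notin> vec.span {a})"
    then have "card (set bs) \<le> card {a}"
      by (intro conjunct2[OF vec.independent_span_bound] bs) auto
    then show False using bs distinct_card by fastforce
  qed
  define z where "z = replicate ?n False"
  define u where "u l = (if l = z then 1 else 0 :: ('k, 'n) poly_ring_elem)" for l
  define F where "F l f = u l * \<theta> f" for l f
  have "\<forall>l. \<exists>s\<in>coker_ann \<A> H. \<forall>f. koszul ys (\<lambda>l. F l f) l = s * \<theta> f"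
    unfolding F_def using koszul_multiple[OF subspace_coker_ann ys(2)] by blast
  then obtain S where S: "\<And>l. S l \<in> coker_ann \<A> H" "\<And>l f. koszul ys (\<lambda>l. F l f) l = S l * \<theta> f" by metis
  have u: "cochain ?n 0 u" by (auto simp: cochain_def u_def z_def split: if_splits)
  have Fc: "cochain ?n 0 (\<lambda>l. F l f)" for f using cochain_mult[OF u, of "\<theta> f"] by (simp add: F_def mult.commute)
  have dF: "cochain ?n 1 (koszul ys (\<lambda>l. F l f))" for f using cochain_koszul[OF Fc] by simp
  \<comment> \<open>Where the boundary of \<theta> vanishes the lift is taken to be 0, which makes
    \<eta> a cochain of degree 1.\<close>
  have "\<exists>\<eta>\<in>carrier ?M. (\<forall>f. dform H dvd \<eta> f - S l * \<theta> f) \<and> ((\<forall>f. S l * \<theta> f = 0) \<longrightarrow> \<eta> = (\<lambda>f. 0))" for l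
  proof (cases "\<forall>f. S l * \<theta> f = 0")
    case True
    then show ?thesis by (intro bexI[OF _ log_mod_zero]) auto
  next
    case False
    then show ?thesis using S(1)[of l] \<theta> unfolding coker_ann_def by blast
  qed
  then obtain \<eta> where \<eta>: "\<And>l. \<eta> l \<in> carrier ?M" "\<And>l f. dform H dvd \<eta> l f - S l * \<theta> f"
    "\<And>l. (\<forall>f. S l * \<theta> f = 0) \<Longrightarrow> \<eta> l = (\<lambda>f. 0)" by metis
  have \<eta>c: "mod_cochain ?M ?n 1 \<eta>"
    unfolding mod_cochain_def
  proof (intro allI conjI impI)
    fix l assume "\<eta> l \<noteq> \<zero>\<^bsub>?M\<^esub>"
    then obtain f where "S l * \<theta> f \<noteq> 0" using \<eta>(3) by auto
    then have "koszul ys (\<lambda>l. F l f) l \<noteq> 0" by (simp add: S(2))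
    then show "length l = ?n" "int (count_list l True) = 1" using dF[of f] by (auto simp: cochain_def)
  qed (rule \<eta>)
  have "mod_cochain ?M ?n (1 + 1) (mod_koszul coord_ring ?M ys \<eta>)"
    by (rule mod_cochain_koszul[OF module_log_mod _ \<eta>c]) simp
  then have d\<eta>c: "mod_cochain ?M ?n 2 (mod_koszul coord_ring ?M ys \<eta>)" by simp
  have d\<eta>: "dform H dvd mod_koszul coord_ring ?M ys \<eta> l f" for l f
  proof -
    have "koszul ys (\<lambda>l. \<eta> l f - koszul ys (\<lambda>l. F l f) l) l \<in> self.span {dform H}"
      by (rule koszul_in_ideal) (simp_all add: self.subspace_span in_span_singleton_iff_dvd S(2) \<eta>(2))
    then show ?thesis
      by (simp add: mod_koszul_log_mod koszul_diff koszul_koszul in_span_singleton_iff_dvd)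
  qed
  have "\<exists>\<zeta>\<in>carrier ?M'. \<forall>f. mod_koszul coord_ring ?M ys \<eta> l f = dform H * \<zeta> f" for l
    using d\<eta>c d\<eta> by (intro log_mod_divide \<A>) (auto simp: mod_cochain_def)
  then obtain \<zeta> where \<zeta>: "\<And>l. \<zeta> l \<in> carrier ?M'" "\<And>l f. mod_koszul coord_ring ?M ys \<eta> l f = dform H * \<zeta> l f" by metis
  have "mod_cochain ?M' ?n 2 \<zeta>"
    unfolding mod_cochain_def
  proof (intro allI conjI impI)
    fix l assume "\<zeta> l \<noteq> \<zero>\<^bsub>?M'\<^esub>"
    then obtain f where "\<zeta> l f \<noteq> 0" by (auto simp: fun_eq_iff)
    then have "mod_koszul coord_ring ?M ys \<eta> l \<noteq> \<zero>\<^bsub>?M\<^esub>"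
      using poly_no_zero_divisors[of "dform H" "\<zeta> l f"] H(2) \<zeta>(2)[of l f] by (auto simp: fun_eq_iff intro!: exI[of _ f])
    then show "length l = ?n" "int (count_list l True) = 2" using d\<eta>c by (auto simp: mod_cochain_def)
  qed (rule \<zeta>)
  moreover have "\<forall>l. mod_koszul coord_ring ?M' ys \<zeta> l = \<zero>\<^bsub>?M'\<^esub>"
  proof
    fix l
    have "dform H * koszul ys (\<lambda>l. \<zeta> l f) l = dform H * 0" for f
      using koszul_koszul[of ys "\<lambda>l. \<eta> l f" l] by (simp add: koszul_mult[symmetric] \<zeta>(2)[symmetric] mod_koszul_log_mod)
    then show "mod_koszul coord_ring ?M' ys \<zeta> l = \<zero>\<^bsub>?M'\<^esub>"
      using cancel by (auto simp: mod_koszul_log_mod fun_eq_iff)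
  qed
  ultimately obtain \<xi> where \<xi>: "mod_cochain ?M' ?n (2 - 1) \<xi>" "\<And>l. mod_koszul coord_ring ?M' ys \<xi> l = \<zeta> l"
    using ex unfolding mod_koszul_exact_def by blast
  have \<xi>c: "\<xi> l \<in> carrier ?M'" for l using \<xi>(1) by (simp add: mod_cochain_def)
  \<comment> \<open>Subtracting the form of \<open>H\<close> times the bounding cochain \<xi> turns
    \<eta> into a cocycle without changing it modulo that form.\<close>
  define \<tau> where "\<tau> l f = \<eta> l f + (- 1) * (dform H * \<xi> l f)" for l f
  have \<tau>M: "\<tau> l \<in> carrier ?M" for l
    unfolding \<tau>_def[abs_def] by (intro log_mod_add \<eta>(1) log_mod_smult log_mod_times \<xi>c)
  have "mod_cochain ?D ?n 1 \<tau>"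
    unfolding mod_cochain_def
  proof (intro allI conjI impI)
    fix l
    show "\<tau> l \<in> carrier ?D" using \<tau>M[of l] by (simp add: log_mod_carrier)
    assume "\<tau> l \<noteq> \<zero>\<^bsub>?D\<^esub>"
    then have "\<eta> l \<noteq> \<zero>\<^bsub>?M\<^esub> \<or> \<xi> l \<noteq> \<zero>\<^bsub>?M'\<^esub>" by (auto simp: \<tau>_def fun_eq_iff)
    then show "length l = ?n" "int (count_list l True) = 1" using \<eta>c \<xi>(1) by (auto simp: mod_cochain_def)
  qed
  moreover have "\<forall>l. mod_koszul coord_ring ?D ys \<tau> l = \<zero>\<^bsub>?D\<^esub>"
  proof -
    have "koszul ys (\<lambda>l. \<tau> l f) l = 0" for l f
    proof -
      have "koszul ys (\<lambda>l. \<tau> l f) l = koszul ys (\<lambda>l. \<eta> l f) l + (- 1) * (dform H * koszul ys (\<lambda>l. \<xi> l f) l)"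
        unfolding \<tau>_def koszul_add koszul_mult ..
      also have "koszul ys (\<lambda>l. \<eta> l f) l = dform H * koszul ys (\<lambda>l. \<xi> l f) l"
        using \<zeta>(2)[of l f] fun_cong[OF \<xi>(2)[of l], of f] by (simp add: mod_koszul_log_mod)
      finally show ?thesis by simp
    qed
    then show ?thesis by (auto simp: mod_koszul_log_mod fun_eq_iff)
  qed
  \<comment> \<open>The cocycle \<tau> is bounded in Der S, not yet in \<open>D(\<A>)\<close>: Der S
    is free, and degree 1 lies below the length of the sequence, which is at least 2.\<close>
  moreover have D: "projective coord_ring ?D" by (rule projective_log_mod_empty)
  have "pd coord_ring ?D \<le> enat 0"
    using pd_eq_0_iff[OF projective_module[OF D]] D by (simp flip: zero_enat_def)
  then have "mod_koszul_exact coord_ring ?D ys 1"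
    unfolding ys(1) using bs by (intro mod_koszul_exact_lin_forms[where n = 0] module_log_mod) auto
  ultimately obtain \<omega> where \<omega>: "mod_cochain ?D ?n (1 - 1) \<omega>" "\<And>l. mod_koszul coord_ring ?D ys \<omega> l = \<tau> l"
    unfolding mod_koszul_exact_def by blast
  have \<omega>D: "\<omega> l \<in> Der coord_ring const" for l using \<omega>(1) by (simp add: mod_cochain_def log_mod_carrier)
  have \<omega>c: "cochain ?n 0 (\<lambda>l. \<omega> l f)" for f using \<omega>(1) by (auto simp: mod_cochain_def cochain_def fun_eq_iff)
  \<comment> \<open>At the index marking \<open>b\<close>, the boundaries of \<omega> and of
    \<theta> are both multiplication by the power of \<open>b\<close>.\<close>
  have key: "\<exists>l. \<forall>f. lin_form b ^ N * \<omega> z f = \<tau> l f \<and> lin_form b ^ N * \<theta> f = S l * \<theta> f" if "b \<in> set bs" for b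
  proof -
    have "lin_form b ^ N \<in> set ys" using that by (simp add: ys(1))
    then obtain l where l: "\<And>G. cochain ?n 0 G \<Longrightarrow> koszul ys G l = lin_form b ^ N * G z"
      using koszul_degree_0[of "lin_form b ^ N" ys] unfolding z_def by blast
    have "\<tau> l f = lin_form b ^ N * \<omega> z f" "S l * \<theta> f = lin_form b ^ N * \<theta> f" for f
      using l[OF \<omega>c[of f]] l[OF Fc[of f], unfolded S(2)] fun_cong[OF \<omega>(2)[of l], of f]
      by (simp_all add: mod_koszul_log_mod F_def u_def)
    then show ?thesis by metis
  qed
  \<comment> \<open>A power of some \<open>b\<close> times \<omega> is logarithmic along
    \<open>L\<close>, and the power can be cancelled since \<open>b\<close> is not proportional to
    the normal of \<open>L\<close>.\<close>
  have "dform L dvd \<omega> z (dform L)" if "L \<in> \<A>" for L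
  proof -
    obtain b where b: "b \<in> set bs" "b \<notin> vec.span {normal_vec L}" using sub by blast
    obtain l where "lin_form b ^ N * \<omega> z (dform L) = \<tau> l (dform L)" using key[OF b(1)] by blast
    then have "lin_form (normal_vec L) dvd lin_form b ^ N * \<omega> z (dform L)"
      using \<tau>M[of l] that by (simp add: log_mod_carrier dform_normal_vec)
    then show ?thesis unfolding dform_normal_vec[of L] by (rule lin_form_dvd_regular[OF b(2)])
  qed
  then have "\<omega> z \<in> carrier ?M" using \<omega>D by (simp add: log_mod_carrier)
  moreover have "dform H dvd \<omega> z f - \<theta> f" for f
  proof -
    obtain b where b: "b \<in> set bs" "b \<notin> vec.span {normal_vec H}" using sub by blast
    obtain l where l: "lin_form b ^ N * \<omega> z f = \<tau> l f" "lin_form b ^ N * \<theta> f = S l * \<theta> f" using key[OF b(1)] by blast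
    have "lin_form b ^ N * (\<omega> z f - \<theta> f) = (\<eta> l f - S l * \<theta> f) - dform H * \<xi> l f"
      by (simp add: right_diff_distrib l \<tau>_def)
    also have "dform H dvd \<dots>" by (rule dvd_diff[OF \<eta>(2)]) simp
    finally show ?thesis unfolding dform_normal_vec[of H] by (rule lin_form_dvd_regular[OF b(2)])
  qed
  ultimately show "\<exists>\<eta>\<in>carrier ?M. \<forall>f. dform H dvd \<eta> f - \<theta> f" by blast
qed

subsection \<open>Induction over the flats\<close>

lemma arrangement_hyperplane: "arrangement \<A> \<Longrightarrow> L \<in> \<A> \<Longrightarrow> hyperplane L"
  by (simp add: arrangement_def hyperplane_def)

lemma flat_eq_Inter:
  assumes "X \<in> flats H (restriction \<A> H)" "H \<in> \<A>"
  shows "X = \<Inter>(localization \<A> X)" "H \<in> localization \<A> X"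
proof -
  obtain C where C: "C \<subseteq> restriction \<A> H" "X = H \<inter> \<Inter>C" using assms(1) by (auto simp: flats_def)
  show H: "H \<in> localization \<A> X" using C assms(2) by (auto simp: localization_def)
  have "v \<in> Y" if v: "v \<in> \<Inter>(localization \<A> X)" and Y: "Y \<in> C" for v Y
  proof -
    obtain L where L: "L \<in> \<A>" "Y = H \<inter> L" using Y C(1) by (auto simp: restriction_def)
    then have "X \<subseteq> L" using C(2) Y by auto
    then show ?thesis using L H v by (auto simp: localization_def)
  qed
  then have "\<Inter>(localization \<A> X) \<subseteq> X" using H unfolding C(2) by blast
  then show "X = \<Inter>(localization \<A> X)" by (auto simp: localization_def)
qed

lemma Inter_in_flats:
  assumes "T \<subseteq> \<A>" "H \<in> T"
  shows "\<Inter>T \<in> flats H (restriction \<A> H)"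
proof -
  have "\<Inter>T = H \<inter> \<Inter>{H \<inter> L | L. L \<in> T - {H}}" using assms(2) by auto
  moreover have "{H \<inter> L | L. L \<in> T - {H}} \<subseteq> restriction \<A> H" using assms(1) by (auto simp: restriction_def)
  ultimately show ?thesis unfolding flats_def by blast
qed

lemma liftable_localization:
  fixes \<A> :: "('k::field ^ 'n::finite) set set"
  assumes \<A>: "arrangement \<A>" "H \<in> \<A>"
    and surj: "locally_surjective_codim_three \<A> H" and NMPD: "deletion_NMPD \<A> H"
    and "X \<in> flats H (restriction \<A> H)"
  shows "liftable (localization \<A> X) H"
  using assms(5)
proof (induction "codim_in H X" arbitrary: X rule: less_induct)
  case less
  let ?B = "localization \<A> X"
  note X = flat_eq_Inter[OF less.prems \<A>(2)]
  have BA: "?B \<subseteq> \<A>" by (auto simp: localization_def)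
  have hyp: "hyperplane L" if "L \<in> ?B" for L using arrangement_hyperplane[OF \<A>(1)] that BA by auto
  have sub: "vec.subspace (\<Inter>T)" if "T \<subseteq> \<A>" for T
    using arrangement_hyperplane[OF \<A>(1)] that by (intro vec.subspace_Inter) (auto simp: hyperplane_def)
  have XH: "X \<subseteq> H" using X(2) by (auto simp: localization_def)
  have H: "hyperplane H" by (rule arrangement_hyperplane[OF \<A>])
  consider "codim_in H X \<le> 1" | "codim_in H X = 2" | "codim_in H X \<ge> 3" by linarith
  then show ?case
  proof cases
    case 1
    show ?thesis
    proof (cases "?B = {H}")
      case True
      then show ?thesis by (simp add: liftable_singleton)
    next
      case False
      then obtain L where L: "L \<in> ?B" "L \<noteq> H" using X(2) by blast
      \<comment> \<open>\<open>X\<close> lies in \<open>H \<inter> L\<close>, a proper subspace of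
        \<open>H\<close>, so codimension at most 1 forces \<open>X\<close> to equal it: the
        localization has rank 2.\<close>
      have "H \<inter> L \<noteq> H" using hyperplane_subset_eq[OF H hyp[OF L(1)]] L(2) by auto
      moreover have sHL: "vec.subspace (H \<inter> L)" using H hyp[OF L(1)] by (simp add: hyperplane_def vec.subspace_inter)
      ultimately have "\<not> vec.dim H \<le> vec.dim (H \<inter> L)"
        using vec.subspace_dim_equal[of "H \<inter> L" H] H by (auto simp: hyperplane_def)
      then have "vec.dim (H \<inter> L) \<le> vec.dim X" using 1 by (simp add: codim_in_def)
      moreover have "X \<subseteq> H \<inter> L" using XH L(1) by (auto simp: localization_def)
      ultimately have "X = H \<inter> L" using vec.subspace_dim_equal[OF _ sHL] sub[OF BA] X(1) by simp
      then show ?thesis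
        using hyp X(2) L by (intro liftable_rank_2[of _ H L]) (auto simp: localization_def)
    qed
  next
    case 2
    then have "euler_restriction H ` carrier (log_mod ?B) = carrier (log_mod_in H (restriction ?B H))"
      using surj less.prems by (simp add: locally_surjective_codim_three_def)
    then show ?thesis
      unfolding liftable_def using euler_restriction_surj_iff[OF X(2) hyp] by blast
  next
    case 3
    \<comment> \<open>A basis of the span of the normals supplies at least as many independent forms
      as the codimension of \<open>X\<close> in the whole space.\<close>
    obtain B0 where B0: "B0 \<subseteq> normal_vec ` ?B" "vec.independent B0" "normal_vec ` ?B \<subseteq> vec.span B0"
      using vec.maximal_independent_subset by blast
    have fin: "finite ?B" using \<A>(1) BA by (auto simp: arrangement_def intro: finite_subset)
    then have finB0: "finite B0" using B0(1) finite_subset by blast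
    obtain bs where bs: "set bs = B0" "distinct bs" using finite_distinct_list[OF finB0] by blast
    have "(\<Inter>a\<in>B0. ker_form a) \<subseteq> X"
    proof
      fix v assume v: "v \<in> (\<Inter>a\<in>B0. ker_form a)"
      have "v \<in> L" if "L \<in> ?B" for L
        using ker_form_span_subset[OF _ v, of "normal_vec L"] B0(3) ker_normal_vec[OF hyp[OF that]] that by auto
      then show "v \<in> X" using X(1) by auto
    qed
    then have "vec.dim (\<Inter>a\<in>B0. ker_form a) \<le> vec.dim X" by (rule vec.dim_subset)
    then have len: "vec.dim (UNIV :: ('k ^ 'n) set) \<le> vec.dim X + length bs"
      using dim_Inter_ker_form[OF finB0] distinct_card[OF bs(2)] bs(1) by simp
    have "\<exists>N. lin_form b ^ N \<in> coker_ann ?B H" if "b \<in> set bs" for b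
    proof (rule power_in_coker_ann[OF fin hyp X(2)])
      show "\<Inter>?B \<subseteq> ker_form b" using that B0(1) bs(1) ker_normal_vec[OF hyp] by auto
      fix T assume T: "T \<subseteq> ?B" "H \<in> T" "\<Inter>T \<noteq> \<Inter>?B"
      have TA: "T \<subseteq> \<A>" using T(1) BA by auto
      have XT: "X \<subseteq> \<Inter>T" using X(1) T(1) by auto
      have loc: "localization ?B (\<Inter>T) = localization \<A> (\<Inter>T)" using XT by (auto simp: localization_def)
      have "\<not> vec.dim (\<Inter>T) \<le> vec.dim X"
        using vec.subspace_dim_equal[OF _ sub[OF TA] XT] sub[OF BA] X(1) T(3) by auto
      moreover have "vec.dim (\<Inter>T) \<le> vec.dim H" by (rule vec.dim_subset) (use T(2) in auto)
      ultimately have "codim_in H (\<Inter>T) < codim_in H X" by (simp add: codim_in_def)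
      then show "liftable (localization ?B (\<Inter>T)) H"
        unfolding loc using less.hyps Inter_in_flats[OF TA T(2)] by simp
    qed
    then obtain f where f: "\<And>b. b \<in> set bs \<Longrightarrow> lin_form b ^ f b \<in> coker_ann ?B H" by metis
    \<comment> \<open>A common exponent: the sum bounds every \<open>f b\<close>, and the
      annihilator is an ideal.\<close>
    define N where "N = (\<Sum>b\<in>set bs. f b)"
    have ys: "set (map (\<lambda>b. lin_form b ^ N) bs) \<subseteq> coker_ann ?B H"
    proof -
      have "lin_form b ^ N \<in> coker_ann ?B H" if "b \<in> set bs" for b
      proof -
        have "f b \<le> N" unfolding N_def using that by (intro member_le_sum) auto
        then have "lin_form b ^ N = lin_form b ^ (N - f b) * lin_form b ^ f b" by (simp flip: power_add)
        then show ?thesis using self.subspace_scale[OF subspace_coker_ann f[OF that]] by simp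
      qed
      then show ?thesis by auto
    qed
    let ?c = "codim_in UNIV X"
    have c: "?c = codim_in H X + 1" using dim_hyperplane[OF H] vec.dim_subset[OF XH] by (simp add: codim_in_def)
    have "localization (\<A> - {H}) X = ?B - {H}" by (auto simp: localization_def)
    then have "pd coord_ring (log_mod (?B - {H})) < enat (?c - 2)"
      using NMPD less.prems 3 by (auto simp: deletion_NMPD_def pd_arr_def)
    \<comment> \<open>Degree 2 is now in range: n0 + 2 < ?c, and ?c is at most the length of
      \<open>bs\<close>.\<close>
    then obtain n0 where n0: "pd coord_ring (log_mod (?B - {H})) = enat n0" "n0 < ?c - 2"
      by (cases "pd coord_ring (log_mod (?B - {H}))") auto
    have "?c \<le> length bs" using len by (simp add: codim_in_def)
    then have "mod_koszul_exact coord_ring (log_mod (?B - {H})) (map (\<lambda>b. lin_form b ^ N) bs) 2"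
      using n0 bs B0(2) by (intro mod_koszul_exact_lin_forms[where n = n0] module_log_mod) auto
    then show ?thesis
      using hyp X(2) B0(2) bs ys \<open>?c \<le> length bs\<close> c 3
      by (intro liftable_if_koszul_exact[where bs = bs and N = N, OF _ _ _ _ _ refl]) auto
  qed
qed

theorem euler_restriction_surj:
  assumes "arrangement \<A>" "H \<in> \<A>" "locally_surjective_codim_three \<A> H" "deletion_NMPD \<A> H"
  shows "euler_restriction H ` carrier (log_mod \<A>) = carrier (log_mod_in H (restriction \<A> H))"
proof -
  \<comment> \<open>The center is the flat whose localization is the whole arrangement.\<close>
  have "localization \<A> (\<Inter>\<A>) = \<A>" by (auto simp: localization_def)
  then have "liftable \<A> H"
    using liftable_localization[OF assms Inter_in_flats[OF subset_refl assms(2)]] by simp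
  then show ?thesis
    unfolding liftable_def using euler_restriction_surj_iff[OF assms(2) arrangement_hyperplane[OF assms(1)]] by blast
qed

section \<open>The Euler sequence\<close>

lemma module_log_mod_in: "module (coord_ring_in H) (log_mod_in H \<B>)"
  unfolding log_mod_in_def by (rule module_log_der) (auto simp: cring_coord_ring_in reduce_mod_closed)

lemma log_mod_in_simps:
  "zero (log_mod_in H \<B>) = (\<lambda>f\<in>carrier (coord_ring_in H). \<zero>\<^bsub>coord_ring_in H\<^esub>)"
  "add (log_mod_in H \<B>) \<theta> \<eta> = (\<lambda>f\<in>carrier (coord_ring_in H). \<theta> f \<oplus>\<^bsub>coord_ring_in H\<^esub> \<eta> f)"
  "smult (log_mod_in H \<B>) r \<theta> = (\<lambda>f\<in>carrier (coord_ring_in H). r \<otimes>\<^bsub>coord_ring_in H\<^esub> \<theta> f)"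
  by (simp_all add: log_mod_in_def log_der_def)

text \<open>\<delta> is the partial derivative in a variable that occurs in the form of
  \<open>H\<close>, scaled so that this form goes to 1; the characteristic does not matter.\<close>

lemma hypersurface_quotient_coord_ring:
  fixes H :: "('k::field ^ 'n::finite) set"
  assumes "hyperplane H"
  shows "\<exists>\<delta>. hypersurface_quotient coord_ring (coord_ring_in H) (reduce_mod H) (dform H) \<delta>"
proof -
  obtain p where p: "normal_vec H $ p \<noteq> 0" using normal_vec_nonzero[OF assms] by (auto simp: vec_eq_iff)
  define \<delta> where "\<delta> f = reduce_mod H (const (inverse (normal_vec H $ p)) * partial p f)" for f
  have "hypersurface_quotient coord_ring (coord_ring_in H) (reduce_mod H) (dform H) \<delta>"
  proof (rule hypersurface_quotient.intro)
    show "reduce_mod H (dform H) = \<zero>\<^bsub>coord_ring_in H\<^esub>" by (simp add: reduce_mod_0 reduce_mod_eq_iff)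
    show "\<exists>q\<in>carrier coord_ring. r = dform H \<otimes>\<^bsub>coord_ring\<^esub> q" if "reduce_mod H r = \<zero>\<^bsub>coord_ring_in H\<^esub>" for r
      using that by (simp add: reduce_mod_0 reduce_mod_eq_iff dvd_def)
    show "r = \<zero>\<^bsub>coord_ring\<^esub>" if "dform H \<otimes>\<^bsub>coord_ring\<^esub> r = \<zero>\<^bsub>coord_ring\<^esub>" for r
      using that poly_no_zero_divisors[of "dform H" r] dform_nonzero[OF assms] by auto
    show "\<delta> (r \<oplus>\<^bsub>coord_ring\<^esub> s) = \<delta> r \<oplus>\<^bsub>coord_ring_in H\<^esub> \<delta> s" for r s
      by (simp add: \<delta>_def reduce_mod_add partial_add distrib_left)
    show "\<delta> (r \<otimes>\<^bsub>coord_ring\<^esub> s) = reduce_mod H r \<otimes>\<^bsub>coord_ring_in H\<^esub> \<delta> s \<oplus>\<^bsub>coord_ring_in H\<^esub> reduce_mod H s \<otimes>\<^bsub>coord_ring_in H\<^esub> \<delta> r" for r s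
      by (simp add: \<delta>_def reduce_mod_add reduce_mod_mult partial_mult distrib_left mult.left_commute)
    show "\<delta> (dform H) = \<one>\<^bsub>coord_ring_in H\<^esub>"
      using p by (simp add: \<delta>_def dform_normal_vec partial_lin_form reduce_mod_1 flip: const_mult)
  qed (auto simp: cring_coord_ring cring_coord_ring_in reduce_mod_ring_hom carrier_coord_ring_in \<delta>_def)
  then show ?thesis by blast
qed

lemma euler_restriction_hom:
  assumes "arrangement \<A>" "H \<in> \<A>"
  shows "euler_restriction H \<in> module_hom coord_ring (log_mod \<A>)
    (restrict_scalars (reduce_mod H) (log_mod_in H (restriction \<A> H)))"
proof (rule module_homI)
  note hyp = arrangement_hyperplane[OF assms(1)]
  have D: "\<theta> \<in> Der coord_ring const" "dform H dvd \<theta> (dform H)" if "\<theta> \<in> carrier (log_mod \<A>)" for \<theta>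
    using that assms(2) by (auto simp: log_mod_carrier)
  note e = euler_restriction_apply[OF D]
  {
    fix \<theta> assume \<theta>: "\<theta> \<in> carrier (log_mod \<A>)"
    then show "euler_restriction H \<theta> \<in> carrier (restrict_scalars (reduce_mod H) (log_mod_in H (restriction \<A> H)))"
      using euler_restriction_in_log_mod_in[OF hyp[OF assms(2)] hyp D[OF \<theta>]] log_mod_subset_rel_log[OF assms(2)] by auto
    show "euler_restriction H (r \<odot>\<^bsub>log_mod \<A>\<^esub> \<theta>) = r \<odot>\<^bsub>restrict_scalars (reduce_mod H) (log_mod_in H (restriction \<A> H))\<^esub> euler_restriction H \<theta>" for r
    proof (rule extensionalityI[of _ "carrier (coord_ring_in H)"])
      fix G assume "G \<in> carrier (coord_ring_in H)"
      then obtain f where "G = reduce_mod H f" by (auto simp: carrier_coord_ring_in)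
      then show "euler_restriction H (r \<odot>\<^bsub>log_mod \<A>\<^esub> \<theta>) G = (r \<odot>\<^bsub>restrict_scalars (reduce_mod H) (log_mod_in H (restriction \<A> H))\<^esub> euler_restriction H \<theta>) G"
        using \<theta> by (simp add: log_mod_in_simps reduce_mod_closed e log_mod_smult reduce_mod_mult)
    qed (simp_all add: euler_restriction_def log_mod_in_simps)
    fix \<eta> assume \<eta>: "\<eta> \<in> carrier (log_mod \<A>)"
    show "euler_restriction H (\<theta> \<oplus>\<^bsub>log_mod \<A>\<^esub> \<eta>) =
      euler_restriction H \<theta> \<oplus>\<^bsub>restrict_scalars (reduce_mod H) (log_mod_in H (restriction \<A> H))\<^esub> euler_restriction H \<eta>"
    proof (rule extensionalityI[of _ "carrier (coord_ring_in H)"])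
      fix G assume "G \<in> carrier (coord_ring_in H)"
      then obtain f where "G = reduce_mod H f" by (auto simp: carrier_coord_ring_in)
      then show "euler_restriction H (\<theta> \<oplus>\<^bsub>log_mod \<A>\<^esub> \<eta>) G =
          (euler_restriction H \<theta> \<oplus>\<^bsub>restrict_scalars (reduce_mod H) (log_mod_in H (restriction \<A> H))\<^esub> euler_restriction H \<eta>) G"
        using \<theta> \<eta> by (simp add: log_mod_in_simps reduce_mod_closed e log_mod_add reduce_mod_add)
    qed (simp_all add: euler_restriction_def log_mod_in_simps)
  }
qed

text \<open>Multiplication by the form of \<open>H\<close> identifies \<open>D(\<A>')\<close> with
  the kernel; that every element of the kernel is reached is \<open>log_mod_divide\<close>.\<close>

lemma pd_ker_euler_restriction:
  assumes "arrangement \<A>" "H \<in> \<A>"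
  shows "pd coord_ring (ker_mod (log_mod \<A>) (restrict_scalars (reduce_mod H) (log_mod_in H (restriction \<A> H))) (euler_restriction H)) =
    pd_arr (\<A> - {H})"
proof -
  let ?N = "restrict_scalars (reduce_mod H) (log_mod_in H (restriction \<A> H))"
  let ?K = "ker_mod (log_mod \<A>) ?N (euler_restriction H)"
  let ?m = "\<lambda>\<zeta> f. dform H * \<zeta> f"
  have H: "hyperplane H" by (rule arrangement_hyperplane[OF assms])
  have "euler_restriction H (\<lambda>f. 0) = \<zero>\<^bsub>?N\<^esub>"
  proof (rule extensionalityI[of _ "carrier (coord_ring_in H)"])
    fix G assume "G \<in> carrier (coord_ring_in H)"
    then obtain f where "G = reduce_mod H f" by (auto simp: carrier_coord_ring_in)
    then show "euler_restriction H (\<lambda>f. 0) G = \<zero>\<^bsub>?N\<^esub> G"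
      by (simp add: log_mod_in_simps reduce_mod_closed reduce_mod_0 euler_restriction_apply zero_in_Der)
  qed (simp_all add: euler_restriction_def log_mod_in_simps)
  then have K: "\<theta> \<in> carrier ?K \<longleftrightarrow> \<theta> \<in> carrier (log_mod \<A>) \<and> (\<forall>f. dform H dvd \<theta> f)" for \<theta>
    using euler_restriction_eq_iff[of \<theta> H "\<lambda>f. 0"] assms(2) by (auto simp: log_mod_carrier zero_in_Der)
  have "module coord_ring ?K"
    by (rule module_ker_mod[OF module_log_mod _ euler_restriction_hom[OF assms]])
      (intro module_restrict_scalars[OF module_log_mod_in cring_coord_ring reduce_mod_ring_hom])
  moreover have "?m \<in> module_hom coord_ring (log_mod (\<A> - {H})) ?K"
  proof (rule module_homI)
    show "?m \<zeta> \<in> carrier ?K" if "\<zeta> \<in> carrier (log_mod (\<A> - {H}))" for \<zeta>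
      unfolding K using log_mod_times[OF that] by simp
  qed (auto simp: distrib_left mult.left_commute)
  moreover have "bij_betw ?m (carrier (log_mod (\<A> - {H}))) (carrier ?K)"
  proof (rule bij_betw_imageI)
    show "inj_on ?m (carrier (log_mod (\<A> - {H})))"
    proof (rule inj_onI, rule ext)
      fix \<zeta> \<eta> f assume "?m \<zeta> = ?m \<eta>"
      then have "dform H * (\<zeta> f - \<eta> f) = 0" by (simp add: right_diff_distrib fun_eq_iff)
      then show "\<zeta> f = \<eta> f" using poly_no_zero_divisors dform_nonzero[OF H] by fastforce
    qed
    show "?m ` carrier (log_mod (\<A> - {H})) = carrier ?K"
    proof (intro equalityI subsetI)
      fix \<psi> assume "\<psi> \<in> carrier ?K"
      then obtain \<zeta> where "\<zeta> \<in> carrier (log_mod (\<A> - {H}))" "\<And>f. \<psi> f = dform H * \<zeta> f"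
        using log_mod_divide[OF assms(2) arrangement_hyperplane[OF assms(1)], of \<psi>] unfolding K by blast
      then show "\<psi> \<in> ?m ` carrier (log_mod (\<A> - {H}))" by (intro image_eqI[of _ _ \<zeta>]) auto
    next
      fix \<psi> assume "\<psi> \<in> ?m ` carrier (log_mod (\<A> - {H}))"
      then show "\<psi> \<in> carrier ?K" unfolding K using log_mod_times by auto
    qed
  qed
  ultimately show ?thesis unfolding pd_arr_def using pd_iso[OF module_log_mod] by metis
qed

text \<open>The cases compare pd + 1 with \<open>k\<close>, since k - 1 would be truncated at k = 0.
  They are decided by three implications between finite bounds: \<open>sub\<close>,
  \<open>quot\<close> and \<open>mid\<close>, one for each term of the Euler sequence.\<close>

theorem theorem1p6:
  fixes \<A> :: "('k::field ^ 'n::finite) set set" and H :: "('k ^ 'n) set" and k :: nat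
  assumes "arrangement \<A>" and "H \<in> \<A>"
    and "locally_surjective_codim_three \<A> H"
    and "pd_arr \<A> = enat k"
    and "deletion_NMPD \<A> H"
  shows "(pd_arr_in H (restriction \<A> H) + 1 = enat k \<longrightarrow> pd_arr (\<A> - {H}) \<le> enat k) \<and>
    (pd_arr_in H (restriction \<A> H) + 1 > enat k \<longrightarrow>
      pd_arr (\<A> - {H}) = pd_arr_in H (restriction \<A> H)) \<and>
    (pd_arr_in H (restriction \<A> H) + 1 < enat k \<longrightarrow>
      pd_arr (\<A> - {H}) = pd_arr \<A> \<and> pd_arr \<A> > pd_arr_in H (restriction \<A> H) + 1)"
proof -
  let ?N = "restrict_scalars (reduce_mod H) (log_mod_in H (restriction \<A> H))"
  define l q where "l = pd_arr (\<A> - {H})" and "q = pd_arr_in H (restriction \<A> H)"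
  have N: "module coord_ring ?N"
    by (rule module_restrict_scalars[OF module_log_mod_in cring_coord_ring reduce_mod_ring_hom])
  have surj: "euler_restriction H ` carrier (log_mod \<A>) = carrier ?N"
    using euler_restriction_surj[OF assms(1-3,5)] by simp
  note ses = module_log_mod N euler_restriction_hom[OF assms(1,2)] surj
  have k: "pd coord_ring (log_mod \<A>) = enat k" using assms(4) by (simp add: pd_arr_def)
  note l = pd_ker_euler_restriction[OF assms(1,2), folded l_def]
  obtain \<delta> where \<delta>: "hypersurface_quotient coord_ring (coord_ring_in H) (reduce_mod H) (dform H) \<delta>"
    using hypersurface_quotient_coord_ring[OF arrangement_hyperplane[OF assms(1,2)]] by blast
  \<comment> \<open>Restriction of scalars raises the projective dimension by one, which shifts the
    bounds on \<open>q\<close> in the implications below.\<close>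
  have q: "pd coord_ring ?N \<le> enat (Suc m) \<longleftrightarrow> q \<le> enat m" for m
    unfolding q_def pd_arr_in_def by (rule hypersurface_quotient.pd_restrict_scalars[OF \<delta> module_log_mod_in])
  have sub: "l \<le> enat a" if "k \<le> a" "q \<le> enat a" for a
    using pd_kernel[OF ses, of a] that by (simp add: k l q)
  have quot: "q \<le> enat a" if "k \<le> Suc a" "l \<le> enat a" for a
    using pd_quotient[OF ses, of a] that by (simp add: k l q)
  have mid: "k \<le> Suc a" if "l \<le> enat (Suc a)" "q \<le> enat a" for a
    using pd_extension[OF ses, of "Suc a"] that by (simp add: k l q)
  have 1: "l \<le> enat k" if "q + 1 = enat k"
    using that by (intro sub) (cases q; auto simp: one_enat_def)+
  have 2: "l = q" if "q + 1 > enat k"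
  proof (cases q)
    case (enat q')
    then have "k \<le> q'" using that by (simp add: one_enat_def)
    then have "l \<le> q" using sub[of q'] enat by simp
    moreover have "q \<le> l"
    proof (rule ccontr)
      assume "\<not> q \<le> l"
      then obtain l' where l': "l = enat l'" "l' < q'" using enat by (cases l) auto
      \<comment> \<open>\<open>a\<close> is q' - 1, so the quotient estimate would give q \<le> q' -
        1.\<close>
      then obtain a where a: "q' = Suc a" "l' \<le> a" by (cases q') auto
      then show False using quot[of a] \<open>k \<le> q'\<close> l' enat by simp
    qed
    ultimately show ?thesis by simp
  next
    case infinity
    show ?thesis
    proof (cases l)
      case (enat l')
      \<comment> \<open>If \<open>l\<close> were finite, a bound dominating both \<open>l'\<close>
        and \<open>k\<close> would make \<open>q\<close> finite.\<close>
      moreover have "k \<le> Suc (max l' k)" by linarith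
      ultimately show ?thesis using quot[of "max l' k"] infinity by simp
    qed (simp add: infinity)
  qed
  have 3: "l = enat k" if lt: "q + 1 < enat k"
  proof -
    obtain q' where q': "q = enat q'" "Suc q' < k" using lt by (cases q) (auto simp: one_enat_def)
    have "l \<le> enat k" using sub[of k] q' by simp
    moreover have "enat k \<le> l"
    proof (rule ccontr)
      assume "\<not> enat k \<le> l"
      then obtain l' where l': "l = enat l'" "l' < k" by (cases l) auto
      \<comment> \<open>Here k \<ge> 2, l \<le> k - 1 and q \<le> k - 2, so the extension estimate
        would give k \<le> k - 1.\<close>
      have a: "k = Suc (Suc (k - 2))" "q' \<le> k - 2" using q'(2) by linarith+
      then show False using mid[of "k - 2"] l' q' by simp
    qed
    ultimately show ?thesis by simp
  qed
  show ?thesis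
    unfolding l_def[symmetric] q_def[symmetric] assms(4) using 1 2 3 by blast
qed

end
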